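(* Let $k$ be a field. If $A$ and $B$ are $k$-linearly Morita equivalent $k$-algebras, then $A$ is a homologically smooth $k$-algebra if and only if $B$ is.
   Context: Algebras are unital and associative over the arbitrary field $k$. Two $k$-algebras are $k$-linearly Morita equivalent if their categories of left modules are equivalent via a $k$-linear equivalence of categories. With $A^e=A\otimes_kA^{\mathrm{op}}$, $A$ is homologically smooth over $k$ if $A$ has a finite-length resolution by finitely generated projective left $A^e$-modules. *)

theory Defs
  imports "HOL-Algebra.Module" "HOL-Algebra.QuotRing"
begin

section \<open>Algebras over a field\<close>

text \<open>The library locale \<open>algebra\<close> is restricted to commutative algebras. The zero
  algebra is admitted.\<close>

locale k_algebra = R?: field R + module R M + M?: ring M
  for R (structure) and M (structure) +
  assumes smult_mult_left:
      "\<lbrakk>a \<in> carrier R; x \<in> carrier M; y \<in> carrier M\<rbrakk> \<Longrightarrow>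
        (a \<odot>\<^bsub>M\<^esub> x) \<otimes>\<^bsub>M\<^esub> y = a \<odot>\<^bsub>M\<^esub> (x \<otimes>\<^bsub>M\<^esub> y)"
    and smult_mult_right:
      "\<lbrakk>a \<in> carrier R; x \<in> carrier M; y \<in> carrier M\<rbrakk> \<Longrightarrow>
        x \<otimes>\<^bsub>M\<^esub> (a \<odot>\<^bsub>M\<^esub> y) = a \<odot>\<^bsub>M\<^esub> (x \<otimes>\<^bsub>M\<^esub> y)"

definition opposite :: "('k, 'a, 'y) module_scheme \<Rightarrow> ('k, 'a, 'y) module_scheme"
  where "opposite A = A\<lparr>mult := \<lambda>x y. y \<otimes>\<^bsub>A\<^esub> x\<rparr>"


section \<open>Left modules over a noncommutative ring\<close>

text \<open>As for the library locale \<open>module\<close>, the \<^term>\<open>mult\<close> and \<^term>\<open>one\<close> fields of the record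
  carrying the module structure are irrelevant.\<close>

locale left_module = R?: ring R + M?: abelian_group M
  for R :: "('r, 'x) ring_scheme" (structure) and M :: "('r, 'm, 'y) module_scheme" (structure) +
  assumes lsmult_closed [simp, intro]:
      "\<lbrakk>a \<in> carrier R; x \<in> carrier M\<rbrakk> \<Longrightarrow> a \<odot>\<^bsub>M\<^esub> x \<in> carrier M"
    and lsmult_l_distr:
      "\<lbrakk>a \<in> carrier R; b \<in> carrier R; x \<in> carrier M\<rbrakk> \<Longrightarrow>
        (a \<oplus> b) \<odot>\<^bsub>M\<^esub> x = a \<odot>\<^bsub>M\<^esub> x \<oplus>\<^bsub>M\<^esub> b \<odot>\<^bsub>M\<^esub> x"
    and lsmult_r_distr:
      "\<lbrakk>a \<in> carrier R; x \<in> carrier M; y \<in> carrier M\<rbrakk> \<Longrightarrow>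
        a \<odot>\<^bsub>M\<^esub> (x \<oplus>\<^bsub>M\<^esub> y) = a \<odot>\<^bsub>M\<^esub> x \<oplus>\<^bsub>M\<^esub> a \<odot>\<^bsub>M\<^esub> y"
    and lsmult_assoc:
      "\<lbrakk>a \<in> carrier R; b \<in> carrier R; x \<in> carrier M\<rbrakk> \<Longrightarrow>
        (a \<otimes> b) \<odot>\<^bsub>M\<^esub> x = a \<odot>\<^bsub>M\<^esub> (b \<odot>\<^bsub>M\<^esub> x)"
    and lsmult_one [simp]: "x \<in> carrier M \<Longrightarrow> \<one> \<odot>\<^bsub>M\<^esub> x = x"

text \<open>Homomorphisms are extensional outside the carrier of their source, so that equality of
  morphisms is equality of functions.\<close>

definition mod_hom ::
    "('r, 'x) ring_scheme \<Rightarrow> ('r, 'm, 'y) module_scheme \<Rightarrow> ('r, 'n, 'z) module_scheme \<Rightarrow> ('m \<Rightarrow> 'n) set"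
  where "mod_hom R M N = {f \<in> carrier M \<rightarrow>\<^sub>E carrier N.
    (\<forall>x\<in>carrier M. \<forall>y\<in>carrier M. f (x \<oplus>\<^bsub>M\<^esub> y) = f x \<oplus>\<^bsub>N\<^esub> f y) \<and>
    (\<forall>r\<in>carrier R. \<forall>x\<in>carrier M. f (r \<odot>\<^bsub>M\<^esub> x) = r \<odot>\<^bsub>N\<^esub> f x)}"

definition mod_id :: "('r, 'm, 'y) module_scheme \<Rightarrow> 'm \<Rightarrow> 'm"
  where "mod_id M = (\<lambda>x\<in>carrier M. x)"

definition fin_gen_module :: "('r, 'x) ring_scheme \<Rightarrow> ('r, 'm, 'y) module_scheme \<Rightarrow> bool"
  where "fin_gen_module R M \<longleftrightarrow> (\<exists>S. finite S \<and> S \<subseteq> carrier M \<and>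
    (\<forall>x\<in>carrier M. \<exists>r\<in>S \<rightarrow> carrier R. x = (\<Oplus>\<^bsub>M\<^esub>s\<in>S. r s \<odot>\<^bsub>M\<^esub> s)))"

text \<open>The lifting property. A definition cannot quantify over types, so it is tested against
  surjections \<open>M \<rightarrow> N\<close> with \<open>N\<close> on the carrier type of \<open>P\<close> and \<open>M\<close> on the type of functions
  \<^typ>\<open>'p \<Rightarrow> 'r\<close>, where the free module on the set \<^term>\<open>carrier P\<close> lives. Hence the canonical
  surjection from that free module splits, and \<open>P\<close> has the lifting property against
  surjections between modules on arbitrary types (\<open>projective_module_lifting\<close> below).\<close>

definition projective_module :: "('r, 'x) ring_scheme \<Rightarrow> ('r, 'p) module \<Rightarrow> bool"
  where "projective_module R P \<longleftrightarrow> left_module R P \<and>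
    (\<forall>(M :: ('r, 'p \<Rightarrow> 'r) module) (N :: ('r, 'p) module). \<forall>q\<in>mod_hom R M N. \<forall>f\<in>mod_hom R P N.
      left_module R M \<longrightarrow> left_module R N \<longrightarrow> q ` carrier M = carrier N \<longrightarrow>
      (\<exists>g\<in>mod_hom R P M. compose (carrier P) q g = f))"

text \<open>A resolution \<open>0 \<rightarrow> P n \<rightarrow> \<dots> \<rightarrow> P 0 \<rightarrow> M \<rightarrow> 0\<close>, continued by zero modules; \<^term>\<open>e\<close> is the
  augmentation. Every finitely generated module over \<open>R\<close> is isomorphic to one whose carrier lies
  in \<^typ>\<open>nat \<Rightarrow> 'r\<close>: it is a quotient of some \<open>R\<^sup>n\<close>, and its elements may be replaced by
  representatives. So the choice of the carrier type of the \<open>P i\<close> is no restriction.\<close>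

definition has_finite_fgproj_resolution ::
    "('r, 'x) ring_scheme \<Rightarrow> ('r, 'm, 'y) module_scheme \<Rightarrow> bool"
  where "has_finite_fgproj_resolution R M \<longleftrightarrow>
    (\<exists>(P :: nat \<Rightarrow> ('r, nat \<Rightarrow> 'r) module) d e.
      (\<forall>i. fin_gen_module R (P i) \<and> projective_module R (P i)) \<and>
      (\<forall>i. d i \<in> mod_hom R (P (Suc i)) (P i)) \<and>
      e \<in> mod_hom R (P 0) M \<and>
      e ` carrier (P 0) = carrier M \<and>
      d 0 ` carrier (P (Suc 0)) = {x \<in> carrier (P 0). e x = \<zero>\<^bsub>M\<^esub>} \<and>
      (\<forall>i. d (Suc i) ` carrier (P (Suc (Suc i))) = {x \<in> carrier (P (Suc i)). d i x = \<zero>\<^bsub>P i\<^esub>}) \<and>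
      (\<exists>n. \<forall>i>n. carrier (P i) = {\<zero>\<^bsub>P i\<^esub>}))"


section \<open>Tensor products of algebras\<close>

definition fsupp :: "('k, 'x) ring_scheme \<Rightarrow> ('p \<Rightarrow> 'k) \<Rightarrow> 'p set"
  where "fsupp K f = {p. f p \<noteq> \<zero>\<^bsub>K\<^esub>}"

definition fin_supp_funs :: "('k, 'x) ring_scheme \<Rightarrow> 'p set \<Rightarrow> ('p \<Rightarrow> 'k) set"
  where "fin_supp_funs K S = {f. range f \<subseteq> carrier K \<and> finite (fsupp K f) \<and> fsupp K f \<subseteq> S}"

definition single :: "('k, 'x) ring_scheme \<Rightarrow> 'k \<Rightarrow> 'p \<Rightarrow> 'p \<Rightarrow> 'k"
  where "single K c p = (\<lambda>q. if q = p then c else \<zero>\<^bsub>K\<^esub>)"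

definition monoid_algebra ::
    "('k, 'x) ring_scheme \<Rightarrow> ('g, 'y) monoid_scheme \<Rightarrow> ('g \<Rightarrow> 'k) ring"
  where "monoid_algebra K G =
    \<lparr>carrier = fin_supp_funs K (carrier G),
     mult = \<lambda>f g p. \<Oplus>\<^bsub>K\<^esub>q\<in>fsupp K f. \<Oplus>\<^bsub>K\<^esub>r\<in>fsupp K g.
              if q \<otimes>\<^bsub>G\<^esub> r = p then f q \<otimes>\<^bsub>K\<^esub> g r else \<zero>\<^bsub>K\<^esub>,
     one = single K \<one>\<^bsub>K\<^esub> \<one>\<^bsub>G\<^esub>,
     zero = \<lambda>p. \<zero>\<^bsub>K\<^esub>,
     add = \<lambda>f g p. f p \<oplus>\<^bsub>K\<^esub> g p\<rparr>"

text \<open>\<open>A \<otimes>\<^sub>K B\<close> is the free \<open>K\<close>-module on the symbols \<open>(a, b)\<close> modulo the span of the bilinearity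
  relations, with \<open>(a \<otimes> b)(a' \<otimes> b') = aa' \<otimes> bb'\<close>. This product is that of the monoid algebra of
  the multiplicative monoid \<open>A \<times>\<times> B\<close>. A product of a symbol with a relation is again a
  relation, so the ideal generated by the relations is their span.\<close>

definition tensor_relations ::
    "('k, 'x) ring_scheme \<Rightarrow> ('k, 'a, 'y) module_scheme \<Rightarrow> ('k, 'b, 'z) module_scheme
      \<Rightarrow> ('a \<times> 'b \<Rightarrow> 'k) set"
  where "tensor_relations K A B = (let F = monoid_algebra K (A \<times>\<times> B); \<delta> = single K \<one>\<^bsub>K\<^esub> in
      {\<delta> (a \<oplus>\<^bsub>A\<^esub> a', b) \<ominus>\<^bsub>F\<^esub> (\<delta> (a, b) \<oplus>\<^bsub>F\<^esub> \<delta> (a', b)) | a a' b.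
        a \<in> carrier A \<and> a' \<in> carrier A \<and> b \<in> carrier B}
    \<union> {\<delta> (a, b \<oplus>\<^bsub>B\<^esub> b') \<ominus>\<^bsub>F\<^esub> (\<delta> (a, b) \<oplus>\<^bsub>F\<^esub> \<delta> (a, b')) | a b b'.
        a \<in> carrier A \<and> b \<in> carrier B \<and> b' \<in> carrier B}
    \<union> {\<delta> (c \<odot>\<^bsub>A\<^esub> a, b) \<ominus>\<^bsub>F\<^esub> single K c (a, b) | c a b.
        c \<in> carrier K \<and> a \<in> carrier A \<and> b \<in> carrier B}
    \<union> {\<delta> (a, c \<odot>\<^bsub>B\<^esub> b) \<ominus>\<^bsub>F\<^esub> single K c (a, b) | c a b.
        c \<in> carrier K \<and> a \<in> carrier A \<and> b \<in> carrier B})"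

definition tensor_algebra ::
    "('k, 'x) ring_scheme \<Rightarrow> ('k, 'a, 'y) module_scheme \<Rightarrow> ('k, 'b, 'z) module_scheme
      \<Rightarrow> ('a \<times> 'b \<Rightarrow> 'k) set ring"
  where "tensor_algebra K A B =
    monoid_algebra K (A \<times>\<times> B) Quot (genideal (monoid_algebra K (A \<times>\<times> B)) (tensor_relations K A B))"


section \<open>Homological smoothness\<close>

definition enveloping_algebra ::
    "('k, 'x) ring_scheme \<Rightarrow> ('k, 'a, 'y) module_scheme \<Rightarrow> ('a \<times> 'a \<Rightarrow> 'k) set ring"
  where "enveloping_algebra K A = tensor_algebra K A (opposite A)"

text \<open>\<open>A\<close> as a left module over its enveloping algebra: \<open>(a \<otimes> b) x = a x b\<close>, extended linearly to
  representatives \<^term>\<open>f\<close>. The value does not depend on the representative, so the image of a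
  coset is a singleton (\<open>smult_coset\<close> below).\<close>

definition bimodule_action ::
    "('k, 'x) ring_scheme \<Rightarrow> ('k, 'a, 'y) module_scheme \<Rightarrow> ('a \<times> 'a \<Rightarrow> 'k) \<Rightarrow> 'a \<Rightarrow> 'a"
  where "bimodule_action K A f x =
    (\<Oplus>\<^bsub>A\<^esub>p\<in>fsupp K f. f p \<odot>\<^bsub>A\<^esub> (fst p \<otimes>\<^bsub>A\<^esub> x \<otimes>\<^bsub>A\<^esub> snd p))"

definition regular_bimodule ::
    "('k, 'x) ring_scheme \<Rightarrow> ('k, 'a, 'y) module_scheme \<Rightarrow> (('a \<times> 'a \<Rightarrow> 'k) set, 'a) module"
  where "regular_bimodule K A =
    \<lparr>carrier = carrier A, mult = mult A, one = one A, zero = zero A, add = add A,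
     smult = \<lambda>T x. the_elem ((\<lambda>f. bimodule_action K A f x) ` T)\<rparr>"

definition homologically_smooth ::
    "('k, 'x) ring_scheme \<Rightarrow> ('k, 'a, 'y) module_scheme \<Rightarrow> bool"
  where "homologically_smooth K A \<longleftrightarrow>
    has_finite_fgproj_resolution (enveloping_algebra K A) (regular_bimodule K A)"


section \<open>Linear equivalences of module categories\<close>

text \<open>The objects of the category of left \<open>R\<close>-modules in the universe \<^typ>\<open>'u\<close> are the left modules
  with carrier a subset of \<^typ>\<open>'u\<close>; the morphisms are given by \<^const>\<open>mod_hom\<close>, and the
  composite of \<open>f\<close> and \<open>g\<close> with \<open>f\<close> defined on \<open>M\<close> is \<^term>\<open>compose (carrier M) g f\<close>.\<close>

definition Mod_obj :: "('r, 'x) ring_scheme \<Rightarrow> ('r, 'u) module set"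
  where "Mod_obj R = {M. left_module R M}"

record ('r, 's, 'u) mod_functor =
  obj_map :: "('r, 'u) module \<Rightarrow> ('s, 'u) module"
  arr_map :: "('r, 'u) module \<Rightarrow> ('r, 'u) module \<Rightarrow> ('u \<Rightarrow> 'u) \<Rightarrow> 'u \<Rightarrow> 'u"

definition is_functor ::
    "('r, 'x) ring_scheme \<Rightarrow> ('s, 'y) ring_scheme \<Rightarrow> ('r, 's, 'u) mod_functor \<Rightarrow> bool"
  where "is_functor R S F \<longleftrightarrow>
    (\<forall>M\<in>Mod_obj R. obj_map F M \<in> Mod_obj S) \<and>
    (\<forall>M\<in>Mod_obj R. \<forall>N\<in>Mod_obj R. \<forall>f\<in>mod_hom R M N.
      arr_map F M N f \<in> mod_hom S (obj_map F M) (obj_map F N)) \<and>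
    (\<forall>M\<in>Mod_obj R. arr_map F M M (mod_id M) = mod_id (obj_map F M)) \<and>
    (\<forall>L\<in>Mod_obj R. \<forall>M\<in>Mod_obj R. \<forall>N\<in>Mod_obj R. \<forall>f\<in>mod_hom R L M. \<forall>g\<in>mod_hom R M N.
      arr_map F L N (compose (carrier L) g f) =
        compose (carrier (obj_map F L)) (arr_map F M N g) (arr_map F L M f))"

definition id_functor :: "('r, 'r, 'u) mod_functor"
  where "id_functor = \<lparr>obj_map = \<lambda>M. M, arr_map = \<lambda>M N f. f\<rparr>"

definition comp_functor ::
    "('s, 't, 'u) mod_functor \<Rightarrow> ('r, 's, 'u) mod_functor \<Rightarrow> ('r, 't, 'u) mod_functor"
  where "comp_functor G F =
    \<lparr>obj_map = \<lambda>M. obj_map G (obj_map F M),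
     arr_map = \<lambda>M N f. arr_map G (obj_map F M) (obj_map F N) (arr_map F M N f)\<rparr>"

definition mod_iso ::
    "('r, 'x) ring_scheme \<Rightarrow> ('r, 'm, 'y) module_scheme \<Rightarrow> ('r, 'n, 'z) module_scheme \<Rightarrow> ('m \<Rightarrow> 'n) set"
  where "mod_iso R M N = {f \<in> mod_hom R M N. \<exists>g\<in>mod_hom R N M.
    compose (carrier M) g f = mod_id M \<and> compose (carrier N) f g = mod_id N}"

definition naturally_isomorphic ::
    "('r, 'x) ring_scheme \<Rightarrow> ('s, 'y) ring_scheme
      \<Rightarrow> ('r, 's, 'u) mod_functor \<Rightarrow> ('r, 's, 'u) mod_functor \<Rightarrow> bool"
  where "naturally_isomorphic R S F G \<longleftrightarrow> (\<exists>\<eta> :: ('r, 'u) module \<Rightarrow> 'u \<Rightarrow> 'u.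
    (\<forall>M\<in>Mod_obj R. \<eta> M \<in> mod_iso S (obj_map F M) (obj_map G M)) \<and>
    (\<forall>M\<in>Mod_obj R. \<forall>N\<in>Mod_obj R. \<forall>f\<in>mod_hom R M N.
      compose (carrier (obj_map F M)) (\<eta> N) (arr_map F M N f) =
      compose (carrier (obj_map F M)) (arr_map G M N f) (\<eta> M)))"

definition is_equivalence ::
    "('r, 'x) ring_scheme \<Rightarrow> ('s, 'y) ring_scheme \<Rightarrow> ('r, 's, 'u) mod_functor \<Rightarrow> bool"
  where "is_equivalence R S F \<longleftrightarrow> is_functor R S F \<and>
    (\<exists>G. is_functor S R G \<and>
      naturally_isomorphic R R id_functor (comp_functor G F) \<and>
      naturally_isomorphic S S (comp_functor F G) id_functor)"

text \<open>The \<open>K\<close>-vector space structure on the set of \<open>A\<close>-linear maps from \<open>M\<close> to \<open>N\<close>, where \<open>K\<close> acts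
  on \<open>N\<close> through \<open>K \<rightarrow> A\<close>.\<close>

definition hom_add ::
    "('r, 'm, 'y) module_scheme \<Rightarrow> ('r, 'n, 'z) module_scheme
      \<Rightarrow> ('m \<Rightarrow> 'n) \<Rightarrow> ('m \<Rightarrow> 'n) \<Rightarrow> 'm \<Rightarrow> 'n"
  where "hom_add M N f g = (\<lambda>x\<in>carrier M. f x \<oplus>\<^bsub>N\<^esub> g x)"

definition hom_scale ::
    "('k, 'a, 'x) module_scheme \<Rightarrow> ('a, 'm, 'y) module_scheme \<Rightarrow> ('a, 'n, 'z) module_scheme
      \<Rightarrow> 'k \<Rightarrow> ('m \<Rightarrow> 'n) \<Rightarrow> 'm \<Rightarrow> 'n"
  where "hom_scale A M N c f = (\<lambda>x\<in>carrier M. (c \<odot>\<^bsub>A\<^esub> \<one>\<^bsub>A\<^esub>) \<odot>\<^bsub>N\<^esub> f x)"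

definition k_linear_functor ::
    "('k, 'x) ring_scheme \<Rightarrow> ('k, 'a, 'y) module_scheme \<Rightarrow> ('k, 'b, 'z) module_scheme
      \<Rightarrow> ('a, 'b, 'u) mod_functor \<Rightarrow> bool"
  where "k_linear_functor K A B F \<longleftrightarrow>
    (\<forall>M\<in>Mod_obj A. \<forall>N\<in>Mod_obj A. \<forall>f\<in>mod_hom A M N.
      (\<forall>g\<in>mod_hom A M N. arr_map F M N (hom_add M N f g) =
        hom_add (obj_map F M) (obj_map F N) (arr_map F M N f) (arr_map F M N g)) \<and>
      (\<forall>c\<in>carrier K. arr_map F M N (hom_scale A M N c f) =
        hom_scale B (obj_map F M) (obj_map F N) c (arr_map F M N f)))"

text \<open>The first argument only names the universe \<^typ>\<open>'u\<close>. The notion is meaningful when \<^typ>\<open>'u\<close> is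
  infinite and at least as large as both algebras (\<open>universe_for\<close>): otherwise \<^typ>\<open>'u\<close> may
  carry too few modules.\<close>

definition morita_equivalent ::
    "'u itself \<Rightarrow> ('k, 'x) ring_scheme \<Rightarrow> ('k, 'a, 'y) module_scheme
      \<Rightarrow> ('k, 'b, 'z) module_scheme \<Rightarrow> bool"
  where "morita_equivalent U K A B \<longleftrightarrow>
    (\<exists>F :: ('a, 'b, 'u) mod_functor. is_equivalence A B F \<and> k_linear_functor K A B F)"

definition universe_for :: "'u itself \<Rightarrow> ('k, 'a, 'y) module_scheme \<Rightarrow> bool"
  where "universe_for U A \<longleftrightarrow>
    infinite (UNIV :: 'u set) \<and> (\<exists>i :: 'a \<Rightarrow> 'u. inj_on i (carrier A))"

section \<open>Linear extension, free modules and the lifting property\<close>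

lemma fin_supp_funsD:
  assumes "f \<in> fin_supp_funs K S"
  shows "f p \<in> carrier K" "finite (fsupp K f)" "fsupp K f \<subseteq> S"
  using assms by (auto simp: fin_supp_funs_def)

lemma fin_supp_funs_add:
  assumes "ring K" "f \<in> fin_supp_funs K S" "g \<in> fin_supp_funs K S"
  shows "(\<lambda>p. f p \<oplus>\<^bsub>K\<^esub> g p) \<in> fin_supp_funs K S"
    and "fsupp K (\<lambda>p. f p \<oplus>\<^bsub>K\<^esub> g p) \<subseteq> fsupp K f \<union> fsupp K g"
proof -
  interpret ring K by fact
  show *: "fsupp K (\<lambda>p. f p \<oplus>\<^bsub>K\<^esub> g p) \<subseteq> fsupp K f \<union> fsupp K g"
    by (auto simp: fsupp_def)
  show "(\<lambda>p. f p \<oplus>\<^bsub>K\<^esub> g p) \<in> fin_supp_funs K S"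
    using assms(2,3) finite_subset[OF *] *
    by (auto simp: fin_supp_funs_def image_subset_iff) 
qed

lemma fin_supp_funs_scale:
  assumes "ring K" "f \<in> fin_supp_funs K S" "c \<in> carrier K"
  shows "(\<lambda>p. c \<otimes>\<^bsub>K\<^esub> f p) \<in> fin_supp_funs K S"
    and "fsupp K (\<lambda>p. c \<otimes>\<^bsub>K\<^esub> f p) \<subseteq> fsupp K f"
proof -
  interpret ring K by fact
  show *: "fsupp K (\<lambda>p. c \<otimes>\<^bsub>K\<^esub> f p) \<subseteq> fsupp K f"
    using assms(3) by (auto simp: fsupp_def)
  show "(\<lambda>p. c \<otimes>\<^bsub>K\<^esub> f p) \<in> fin_supp_funs K S"
    using assms(2,3) finite_subset[OF *] *
    by (auto simp: fin_supp_funs_def image_subset_iff) 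
qed

lemma fin_supp_funs_neg:
  assumes "ring K" "f \<in> fin_supp_funs K S"
  shows "(\<lambda>p. \<ominus>\<^bsub>K\<^esub> f p) \<in> fin_supp_funs K S"
proof -
  interpret ring K by fact
  have *: "fsupp K (\<lambda>p. \<ominus>\<^bsub>K\<^esub> f p) \<subseteq> fsupp K f"
    by (auto simp: fsupp_def)
  show ?thesis
    using assms(2) finite_subset[OF *] *
    by (auto simp: fin_supp_funs_def image_subset_iff) 
qed

lemma fin_supp_funs_zero: "ring K \<Longrightarrow> (\<lambda>p. \<zero>\<^bsub>K\<^esub>) \<in> fin_supp_funs K S"
proof -
  assume "ring K" then interpret ring K .
  show ?thesis by (auto simp: fin_supp_funs_def fsupp_def)
qed

lemma single_in:
  assumes "ring K" "c \<in> carrier K" "p \<in> S"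
  shows "single K c p \<in> fin_supp_funs K S" "fsupp K (single K c p) \<subseteq> {p}"
proof -
  interpret ring K by fact
  show *: "fsupp K (single K c p) \<subseteq> {p}" by (auto simp: fsupp_def single_def)
  then show "single K c p \<in> fin_supp_funs K S" using assms finite_subset[OF *]
    by (auto simp: fin_supp_funs_def single_def)
qed

lemma fin_supp_induct [consumes 2, case_names zero add]:
  assumes "ring K" and "f \<in> fin_supp_funs K S"
    and "P (\<lambda>p. \<zero>\<^bsub>K\<^esub>)"
    and "\<And>c p f. \<lbrakk>c \<in> carrier K; p \<in> S; f \<in> fin_supp_funs K S; P f\<rbrakk> \<Longrightarrow>
        P (\<lambda>q. single K c p q \<oplus>\<^bsub>K\<^esub> f q)"
  shows "P f"
proof -
  interpret ring K by fact
  have "finite T \<Longrightarrow> f \<in> fin_supp_funs K S \<Longrightarrow> fsupp K f \<subseteq> T \<Longrightarrow> P f" for T f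
  proof (induction T arbitrary: f rule: finite_induct)
    case empty
    then have "f = (\<lambda>p. \<zero>\<^bsub>K\<^esub>)" by (auto simp: fsupp_def)
    then show ?case using assms(3) by simp
  next
    case (insert x T)
    show ?case
    proof (cases "f x = \<zero>\<^bsub>K\<^esub>")
      case True then show ?thesis using insert by (auto simp: fsupp_def subset_iff)
    next
      case False
      let ?g = "f(x := \<zero>\<^bsub>K\<^esub>)"
      have xS: "x \<in> S" using False insert.prems by (auto simp: fin_supp_funs_def fsupp_def)
      have sub: "fsupp K ?g \<subseteq> T" "fsupp K ?g \<subseteq> fsupp K f" using insert.prems by (auto simp: fsupp_def)
      have g: "?g \<in> fin_supp_funs K S"
        using insert.prems(1) sub finite_subset[OF sub(2)] by (auto simp: fin_supp_funs_def)
      have "f = (\<lambda>q. single K (f x) x q \<oplus>\<^bsub>K\<^esub> ?g q)"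
        using fin_supp_funsD(1)[OF insert.prems(1)] by (auto simp: single_def)
      moreover have "P (\<lambda>q. single K (f x) x q \<oplus>\<^bsub>K\<^esub> ?g q)"
        using assms(4)[OF _ xS g insert.IH[OF g sub(1)]] fin_supp_funsD(1)[OF insert.prems(1)] by blast
      ultimately show ?thesis by simp
    qed
  qed
  from this[OF fin_supp_funsD(2)[OF assms(2)] assms(2) subset_refl] show ?thesis .
qed

definition lin_ext :: "('k, 'x) ring_scheme \<Rightarrow> ('k, 'n, 'y) module_scheme \<Rightarrow> ('p \<Rightarrow> 'n) \<Rightarrow> ('p \<Rightarrow> 'k) \<Rightarrow> 'n"
  where "lin_ext K N \<phi> f = (\<Oplus>\<^bsub>N\<^esub>p\<in>fsupp K f. f p \<odot>\<^bsub>N\<^esub> \<phi> p)"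

context left_module
begin

lemma lsmult_l_null [simp]:
  assumes "x \<in> carrier M" shows "\<zero> \<odot>\<^bsub>M\<^esub> x = \<zero>\<^bsub>M\<^esub>"
proof -
  have "\<zero> \<odot>\<^bsub>M\<^esub> x \<oplus>\<^bsub>M\<^esub> \<zero> \<odot>\<^bsub>M\<^esub> x = \<zero> \<odot>\<^bsub>M\<^esub> x"
    using lsmult_l_distr[of \<zero> \<zero> x] assms by simp
  then show ?thesis using assms M.add.l_cancel_one' by (metis R.zero_closed lsmult_closed)
qed

lemma lsmult_r_null [simp]:
  assumes "a \<in> carrier R" shows "a \<odot>\<^bsub>M\<^esub> \<zero>\<^bsub>M\<^esub> = \<zero>\<^bsub>M\<^esub>"
proof -
  have "a \<odot>\<^bsub>M\<^esub> \<zero>\<^bsub>M\<^esub> \<oplus>\<^bsub>M\<^esub> a \<odot>\<^bsub>M\<^esub> \<zero>\<^bsub>M\<^esub> = a \<odot>\<^bsub>M\<^esub> \<zero>\<^bsub>M\<^esub>"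
    using lsmult_r_distr[of a "\<zero>\<^bsub>M\<^esub>" "\<zero>\<^bsub>M\<^esub>"] assms by simp
  then show ?thesis using assms M.add.l_cancel_one' by (metis M.zero_closed lsmult_closed)
qed

lemma lin_ext_superset:
  assumes "f \<in> fin_supp_funs R S" "\<phi> \<in> S \<rightarrow> carrier M" "finite T" "fsupp R f \<subseteq> T" "T \<subseteq> S"
  shows "lin_ext R M \<phi> f = (\<Oplus>\<^bsub>M\<^esub>p\<in>T. f p \<odot>\<^bsub>M\<^esub> \<phi> p)"
  unfolding lin_ext_def
  using assms fin_supp_funsD(1)[OF assms(1)]
  by (intro M.add.finprod_mono_neutral_cong_left) (auto simp: fsupp_def Pi_def subset_iff)

lemma lin_ext_closed:
  assumes "f \<in> fin_supp_funs R S" "\<phi> \<in> S \<rightarrow> carrier M"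
  shows "lin_ext R M \<phi> f \<in> carrier M"
  unfolding lin_ext_def using assms fin_supp_funsD[OF assms(1)]
  by (intro M.finsum_closed) auto

lemma lin_ext_add:
  assumes f: "f \<in> fin_supp_funs R S" and g: "g \<in> fin_supp_funs R S" and \<phi>: "\<phi> \<in> S \<rightarrow> carrier M"
  shows "lin_ext R M \<phi> (\<lambda>p. f p \<oplus> g p) = lin_ext R M \<phi> f \<oplus>\<^bsub>M\<^esub> lin_ext R M \<phi> g"
proof -
  let ?T = "fsupp R f \<union> fsupp R g"
  note D = fin_supp_funsD[OF f] fin_supp_funsD[OF g]
  have T: "finite ?T" "?T \<subseteq> S" using D by auto
  have phi: "p \<in> ?T \<Longrightarrow> \<phi> p \<in> carrier M" for p using T \<phi> by auto
  have "lin_ext R M \<phi> (\<lambda>p. f p \<oplus> g p) = (\<Oplus>\<^bsub>M\<^esub>p\<in>?T. (f p \<oplus> g p) \<odot>\<^bsub>M\<^esub> \<phi> p)"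
    using fin_supp_funs_add[OF R.ring_axioms f g] T \<phi> by (intro lin_ext_superset) auto
  also have "\<dots> = (\<Oplus>\<^bsub>M\<^esub>p\<in>?T. f p \<odot>\<^bsub>M\<^esub> \<phi> p \<oplus>\<^bsub>M\<^esub> g p \<odot>\<^bsub>M\<^esub> \<phi> p)"
    using D phi by (intro M.finsum_cong') (auto simp: lsmult_l_distr)
  also have "\<dots> = (\<Oplus>\<^bsub>M\<^esub>p\<in>?T. f p \<odot>\<^bsub>M\<^esub> \<phi> p) \<oplus>\<^bsub>M\<^esub> (\<Oplus>\<^bsub>M\<^esub>p\<in>?T. g p \<odot>\<^bsub>M\<^esub> \<phi> p)"
    using D phi by (intro M.finsum_addf) auto
  finally show ?thesis using lin_ext_superset[OF f \<phi> T(1) _ T(2)] lin_ext_superset[OF g \<phi> T(1) _ T(2)]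
    by simp
qed

lemma lin_ext_single:
  assumes "c \<in> carrier R" "p \<in> S" "\<phi> \<in> S \<rightarrow> carrier M"
  shows "lin_ext R M \<phi> (single R c p) = c \<odot>\<^bsub>M\<^esub> \<phi> p"
proof -
  have "lin_ext R M \<phi> (single R c p) = (\<Oplus>\<^bsub>M\<^esub>q\<in>{p}. single R c p q \<odot>\<^bsub>M\<^esub> \<phi> q)"
    using single_in[OF R.ring_axioms assms(1,2)] assms by (intro lin_ext_superset) auto
  also have "\<dots> = c \<odot>\<^bsub>M\<^esub> \<phi> p" using assms by (auto simp: single_def Pi_def)
  finally show ?thesis .
qed

lemma lin_ext_zero [simp]: "lin_ext R M \<phi> (\<lambda>p. \<zero>) = \<zero>\<^bsub>M\<^esub>"
  by (simp add: lin_ext_def fsupp_def)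

lemma lin_ext_scale:
  assumes f: "f \<in> fin_supp_funs R S" and c: "c \<in> carrier R" and \<phi>: "\<phi> \<in> S \<rightarrow> carrier M"
  shows "lin_ext R M \<phi> (\<lambda>p. c \<otimes> f p) = c \<odot>\<^bsub>M\<^esub> lin_ext R M \<phi> f"
  using R.ring_axioms f
proof (induction rule: fin_supp_induct)
  case zero then show ?case using c by simp
next
  case (add d p f)
  have e: "(\<lambda>q. c \<otimes> (single R d p q \<oplus> f q)) = (\<lambda>q. single R (c \<otimes> d) p q \<oplus> c \<otimes> f q)"
    using c add fin_supp_funsD(1)[OF add(3)] by (auto simp: single_def R.r_distr)
  note fss = fin_supp_funs_scale(1)[OF R.ring_axioms add(3) c] single_in(1)[OF R.ring_axioms]
  have m: "\<phi> p \<in> carrier M" using add \<phi> by auto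
  have lc: "lin_ext R M \<phi> f \<in> carrier M" using lin_ext_closed[OF add(3) \<phi>] .
  have cd: "c \<otimes> d \<in> carrier R" using c add by simp
  have "lin_ext R M \<phi> (\<lambda>q. single R (c \<otimes> d) p q \<oplus> c \<otimes> f q)
      = (c \<otimes> d) \<odot>\<^bsub>M\<^esub> \<phi> p \<oplus>\<^bsub>M\<^esub> c \<odot>\<^bsub>M\<^esub> lin_ext R M \<phi> f"
    using lin_ext_add[OF fss(2)[OF cd add(2)] fss(1) \<phi>] lin_ext_single[OF cd add(2) \<phi>] add(4) by simp
  also have "\<dots> = c \<odot>\<^bsub>M\<^esub> (d \<odot>\<^bsub>M\<^esub> \<phi> p \<oplus>\<^bsub>M\<^esub> lin_ext R M \<phi> f)"
    using lsmult_assoc[OF c add(1) m] lsmult_r_distr[OF c lsmult_closed[OF add(1) m] lc] by simp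
  also have "\<dots> = c \<odot>\<^bsub>M\<^esub> lin_ext R M \<phi> (\<lambda>q. single R d p q \<oplus> f q)"
    using lin_ext_add[OF fss(2)[OF add(1,2)] add(3) \<phi>] lin_ext_single[OF add(1,2) \<phi>] by simp
  finally show ?case unfolding e .
qed

end

definition free_module :: "('r, 'x) ring_scheme \<Rightarrow> 'p set \<Rightarrow> ('r, 'p \<Rightarrow> 'r) module"
  where "free_module R S = \<lparr>carrier = fin_supp_funs R S, mult = \<lambda>f g. f, one = (\<lambda>p. \<zero>\<^bsub>R\<^esub>),
     zero = (\<lambda>p. \<zero>\<^bsub>R\<^esub>), add = \<lambda>f g p. f p \<oplus>\<^bsub>R\<^esub> g p, smult = \<lambda>c f p. c \<otimes>\<^bsub>R\<^esub> f p\<rparr>"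

lemma free_module:
  assumes "ring R" shows "left_module R (free_module R S)"
proof -
  interpret ring R by fact
  have D: "\<forall>p. f p \<in> carrier R" if "f \<in> carrier (free_module R S)" for f
    using that fin_supp_funsD(1)[of f R S] by (simp add: free_module_def)
  have "abelian_group (free_module R S)"
  proof (rule abelian_groupI)
    fix f assume f: "f \<in> carrier (free_module R S)"
    then have f': "f \<in> fin_supp_funs R S" by (simp add: free_module_def)
    show "\<exists>g\<in>carrier (free_module R S). g \<oplus>\<^bsub>free_module R S\<^esub> f = \<zero>\<^bsub>free_module R S\<^esub>"
      by (rule bexI[of _ "\<lambda>p. \<ominus>\<^bsub>R\<^esub> f p"])
        (simp_all add: free_module_def fin_supp_funs_neg[OF assms f'] l_neg D[OF f, rule_format])
  next
    fix f g h assume "f \<in> carrier (free_module R S)" "g \<in> carrier (free_module R S)" "h \<in> carrier (free_module R S)"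
    then have "f p \<in> carrier R" "g p \<in> carrier R" "h p \<in> carrier R" for p by (blast dest: D)+
    then show "f \<oplus>\<^bsub>free_module R S\<^esub> g \<oplus>\<^bsub>free_module R S\<^esub> h = f \<oplus>\<^bsub>free_module R S\<^esub> (g \<oplus>\<^bsub>free_module R S\<^esub> h)"
      by (simp add: free_module_def a_assoc)
  next
    fix f g assume "f \<in> carrier (free_module R S)" "g \<in> carrier (free_module R S)"
    then have "f p \<in> carrier R" "g p \<in> carrier R" for p by (blast dest: D)+
    then show "f \<oplus>\<^bsub>free_module R S\<^esub> g = g \<oplus>\<^bsub>free_module R S\<^esub> f"
      by (simp add: free_module_def a_comm)
  next
    fix f assume "f \<in> carrier (free_module R S)"
    then have "f p \<in> carrier R" for p by (blast dest: D)+
    then show "\<zero>\<^bsub>free_module R S\<^esub> \<oplus>\<^bsub>free_module R S\<^esub> f = f" by (simp add: free_module_def)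
  qed (simp_all add: free_module_def fin_supp_funs_add(1)[OF assms] fin_supp_funs_zero[OF assms])
  note ag = this
  let ?F = "free_module R S"
  show ?thesis
  proof (intro left_module.intro left_module_axioms.intro assms ag)
    show "(a \<oplus>\<^bsub>R\<^esub> b) \<odot>\<^bsub>?F\<^esub> f = a \<odot>\<^bsub>?F\<^esub> f \<oplus>\<^bsub>?F\<^esub> b \<odot>\<^bsub>?F\<^esub> f"
      if "a \<in> carrier R" "b \<in> carrier R" "f \<in> carrier ?F" for a b f
      using that(1,2) D[OF that(3)] by (simp add: free_module_def l_distr)
    show "a \<odot>\<^bsub>?F\<^esub> (f \<oplus>\<^bsub>?F\<^esub> g) = a \<odot>\<^bsub>?F\<^esub> f \<oplus>\<^bsub>?F\<^esub> a \<odot>\<^bsub>?F\<^esub> g"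
      if "a \<in> carrier R" "f \<in> carrier ?F" "g \<in> carrier ?F" for a f g
      using that(1) D[OF that(2)] D[OF that(3)] by (simp add: free_module_def r_distr)
    show "(a \<otimes>\<^bsub>R\<^esub> b) \<odot>\<^bsub>?F\<^esub> f = a \<odot>\<^bsub>?F\<^esub> (b \<odot>\<^bsub>?F\<^esub> f)"
      if "a \<in> carrier R" "b \<in> carrier R" "f \<in> carrier ?F" for a b f
      using that(1,2) D[OF that(3)] by (simp add: free_module_def m_assoc)
    show "a \<odot>\<^bsub>?F\<^esub> f \<in> carrier ?F" if "a \<in> carrier R" "f \<in> carrier ?F" for a f
      using that fin_supp_funs_scale(1)[OF assms, of f S a] by (simp add: free_module_def)
    show "\<one>\<^bsub>R\<^esub> \<odot>\<^bsub>?F\<^esub> f = f" if "f \<in> carrier ?F" for f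
      using D[OF that] by (simp add: free_module_def)
  qed
qed

lemma (in left_module) lin_ext_hom:
  assumes "\<phi> \<in> S \<rightarrow> carrier M"
  shows "(\<lambda>f\<in>carrier (free_module R S). lin_ext R M \<phi> f) \<in> mod_hom R (free_module R S) M"
proof -
  let ?F = "free_module R S" and ?l = "lin_ext R M \<phi>"
  interpret F: left_module R ?F by (rule free_module[OF R.ring_axioms])
  have "?l (f \<oplus>\<^bsub>?F\<^esub> g) = ?l f \<oplus>\<^bsub>M\<^esub> ?l g" if "f \<in> carrier ?F" "g \<in> carrier ?F" for f g
    using lin_ext_add[OF _ _ assms, of f g] that by (simp add: free_module_def)
  moreover have "?l (c \<odot>\<^bsub>?F\<^esub> f) = c \<odot>\<^bsub>M\<^esub> ?l f" if "c \<in> carrier R" "f \<in> carrier ?F" for c f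
    using lin_ext_scale[OF _ _ assms, of f c] that by (simp add: free_module_def)
  moreover have "?l f \<in> carrier M" if "f \<in> carrier ?F" for f
    using lin_ext_closed[OF _ assms, of f] that by (simp add: free_module_def)
  ultimately show ?thesis unfolding mod_hom_def mem_Collect_eq
    by (intro conjI ballI restrict_PiE_iff[THEN iffD2]) (simp_all only: restrict_apply F.M.a_closed F.lsmult_closed if_True simp_thms)
qed

lemma mod_hom_comp:
  assumes "f \<in> mod_hom R L M" "g \<in> mod_hom R M N" "left_module R L"
  shows "compose (carrier L) g f \<in> mod_hom R L N"
proof -
  interpret left_module R L by fact
  have f: "f x \<in> carrier M" if "x \<in> carrier L" for x using assms(1) that by (auto simp: mod_hom_def)
  have g: "g x \<in> carrier N" if "x \<in> carrier M" for x using assms(2) that by (auto simp: mod_hom_def)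
  have "compose (carrier L) g f \<in> carrier L \<rightarrow>\<^sub>E carrier N" using f g by (simp add: compose_def)
  moreover have "g (f (x \<oplus>\<^bsub>L\<^esub> y)) = g (f x) \<oplus>\<^bsub>N\<^esub> g (f y)" if "x \<in> carrier L" "y \<in> carrier L" for x y
    using assms(1,2) that f by (simp add: mod_hom_def)
  moreover have "g (f (r \<odot>\<^bsub>L\<^esub> x)) = r \<odot>\<^bsub>N\<^esub> g (f x)" if "r \<in> carrier R" "x \<in> carrier L" for r x
    using assms(1,2) that f by (simp add: mod_hom_def)
  ultimately show ?thesis unfolding mod_hom_def by (simp add: compose_def)
qed

lemma mod_hom_finsum:
  assumes "left_module R L" "left_module R M" "f \<in> mod_hom R L M" "finite T" "h \<in> T \<rightarrow> carrier L"
  shows "f (\<Oplus>\<^bsub>L\<^esub>t\<in>T. h t) = (\<Oplus>\<^bsub>M\<^esub>t\<in>T. f (h t))"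
proof -
  interpret L: left_module R L by fact
  interpret M: left_module R M by fact
  have m: "x \<in> carrier L \<Longrightarrow> f x \<in> carrier M" for x using assms(3) by (auto simp: mod_hom_def)
  have a: "x \<in> carrier L \<Longrightarrow> y \<in> carrier L \<Longrightarrow> f (x \<oplus>\<^bsub>L\<^esub> y) = f x \<oplus>\<^bsub>M\<^esub> f y" for x y
    using assms(3) by (auto simp: mod_hom_def)
  have "f \<zero>\<^bsub>L\<^esub> \<oplus>\<^bsub>M\<^esub> f \<zero>\<^bsub>L\<^esub> = f \<zero>\<^bsub>L\<^esub>" using a[of "\<zero>\<^bsub>L\<^esub>" "\<zero>\<^bsub>L\<^esub>"] by simp
  then have z: "f \<zero>\<^bsub>L\<^esub> = \<zero>\<^bsub>M\<^esub>" using m[of "\<zero>\<^bsub>L\<^esub>"] M.M.add.l_cancel_one' by simp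
  show ?thesis using assms(4,5)
    by (induction T rule: finite_induct) (auto simp: z a m Pi_iff)
qed

lemma projective_module_lifting:
  fixes P :: "('r, 'p) module" and M :: "('r, 'm, 'y) module_scheme" and N :: "('r, 'n, 'z) module_scheme"
  assumes P: "projective_module R P" and M: "left_module R M" and N: "left_module R N"
    and q: "q \<in> mod_hom R M N" "q ` carrier M = carrier N" and f: "f \<in> mod_hom R P N"
  shows "\<exists>g\<in>mod_hom R P M. compose (carrier P) q g = f"
proof -
  have lP: "left_module R P" using P by (simp add: projective_module_def)
  interpret P: left_module R P by fact
  interpret M: left_module R M by fact
  interpret N: left_module R N by fact
  let ?F = "free_module R (carrier P)"
  interpret F: left_module R ?F by (rule free_module[OF P.R.ring_axioms])
  define e where "e = (\<lambda>h\<in>carrier ?F. lin_ext R P (\<lambda>x. x) h)"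
  have e: "e \<in> mod_hom R ?F P" unfolding e_def by (intro P.lin_ext_hom) auto
  have es: "e (single R \<one>\<^bsub>R\<^esub> x) = x" if "x \<in> carrier P" for x
    using that P.lin_ext_single[of "\<one>\<^bsub>R\<^esub>" x "carrier P" "\<lambda>x. x"]
      single_in(1)[OF P.R.ring_axioms, of "\<one>\<^bsub>R\<^esub>" x "carrier P"]
    by (simp add: e_def free_module_def)
  have esurj: "e ` carrier ?F = carrier P"
  proof
    show "e ` carrier ?F \<subseteq> carrier P" using e by (auto simp: mod_hom_def)
    show "carrier P \<subseteq> e ` carrier ?F"
    proof
      fix x assume x: "x \<in> carrier P"
      have "single R \<one>\<^bsub>R\<^esub> x \<in> carrier ?F"
        using single_in(1)[OF P.R.ring_axioms P.R.one_closed x] by (simp add: free_module_def)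
      then show "x \<in> e ` carrier ?F" using es[OF x] by (metis image_eqI)
    qed
  qed
  have idP: "mod_id P \<in> mod_hom R P P" by (auto simp: mod_hom_def mod_id_def)
  obtain s where s: "s \<in> mod_hom R P ?F" "compose (carrier P) e s = mod_id P"
    using P e idP F.left_module_axioms lP esurj unfolding projective_module_def by blast
  have fN: "x \<in> carrier P \<Longrightarrow> f x \<in> carrier N" for x using f by (auto simp: mod_hom_def)
  have "\<forall>x\<in>carrier P. \<exists>y\<in>carrier M. q y = f x" using q(2) fN by (metis imageE)
  then obtain m where m: "\<And>x. x \<in> carrier P \<Longrightarrow> m x \<in> carrier M" "\<And>x. x \<in> carrier P \<Longrightarrow> q (m x) = f x"
    by metis
  define l where "l = (\<lambda>h\<in>carrier ?F. lin_ext R M m h)"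
  have l: "l \<in> mod_hom R ?F M" unfolding l_def using m by (intro M.lin_ext_hom) auto
  have ql: "q (l h) = f (e h)" if h: "h \<in> carrier ?F" for h
  proof -
    have h': "h \<in> fin_supp_funs R (carrier P)" using h by (simp add: free_module_def)
    note D = fin_supp_funsD[OF h']
    have *: "x \<in> fsupp R h \<Longrightarrow> x \<in> carrier P" for x using D by auto
    have "q (l h) = (\<Oplus>\<^bsub>N\<^esub>x\<in>fsupp R h. q (h x \<odot>\<^bsub>M\<^esub> m x))"
      unfolding l_def lin_ext_def using h D m *
      by (simp, intro mod_hom_finsum[OF M N q(1)]) auto
    also have "\<dots> = (\<Oplus>\<^bsub>N\<^esub>x\<in>fsupp R h. f (h x \<odot>\<^bsub>P\<^esub> x))"
    proof (rule N.M.finsum_cong')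
      show "q (h x \<odot>\<^bsub>M\<^esub> m x) = f (h x \<odot>\<^bsub>P\<^esub> x)" if "x \<in> fsupp R h" for x
        using q(1) f D(1)[of x] m *[OF that] by (simp add: mod_hom_def)
    qed (use fN D * in auto)
    also have "\<dots> = f (e h)"
      unfolding e_def lin_ext_def using h D *
      by (simp, intro mod_hom_finsum[OF lP N f, symmetric]) auto
    finally show ?thesis .
  qed
  have "compose (carrier P) l s \<in> mod_hom R P M" using mod_hom_comp[OF s(1) l lP] .
  moreover have "compose (carrier P) q (compose (carrier P) l s) = f"
  proof
    fix x
    show "compose (carrier P) q (compose (carrier P) l s) x = f x"
    proof (cases "x \<in> carrier P")
      case True
      then have "s x \<in> carrier ?F" using s(1) by (auto simp: mod_hom_def)
      moreover have "e (s x) = x" using fun_cong[OF s(2), of x] True by (simp add: compose_def mod_id_def)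
      ultimately show ?thesis using True ql by (simp add: compose_def)
    next
      case False
      then show ?thesis using f by (auto simp: compose_def mod_hom_def PiE_def extensional_def)
    qed
  qed
  ultimately show ?thesis by blast
qed

section \<open>The monoid algebra is a ring\<close>

definition reg :: "('k, 'x) ring_scheme \<Rightarrow> ('k, 'k) module"
  where "reg K = \<lparr>carrier = carrier K, mult = mult K, one = one K, zero = zero K, add = add K, smult = mult K\<rparr>"

lemma finsum_reg: "finsum (reg K) f T = finsum K f T"
  by (simp add: finsum_def finprod_def reg_def)

lemma left_module_reg: assumes "ring K" shows "left_module K (reg K)"
proof -
  interpret ring K by fact
  show ?thesis
    apply (intro left_module.intro left_module_axioms.intro assms abelian_groupI)
    apply (simp_all add: reg_def a_assoc m_assoc l_distr r_distr)
    apply (auto simp: a_comm intro: l_neg)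
    done
qed

lemma (in left_module) lin_ext_phi_add:
  assumes f: "f \<in> fin_supp_funs R S" and "\<phi> \<in> S \<rightarrow> carrier M" "\<psi> \<in> S \<rightarrow> carrier M"
  shows "lin_ext R M (\<lambda>p. \<phi> p \<oplus>\<^bsub>M\<^esub> \<psi> p) f = lin_ext R M \<phi> f \<oplus>\<^bsub>M\<^esub> lin_ext R M \<psi> f"
proof -
  note D = fin_supp_funsD[OF f]
  have phi: "\<phi> p \<in> carrier M" "\<psi> p \<in> carrier M" if "p \<in> fsupp R f" for p using assms D that by auto
  have "lin_ext R M (\<lambda>p. \<phi> p \<oplus>\<^bsub>M\<^esub> \<psi> p) f = (\<Oplus>\<^bsub>M\<^esub>p\<in>fsupp R f. f p \<odot>\<^bsub>M\<^esub> \<phi> p \<oplus>\<^bsub>M\<^esub> f p \<odot>\<^bsub>M\<^esub> \<psi> p)"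
    unfolding lin_ext_def using D phi by (intro M.finsum_cong') (auto simp: lsmult_r_distr)
  also have "\<dots> = lin_ext R M \<phi> f \<oplus>\<^bsub>M\<^esub> lin_ext R M \<psi> f"
    unfolding lin_ext_def using D phi by (intro M.finsum_addf) auto
  finally show ?thesis .
qed

locale monoid_algebra_setup = K?: cring K + G?: monoid G for K :: "('k, 'x) ring_scheme" (structure) and G :: "('g,'y) monoid_scheme" (structure)
begin

abbreviation "FS \<equiv> fin_supp_funs K (carrier G)"
abbreviation "F \<equiv> monoid_algebra K G"
abbreviation "\<iota> q p r \<equiv> (if q \<otimes>\<^bsub>G\<^esub> r = p then \<one>\<^bsub>K\<^esub> else \<zero>\<^bsub>K\<^esub>)"
abbreviation "LE \<equiv> lin_ext K (reg K)"

sublocale L: left_module K "reg K" by (rule left_module_reg[OF K.ring_axioms])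

lemma regs [simp]: "carrier (reg K) = carrier K" "\<zero>\<^bsub>reg K\<^esub> = \<zero>\<^bsub>K\<^esub>" "x \<oplus>\<^bsub>reg K\<^esub> y = x \<oplus>\<^bsub>K\<^esub> y"
  "x \<odot>\<^bsub>reg K\<^esub> y = x \<otimes>\<^bsub>K\<^esub> y" by (simp_all add: reg_def)

lemma carrier_F [simp]: "carrier F = FS" "\<zero>\<^bsub>F\<^esub> = (\<lambda>p. \<zero>\<^bsub>K\<^esub>)" "\<one>\<^bsub>F\<^esub> = single K \<one>\<^bsub>K\<^esub> \<one>\<^bsub>G\<^esub>"
  "f \<oplus>\<^bsub>F\<^esub> g = (\<lambda>p. f p \<oplus>\<^bsub>K\<^esub> g p)" by (simp_all add: monoid_algebra_def)

lemma LE_closed: "f \<in> FS \<Longrightarrow> \<phi> \<in> carrier G \<rightarrow> carrier K \<Longrightarrow> LE \<phi> f \<in> carrier K"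
  using L.lin_ext_closed[of f "carrier G" \<phi>] by simp

lemma mult_F:
  assumes f: "f \<in> FS" and g: "g \<in> FS"
  shows "(f \<otimes>\<^bsub>F\<^esub> g) p = LE (\<lambda>q. LE (\<iota> q p) g) f"
proof -
  note D = fin_supp_funsD[OF f] fin_supp_funsD[OF g]
  have "(f \<otimes>\<^bsub>F\<^esub> g) p = (\<Oplus>\<^bsub>K\<^esub>q\<in>fsupp K f. \<Oplus>\<^bsub>K\<^esub>r\<in>fsupp K g. f q \<otimes>\<^bsub>K\<^esub> (g r \<otimes>\<^bsub>K\<^esub> \<iota> q p r))"
    unfolding monoid_algebra_def using D
    by (simp, intro K.finsum_cong') (auto intro!: K.finsum_cong' K.finsum_closed)
  also have "\<dots> = (\<Oplus>\<^bsub>K\<^esub>q\<in>fsupp K f. f q \<otimes>\<^bsub>K\<^esub> (\<Oplus>\<^bsub>K\<^esub>r\<in>fsupp K g. g r \<otimes>\<^bsub>K\<^esub> \<iota> q p r))"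
    using D by (intro K.finsum_cong') (auto intro!: K.finsum_rdistr[symmetric] K.finsum_closed)
  finally show ?thesis by (simp add: lin_ext_def finsum_reg)
qed

lemma FSD: "f \<in> FS \<Longrightarrow> f p \<in> carrier K" by (rule fin_supp_funsD(1))
lemmas fs = fin_supp_funs_add(1)[OF K.ring_axioms] fin_supp_funs_neg[OF K.ring_axioms]
  fin_supp_funs_zero[OF K.ring_axioms] single_in(1)[OF K.ring_axioms]

lemma mult_l_distr:
  assumes "f \<in> FS" "f' \<in> FS" "g \<in> FS"
  shows "(f \<oplus>\<^bsub>F\<^esub> f') \<otimes>\<^bsub>F\<^esub> g = f \<otimes>\<^bsub>F\<^esub> g \<oplus>\<^bsub>F\<^esub> f' \<otimes>\<^bsub>F\<^esub> g"
proof
  fix p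
  have "(\<lambda>q. LE (\<iota> q p) g) \<in> carrier G \<rightarrow> carrier K" using assms by (auto intro!: LE_closed)
  then show "((f \<oplus>\<^bsub>F\<^esub> f') \<otimes>\<^bsub>F\<^esub> g) p = (f \<otimes>\<^bsub>F\<^esub> g \<oplus>\<^bsub>F\<^esub> f' \<otimes>\<^bsub>F\<^esub> g) p"
    using assms by (simp add: mult_F fs L.lin_ext_add[OF assms(1,2), simplified])
qed

lemma mult_r_distr:
  assumes "f \<in> FS" "f' \<in> FS" "g \<in> FS"
  shows "g \<otimes>\<^bsub>F\<^esub> (f \<oplus>\<^bsub>F\<^esub> f') = g \<otimes>\<^bsub>F\<^esub> f \<oplus>\<^bsub>F\<^esub> g \<otimes>\<^bsub>F\<^esub> f'"
proof
  fix p
  have 1: "\<iota> q p \<in> carrier G \<rightarrow> carrier K" for q by auto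
  have "(\<lambda>q. LE (\<iota> q p) f) \<in> carrier G \<rightarrow> carrier K" "(\<lambda>q. LE (\<iota> q p) f') \<in> carrier G \<rightarrow> carrier K"
    using assms by (auto intro!: LE_closed)
  then show "(g \<otimes>\<^bsub>F\<^esub> (f \<oplus>\<^bsub>F\<^esub> f')) p = (g \<otimes>\<^bsub>F\<^esub> f \<oplus>\<^bsub>F\<^esub> g \<otimes>\<^bsub>F\<^esub> f') p"
    using assms by (simp add: mult_F fs L.lin_ext_add[OF assms(1,2), simplified]
      L.lin_ext_phi_add[OF assms(3), simplified])
qed

lemma single_mult_single:
  assumes "c \<in> carrier K" "d \<in> carrier K" "p \<in> carrier G" "q \<in> carrier G"
  shows "single K c p \<otimes>\<^bsub>F\<^esub> single K d q = single K (c \<otimes>\<^bsub>K\<^esub> d) (p \<otimes>\<^bsub>G\<^esub> q)"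
proof
  fix x
  have "LE (\<iota> p' x) (single K d q) = d \<otimes>\<^bsub>K\<^esub> \<iota> p' x q" for p'
    using L.lin_ext_single[of d q "carrier G" "\<iota> p' x"] assms by simp
  moreover have "LE (\<lambda>p'. d \<otimes>\<^bsub>K\<^esub> \<iota> p' x q) (single K c p) = c \<otimes>\<^bsub>K\<^esub> (d \<otimes>\<^bsub>K\<^esub> \<iota> p x q)"
    using L.lin_ext_single[of c p "carrier G" "\<lambda>p'. d \<otimes>\<^bsub>K\<^esub> \<iota> p' x q"] assms by simp
  ultimately show "(single K c p \<otimes>\<^bsub>F\<^esub> single K d q) x = single K (c \<otimes>\<^bsub>K\<^esub> d) (p \<otimes>\<^bsub>G\<^esub> q) x"
    using assms by (auto simp: mult_F fs single_def[of K _ "p \<otimes>\<^bsub>G\<^esub> q"])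
qed

lemma mult_zero_l: "(\<lambda>p. \<zero>\<^bsub>K\<^esub>) \<otimes>\<^bsub>F\<^esub> g = (\<lambda>p. \<zero>\<^bsub>K\<^esub>)"
  by (simp add: monoid_algebra_def fsupp_def)

lemma mult_zero_r: "g \<otimes>\<^bsub>F\<^esub> (\<lambda>p. \<zero>\<^bsub>K\<^esub>) = (\<lambda>p. \<zero>\<^bsub>K\<^esub>)"
  by (simp add: monoid_algebra_def fsupp_def)

lemmas dist = mult_l_distr[simplified] mult_r_distr[simplified]

lemmas indF [consumes 1, case_names zero add] = fin_supp_induct[OF K.ring_axioms, where S = "carrier G"]

lemma mult_closed: "f \<in> FS \<Longrightarrow> g \<in> FS \<Longrightarrow> f \<otimes>\<^bsub>F\<^esub> g \<in> FS"
proof (induction f rule: indF)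
  case (add c p f)
  have "single K c p \<otimes>\<^bsub>F\<^esub> g \<in> FS" using \<open>g \<in> FS\<close>
    by (induction g rule: indF) (use add(1,2) in \<open>simp_all add: mult_zero_r dist fs single_mult_single\<close>)
  then show ?case using add by (simp add: dist fs)
qed (simp add: mult_zero_l fs)

lemma mult_assoc:
  assumes "f \<in> FS" "g \<in> FS" "h \<in> FS"
  shows "f \<otimes>\<^bsub>F\<^esub> g \<otimes>\<^bsub>F\<^esub> h = f \<otimes>\<^bsub>F\<^esub> (g \<otimes>\<^bsub>F\<^esub> h)"
proof -
  have 1: "single K c p \<otimes>\<^bsub>F\<^esub> single K d q \<otimes>\<^bsub>F\<^esub> h = single K c p \<otimes>\<^bsub>F\<^esub> (single K d q \<otimes>\<^bsub>F\<^esub> h)"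
    if "c \<in> carrier K" "d \<in> carrier K" "p \<in> carrier G" "q \<in> carrier G" for c d p q
    using assms(3) by (induction h rule: indF)
      (use that in \<open>simp_all add: mult_zero_r dist fs single_mult_single mult_closed K.m_assoc G.m_assoc\<close>)
  have 2: "single K c p \<otimes>\<^bsub>F\<^esub> g \<otimes>\<^bsub>F\<^esub> h = single K c p \<otimes>\<^bsub>F\<^esub> (g \<otimes>\<^bsub>F\<^esub> h)"
    if "c \<in> carrier K" "p \<in> carrier G" for c p
    using assms(2) by (induction g rule: indF)
      (use that assms(3) 1 in \<open>simp_all add: mult_zero_r mult_zero_l dist fs mult_closed\<close>)
  show ?thesis using assms(1) by (induction f rule: indF)
      (use assms(2,3) 2 in \<open>simp_all add: mult_zero_l dist fs mult_closed\<close>)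
qed

lemma mult_one: "f \<in> FS \<Longrightarrow> single K \<one>\<^bsub>K\<^esub> \<one>\<^bsub>G\<^esub> \<otimes>\<^bsub>F\<^esub> f = f" "f \<in> FS \<Longrightarrow> f \<otimes>\<^bsub>F\<^esub> single K \<one>\<^bsub>K\<^esub> \<one>\<^bsub>G\<^esub> = f"
  by (induction f rule: indF; simp add: mult_zero_l mult_zero_r dist fs single_mult_single)+

sublocale F: ring F
proof (rule ringI)
  note D = fin_supp_funsD(1)
  show "abelian_group F"
  proof (rule abelian_groupI)
    fix f assume "f \<in> carrier F"
    then show "\<exists>g\<in>carrier F. g \<oplus>\<^bsub>F\<^esub> f = \<zero>\<^bsub>F\<^esub>"
      by (intro bexI[of _ "\<lambda>p. \<ominus>\<^bsub>K\<^esub> f p"]) (simp_all add: fs K.l_neg fin_supp_funsD(1)[of f K "carrier G"])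
  next
    fix f g h assume "f \<in> carrier F" "g \<in> carrier F" "h \<in> carrier F"
    then have "f p \<in> carrier K" "g p \<in> carrier K" "h p \<in> carrier K" for p by (simp_all add: fin_supp_funs_def range_subsetD)
    then show "f \<oplus>\<^bsub>F\<^esub> g \<oplus>\<^bsub>F\<^esub> h = f \<oplus>\<^bsub>F\<^esub> (g \<oplus>\<^bsub>F\<^esub> h)"
      by (simp add: K.a_assoc)
  next
    fix f g assume "f \<in> carrier F" "g \<in> carrier F"
    then have "f p \<in> carrier K" "g p \<in> carrier K" for p by (simp_all add: fin_supp_funs_def range_subsetD)
    then show "f \<oplus>\<^bsub>F\<^esub> g = g \<oplus>\<^bsub>F\<^esub> f"
      by (simp add: K.a_comm)
  next
    fix f assume "f \<in> carrier F"
    then have "f p \<in> carrier K" for p by (simp_all add: fin_supp_funs_def range_subsetD)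
    then show "\<zero>\<^bsub>F\<^esub> \<oplus>\<^bsub>F\<^esub> f = f" by simp
  qed (simp_all add: fs)
  show "monoid F" by (rule monoidI) (simp_all add: fs mult_closed mult_assoc mult_one)
qed (simp_all add: mult_l_distr mult_r_distr del: carrier_F(2-))

end

section \<open>The enveloping algebra is a ring acting on the algebra\<close>

lemma (in k_algebra) left_module_self: "left_module R M"
  by (intro left_module.intro left_module_axioms.intro)
    (auto simp: R.ring_axioms M.abelian_group_axioms smult_l_distr smult_r_distr smult_assoc1)

lemma opposite_simps [simp]: "carrier (opposite A) = carrier A" "\<one>\<^bsub>opposite A\<^esub> = \<one>\<^bsub>A\<^esub>" "\<zero>\<^bsub>opposite A\<^esub> = \<zero>\<^bsub>A\<^esub>"
  "x \<oplus>\<^bsub>opposite A\<^esub> y = x \<oplus>\<^bsub>A\<^esub> y" "x \<otimes>\<^bsub>opposite A\<^esub> y = y \<otimes>\<^bsub>A\<^esub> x" "c \<odot>\<^bsub>opposite A\<^esub> y = c \<odot>\<^bsub>A\<^esub> y"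
  by (simp_all add: opposite_def)

locale enveloping_setup = k_algebra K A for K :: "('k, 'x) ring_scheme" (structure) and A :: "('k, 'a, 'y) module_scheme" (structure)
begin

abbreviation "G \<equiv> A \<times>\<times> opposite A"


lemma monoid_G: "monoid G"
  by (intro DirProd_monoid M.is_monoid monoidI) (auto simp: M.m_assoc)

sublocale Q: monoid_algebra_setup K G by (intro monoid_algebra_setup.intro R.is_cring monoid_G)
sublocale LA: left_module K A by (rule left_module_self)

lemma G_simps [simp]: "carrier G = carrier A \<times> carrier A" "(a,b) \<otimes>\<^bsub>G\<^esub> (c,d) = (a \<otimes>\<^bsub>A\<^esub> c, d \<otimes>\<^bsub>A\<^esub> b)" "\<one>\<^bsub>G\<^esub> = (\<one>\<^bsub>A\<^esub>,\<one>\<^bsub>A\<^esub>)"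
  by simp_all

abbreviation "act \<equiv> bimodule_action K A"

lemma act_eq: "act f x = lin_ext K A (\<lambda>p. fst p \<otimes>\<^bsub>A\<^esub> x \<otimes>\<^bsub>A\<^esub> snd p) f"
  by (simp add: bimodule_action_def lin_ext_def)

lemma phi: "x \<in> carrier A \<Longrightarrow> (\<lambda>p. fst p \<otimes>\<^bsub>A\<^esub> x \<otimes>\<^bsub>A\<^esub> snd p) \<in> carrier G \<rightarrow> carrier A" by auto

lemma act_closed: "f \<in> Q.FS \<Longrightarrow> x \<in> carrier A \<Longrightarrow> act f x \<in> carrier A"
  unfolding act_eq by (rule LA.lin_ext_closed[OF _ phi])

lemma act_add: "f \<in> Q.FS \<Longrightarrow> g \<in> Q.FS \<Longrightarrow> x \<in> carrier A \<Longrightarrow> act (\<lambda>p. f p \<oplus>\<^bsub>K\<^esub> g p) x = act f x \<oplus>\<^bsub>A\<^esub> act g x"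
  unfolding act_eq by (rule LA.lin_ext_add[OF _ _ phi])

lemma act_zero: "act (\<lambda>p. \<zero>\<^bsub>K\<^esub>) x = \<zero>\<^bsub>A\<^esub>" unfolding act_eq by simp

lemma act_single: "c \<in> carrier K \<Longrightarrow> a \<in> carrier A \<Longrightarrow> b \<in> carrier A \<Longrightarrow> x \<in> carrier A \<Longrightarrow>
   act (single K c (a,b)) x = c \<odot>\<^bsub>A\<^esub> (a \<otimes>\<^bsub>A\<^esub> x \<otimes>\<^bsub>A\<^esub> b)"
  unfolding act_eq using LA.lin_ext_single[OF _ _ phi, of c "(a,b)" x] by simp

lemma act_add_r: 
  assumes "f \<in> Q.FS" "x \<in> carrier A" "y \<in> carrier A" shows "act f (x \<oplus>\<^bsub>A\<^esub> y) = act f x \<oplus>\<^bsub>A\<^esub> act f y"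
  using assms(1)
proof (induction rule: Q.indF)
  case (add c p f)
  obtain a b where p: "p = (a,b)" by force
  have ab: "a \<in> carrier A" "b \<in> carrier A" using add p by auto
  show ?case using add ab assms(2,3) unfolding p
    by (simp add: act_add Q.fs act_single act_closed M.l_distr M.r_distr smult_r_distr M.a_ac)
qed (simp add: act_zero)

lemma act_zero_r: "f \<in> Q.FS \<Longrightarrow> act f \<zero>\<^bsub>A\<^esub> = \<zero>\<^bsub>A\<^esub>"
  using act_add_r[of f "\<zero>\<^bsub>A\<^esub>" "\<zero>\<^bsub>A\<^esub>"] act_closed[of f "\<zero>\<^bsub>A\<^esub>"] M.add.l_cancel_one' by simp

lemma act_mult:
  assumes "f \<in> Q.FS" "g \<in> Q.FS" "x \<in> carrier A" shows "act (f \<otimes>\<^bsub>Q.F\<^esub> g) x = act f (act g x)"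
proof -
  have 1: "act (single K c p \<otimes>\<^bsub>Q.F\<^esub> g) x = act (single K c p) (act g x)" if "c \<in> carrier K" "p \<in> carrier G" for c p
    using assms(2)
  proof (induction rule: Q.indF)
    case zero then show ?case using that by (simp add: Q.mult_zero_r act_zero act_zero_r Q.fs)
  next
    case (add d q g)
    obtain a b where p: "p = (a,b)" by force
    obtain a' b' where q: "q = (a',b')" by force
    have ab: "a \<in> carrier A" "b \<in> carrier A" "a' \<in> carrier A" "b' \<in> carrier A" using add p q that by auto
    have cl: "single K c (a,b) \<otimes>\<^bsub>Q.F\<^esub> g \<in> Q.FS" "single K (c \<otimes>\<^bsub>K\<^esub> d) (a \<otimes>\<^bsub>A\<^esub> a', b' \<otimes>\<^bsub>A\<^esub> b) \<in> Q.FS"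
      by (rule Q.mult_closed[OF Q.fs(4)]; use add ab that(1) in simp) (rule Q.fs(4); use add ab that(1) in simp)
    show ?case using add ab assms(3) that(1) unfolding p q
      by (simp add: act_add[OF cl(2,1)] act_add act_add_r Q.dist Q.fs Q.mult_closed Q.single_mult_single act_single act_closed
       smult_assoc1 smult_mult_left smult_mult_right M.m_assoc)
  qed
  show ?thesis using assms(1)
  proof (induction rule: Q.indF)
    case zero show ?case by (simp add: Q.mult_zero_l act_zero)
  next
    case (add c p f)
    note m = Q.mult_closed[OF Q.fs(4)[OF add(1,2)] assms(2)] Q.mult_closed[OF add(3) assms(2)]
    show ?case
      using act_add[OF m assms(3)] act_add[OF Q.fs(4)[OF add(1,2)] add(3) act_closed[OF assms(2,3)]]
      by (simp add: Q.dist[OF Q.fs(4)[OF add(1,2)] add(3) assms(2)] 1[OF add(1,2)] add(4))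
  qed
qed

abbreviation "T \<equiv> tensor_relations K A (opposite A)"
abbreviation "I \<equiv> genideal Q.F T"

lemma T_carrier: "T \<subseteq> Q.FS"
proof -
  note [simp] = Q.F.minus_closed[simplified] Q.fs smult_closed
  show ?thesis unfolding tensor_relations_def Let_def by auto
qed

lemmas closures = Q.mult_closed[simplified] Q.F.a_inv_closed[simplified]

lemma act_neg: 
  assumes "f \<in> Q.FS" "x \<in> carrier A" shows "act (\<ominus>\<^bsub>Q.F\<^esub> f) x = \<ominus>\<^bsub>A\<^esub> act f x"
proof -
  have n: "\<ominus>\<^bsub>Q.F\<^esub> f \<in> Q.FS" using Q.F.a_inv_closed[of f] assms by simp
  have "act (\<ominus>\<^bsub>Q.F\<^esub> f \<oplus>\<^bsub>Q.F\<^esub> f) x = \<zero>\<^bsub>A\<^esub>" using Q.F.l_neg[of f] assms by (simp add: act_zero del: Q.carrier_F(4))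
  then have "act (\<ominus>\<^bsub>Q.F\<^esub> f) x \<oplus>\<^bsub>A\<^esub> act f x = \<zero>\<^bsub>A\<^esub>" using act_add[OF n assms] by simp
  then show ?thesis using M.minus_equality act_closed n assms by metis
qed

lemma act_minus: 
  assumes "f \<in> Q.FS" "g \<in> Q.FS" "x \<in> carrier A" shows "act (f \<ominus>\<^bsub>Q.F\<^esub> g) x = act f x \<ominus>\<^bsub>A\<^esub> act g x"
  using assms act_neg[OF assms(2,3)] act_add[OF assms(1) _ assms(3), of "\<ominus>\<^bsub>Q.F\<^esub> g"] Q.F.a_inv_closed[of g]
  by (simp add: a_minus_def)

lemma ideal_I: "ideal I Q.F" using Q.F.genideal_ideal T_carrier by simp

lemma ker_ideal: "ideal {f \<in> Q.FS. \<forall>x\<in>carrier A. act f x = \<zero>\<^bsub>A\<^esub>} Q.F"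
proof (rule idealI)
  show "ring Q.F" by (rule Q.F.ring_axioms)
  show "subgroup {f \<in> Q.FS. \<forall>x\<in>carrier A. act f x = \<zero>\<^bsub>A\<^esub>} (add_monoid Q.F)"
  proof (rule group.subgroupI[OF Q.F.a_group])
    have "(\<lambda>p. \<zero>\<^bsub>K\<^esub>) \<in> {f \<in> Q.FS. \<forall>x\<in>carrier A. act f x = \<zero>\<^bsub>A\<^esub>}" by (simp add: act_zero Q.fs)
    then show "{f \<in> Q.FS. \<forall>x\<in>carrier A. act f x = \<zero>\<^bsub>A\<^esub>} \<noteq> {}" by blast
    show "inv\<^bsub>add_monoid Q.F\<^esub> f \<in> {f \<in> Q.FS. \<forall>x\<in>carrier A. act f x = \<zero>\<^bsub>A\<^esub>}"
      if "f \<in> {f \<in> Q.FS. \<forall>x\<in>carrier A. act f x = \<zero>\<^bsub>A\<^esub>}" for f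
      using that unfolding a_inv_def[symmetric] by (simp add: closures act_neg)
  qed (auto simp: Q.fs act_add)
qed (auto simp: closures act_mult act_closed act_zero_r act_zero)

lemma T_ker: "T \<subseteq> {f \<in> Q.FS. \<forall>x\<in>carrier A. act f x = \<zero>\<^bsub>A\<^esub>}"
proof -
  have "act f x = \<zero>\<^bsub>A\<^esub>" if "f \<in> T" "x \<in> carrier A" for f x
    using that unfolding tensor_relations_def Let_def
    by (auto simp: act_minus[simplified] act_add[simplified] Q.fs act_single smult_closed M.minus_eq M.l_distr M.r_distr smult_r_distr smult_mult_left
      smult_mult_right M.r_neg)
  then show ?thesis using T_carrier by auto
qed

lemma I_ker: "f \<in> I \<Longrightarrow> x \<in> carrier A \<Longrightarrow> act f x = \<zero>\<^bsub>A\<^esub>" "f \<in> I \<Longrightarrow> f \<in> Q.FS"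
  using Q.F.genideal_minimal[OF ker_ideal T_ker] by auto

abbreviation "Ae \<equiv> enveloping_algebra K A"

lemma ring_enveloping_algebra: "ring Ae"
  unfolding enveloping_algebra_def tensor_algebra_def using ideal.quotient_is_ring[OF ideal_I] .

sublocale I: ideal I Q.F by (rule ideal_I)

lemma smult_coset:
  assumes "f \<in> Q.FS" "x \<in> carrier A"
  shows "(I +>\<^bsub>Q.F\<^esub> f) \<odot>\<^bsub>regular_bimodule K A\<^esub> x = act f x"
proof -
  have "act h x = act f x" if h: "h \<in> I +>\<^bsub>Q.F\<^esub> f" for h
  proof -
    obtain i where "i \<in> I" "h = i \<oplus>\<^bsub>Q.F\<^esub> f" using h unfolding a_r_coset_def' by (auto simp del: Q.carrier_F)
    note i = this
    have "act h x = act i x \<oplus>\<^bsub>A\<^esub> act f x" using act_add[OF I_ker(2)[OF i(1)] assms] i(2) by simp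
    then show ?thesis unfolding I_ker(1)[OF i(1) assms(2)] using M.l_zero[OF act_closed[OF assms]] by simp
  qed
  moreover have "f \<in> I +>\<^bsub>Q.F\<^esub> f" using assms I.a_rcos_self by simp
  ultimately have "(\<lambda>f. act f x) ` (I +>\<^bsub>Q.F\<^esub> f) = {act f x}" by blast
  then show ?thesis by (simp add: regular_bimodule_def)
qed

lemma Ae_carrier: "carrier Ae = {I +>\<^bsub>Q.F\<^esub> f | f. f \<in> Q.FS}"
  by (auto simp: enveloping_algebra_def tensor_algebra_def FactRing_def A_RCOSETS_def' a_r_coset_def)

lemma Ae_ops: "f \<in> Q.FS \<Longrightarrow> g \<in> Q.FS \<Longrightarrow> (I +>\<^bsub>Q.F\<^esub> f) \<otimes>\<^bsub>Ae\<^esub> (I +>\<^bsub>Q.F\<^esub> g) = I +>\<^bsub>Q.F\<^esub> (f \<otimes>\<^bsub>Q.F\<^esub> g)"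
  "f \<in> Q.FS \<Longrightarrow> g \<in> Q.FS \<Longrightarrow> (I +>\<^bsub>Q.F\<^esub> f) \<oplus>\<^bsub>Ae\<^esub> (I +>\<^bsub>Q.F\<^esub> g) = I +>\<^bsub>Q.F\<^esub> (f \<oplus>\<^bsub>Q.F\<^esub> g)"
  "\<one>\<^bsub>Ae\<^esub> = I +>\<^bsub>Q.F\<^esub> \<one>\<^bsub>Q.F\<^esub>"
  using I.rcoset_mult_add[of f g] I.a_rcos_sum[of f g]
  by (auto simp: enveloping_algebra_def tensor_algebra_def FactRing_def)

lemma left_module_regular_bimodule: "left_module Ae (regular_bimodule K A)"
proof (intro left_module.intro left_module_axioms.intro ring_enveloping_algebra)
  let ?B = "regular_bimodule K A"
  have s [simp]: "carrier ?B = carrier A" "\<zero>\<^bsub>?B\<^esub> = \<zero>\<^bsub>A\<^esub>" "x \<oplus>\<^bsub>?B\<^esub> y = x \<oplus>\<^bsub>A\<^esub> y" for x y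
    by (simp_all add: regular_bimodule_def)
  show "abelian_group ?B"
    apply (rule abelian_groupI)
    apply (simp_all add: M.a_assoc)
    apply (auto simp: M.a_comm intro: M.l_neg)
    done
  note [simp] = smult_coset[simplified] Ae_ops[simplified] act_closed[simplified] Q.fs closures act_add[simplified] act_mult[simplified] act_add_r[simplified] act_single
  show "\<And>a x. a \<in> carrier Ae \<Longrightarrow> x \<in> carrier ?B \<Longrightarrow> a \<odot>\<^bsub>?B\<^esub> x \<in> carrier ?B"
    by (auto simp: Ae_carrier)
  show "\<And>a b x. a \<in> carrier Ae \<Longrightarrow> b \<in> carrier Ae \<Longrightarrow> x \<in> carrier ?B \<Longrightarrow>
       (a \<oplus>\<^bsub>Ae\<^esub> b) \<odot>\<^bsub>?B\<^esub> x = a \<odot>\<^bsub>?B\<^esub> x \<oplus>\<^bsub>?B\<^esub> b \<odot>\<^bsub>?B\<^esub> x"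
    by (auto simp: Ae_carrier)
  show "\<And>a x y. a \<in> carrier Ae \<Longrightarrow> x \<in> carrier ?B \<Longrightarrow> y \<in> carrier ?B \<Longrightarrow>
       a \<odot>\<^bsub>?B\<^esub> (x \<oplus>\<^bsub>?B\<^esub> y) = a \<odot>\<^bsub>?B\<^esub> x \<oplus>\<^bsub>?B\<^esub> a \<odot>\<^bsub>?B\<^esub> y"
    by (auto simp: Ae_carrier)
  show "\<And>a b x. a \<in> carrier Ae \<Longrightarrow> b \<in> carrier Ae \<Longrightarrow> x \<in> carrier ?B \<Longrightarrow>
       (a \<otimes>\<^bsub>Ae\<^esub> b) \<odot>\<^bsub>?B\<^esub> x = a \<odot>\<^bsub>?B\<^esub> (b \<odot>\<^bsub>?B\<^esub> x)"
    by (auto simp: Ae_carrier)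
  show "\<And>x. x \<in> carrier ?B \<Longrightarrow> \<one>\<^bsub>Ae\<^esub> \<odot>\<^bsub>?B\<^esub> x = x"
    by auto
qed

end

end

theory Submission
  imports Defs
begin

text \<open>An equivalence sends the regular \<open>A\<close>-module to a progenerator \<open>P\<close> over \<open>B\<close> whose endomorphisms are
  the right multiplications by elements of \<open>A\<close>. Choosing \<open>x\<^sub>i \<in> P\<close> and \<open>q\<^sub>i : P \<rightarrow> B\<close> such that
  \<open>\<Sum>\<^sub>i q\<^sub>i(x\<^sub>i) = 1\<close> over one finite index set and \<open>\<Sum>\<^sub>j q\<^sub>j(y) x\<^sub>j = y\<close> over another turns the Morita
  context into two families of \<open>K\<close>-linear maps \<open>B \<rightarrow> A\<close> and \<open>A \<rightarrow> B\<close>. Their tensor products are such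
  families for \<open>A\<^sup>e\<close> and \<open>B\<^sup>e\<close>. The functor \<open>M \<mapsto> {t \<in> M\<^sup>I. t = \<phi>(1) t}\<close> from \<open>A\<^sup>e\<close>-modules to
  \<open>B\<^sup>e\<close>-modules, on which \<open>B\<^sup>e\<close> acts through the matrices \<open>\<phi>\<close>, is exact, turns dual bases into dual
  bases and sends \<open>A\<close> to \<open>B\<close>, so it transports finite resolutions by finitely generated projective
  modules.\<close>

section \<open>Sums and module homomorphisms\<close>

text \<open>The equivalence only sees left modules over \<open>A\<close> and \<open>B\<close> on one
  fixed carrier type, whereas smoothness concerns bimodules and resolutions on other types. Hence it
  is reduced to finitely many elements and functionals: explicit formulas can be tensored with their
  opposites and applied to modules on any type. \<open>K\<close>-linearity of the functor makes the
  resulting maps \<open>K\<close>-linear, so that their tensor products over \<open>K\<close> exist.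
  Categorical characterisations of finitely generated projective generators usually test against
  arbitrary direct sums, under which the universe need not be closed. Trace ideals replace them: if
  a trace ideal misses 1, the contradiction comes from a cyclic module, and those fit into the
  universe. The two families share one index type because mixed entries \<open>phi i j\<close> with
  \<open>i\<close> in \<open>I\<close> and \<open>j\<close> in \<open>J\<close> occur in the dual
  bases of the image modules.\<close>

lemma (in abelian_monoid) finsum_Sigma:
  assumes "finite A" "finite B" "\<And>a b. a \<in> A \<Longrightarrow> b \<in> B \<Longrightarrow> f (a, b) \<in> carrier G"
  shows "(\<Oplus>p\<in>A \<times> B. f p) = (\<Oplus>a\<in>A. \<Oplus>b\<in>B. f (a, b))"
  using assms(1,3)
proof (induction A rule: finite_induct)
  case (insert a A)
  have "(\<Oplus>p\<in>insert a A \<times> B. f p) = (\<Oplus>p\<in>({a} \<times> B) \<union> (A \<times> B). f p)"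
    by (rule arg_cong[where f = "finsum G f"]) auto
  also have "\<dots> = (\<Oplus>p\<in>{a} \<times> B. f p) \<oplus> (\<Oplus>p\<in>A \<times> B. f p)"
    using insert assms(2) by (intro finsum_Un_disjoint) auto
  also have "(\<Oplus>p\<in>{a} \<times> B. f p) = (\<Oplus>b\<in>B. f (a, b))"
  proof -
    have "{a} \<times> B = Pair a ` B" by auto
    moreover have "f \<in> Pair a ` B \<rightarrow> carrier G" using insert(4) by auto
    ultimately show ?thesis using add.finprod_reindex[of f "Pair a" B] by (simp add: inj_on_def)
  qed
  finally show ?case using insert by (simp add: finsum_insert Pi_def)
qed simp

lemma (in abelian_monoid) finsum_swap:
  assumes "finite A" "finite B" "\<And>a b. a \<in> A \<Longrightarrow> b \<in> B \<Longrightarrow> f a b \<in> carrier G"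
  shows "(\<Oplus>a\<in>A. \<Oplus>b\<in>B. f a b) = (\<Oplus>b\<in>B. \<Oplus>a\<in>A. f a b)"
  using assms(1,3)
proof (induction A rule: finite_induct)
  case (insert a A)
  have "(\<Oplus>b\<in>B. \<Oplus>a\<in>insert a A. f a b) = (\<Oplus>b\<in>B. f a b \<oplus> (\<Oplus>a\<in>A. f a b))"
    using insert by (intro finsum_cong') (auto simp: Pi_def)
  also have "\<dots> = (\<Oplus>b\<in>B. f a b) \<oplus> (\<Oplus>b\<in>B. \<Oplus>a\<in>A. f a b)"
    using insert by (intro finsum_addf) (auto simp: Pi_def)
  finally show ?case using insert by (simp add: finsum_insert Pi_def)
qed simp

lemma additive_zero:
  assumes "abelian_group M" "abelian_group N" "h \<zero>\<^bsub>M\<^esub> \<in> carrier N"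
    "\<And>x y. x \<in> carrier M \<Longrightarrow> y \<in> carrier M \<Longrightarrow> h (x \<oplus>\<^bsub>M\<^esub> y) = h x \<oplus>\<^bsub>N\<^esub> h y"
  shows "h \<zero>\<^bsub>M\<^esub> = \<zero>\<^bsub>N\<^esub>"
proof -
  interpret M: abelian_group M by fact
  interpret N: abelian_group N by fact
  have "h \<zero>\<^bsub>M\<^esub> \<oplus>\<^bsub>N\<^esub> h \<zero>\<^bsub>M\<^esub> = h \<zero>\<^bsub>M\<^esub>" using assms(4)[of "\<zero>\<^bsub>M\<^esub>" "\<zero>\<^bsub>M\<^esub>"] by simp
  then show ?thesis using assms(3) N.add.l_cancel_one' by simp
qed

lemma additive_finsum:
  assumes "abelian_group M" "abelian_group N" "\<And>x. x \<in> carrier M \<Longrightarrow> h x \<in> carrier N"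
    "\<And>x y. x \<in> carrier M \<Longrightarrow> y \<in> carrier M \<Longrightarrow> h (x \<oplus>\<^bsub>M\<^esub> y) = h x \<oplus>\<^bsub>N\<^esub> h y"
    and "\<And>i. i \<in> A \<Longrightarrow> u i \<in> carrier M"
  shows "h (\<Oplus>\<^bsub>M\<^esub>i\<in>A. u i) = (\<Oplus>\<^bsub>N\<^esub>i\<in>A. h (u i))"
proof -
  interpret M: abelian_group M by fact
  interpret N: abelian_group N by fact
  have z: "h \<zero>\<^bsub>M\<^esub> = \<zero>\<^bsub>N\<^esub>" by (intro additive_zero assms M.zero_closed)
  \<comment> \<open>An infinite index set is allowed: both sums are then zero by convention, and
    \<open>h\<close> preserves zero.\<close>
  show ?thesis using assms(5)
    by (induction A rule: infinite_finite_induct) (auto simp: z assms(3,4) Pi_iff)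
qed

lemma (in left_module) finsum_lsmult:
  assumes "\<And>i. i \<in> A \<Longrightarrow> c i \<in> carrier R" "x \<in> carrier M"
  shows "(\<Oplus>i\<in>A. c i) \<odot>\<^bsub>M\<^esub> x = (\<Oplus>\<^bsub>M\<^esub>i\<in>A. c i \<odot>\<^bsub>M\<^esub> x)"
  using assms by (intro additive_finsum[where h = "\<lambda>c. c \<odot>\<^bsub>M\<^esub> x"])
    (auto simp: lsmult_l_distr R.abelian_group_axioms M.abelian_group_axioms)

lemma (in left_module) lsmult_finsum:
  assumes "\<And>i. i \<in> A \<Longrightarrow> u i \<in> carrier M" "c \<in> carrier R"
  shows "c \<odot>\<^bsub>M\<^esub> (\<Oplus>\<^bsub>M\<^esub>i\<in>A. u i) = (\<Oplus>\<^bsub>M\<^esub>i\<in>A. c \<odot>\<^bsub>M\<^esub> u i)"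
  using assms by (intro additive_finsum[where h = "\<lambda>x. c \<odot>\<^bsub>M\<^esub> x"])
    (auto simp: lsmult_r_distr M.abelian_group_axioms)

lemma mod_homD:
  assumes "f \<in> mod_hom R M N"
  shows "x \<in> carrier M \<Longrightarrow> f x \<in> carrier N"
    "x \<in> carrier M \<Longrightarrow> y \<in> carrier M \<Longrightarrow> f (x \<oplus>\<^bsub>M\<^esub> y) = f x \<oplus>\<^bsub>N\<^esub> f y"
    "r \<in> carrier R \<Longrightarrow> x \<in> carrier M \<Longrightarrow> f (r \<odot>\<^bsub>M\<^esub> x) = r \<odot>\<^bsub>N\<^esub> f x"
    "x \<notin> carrier M \<Longrightarrow> f x = undefined"
  using assms by (auto simp: mod_hom_def PiE_def extensional_def)

lemma mod_homI:
  assumes "\<And>x. x \<in> carrier M \<Longrightarrow> f x \<in> carrier N"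
    "\<And>x y. x \<in> carrier M \<Longrightarrow> y \<in> carrier M \<Longrightarrow> f (x \<oplus>\<^bsub>M\<^esub> y) = f x \<oplus>\<^bsub>N\<^esub> f y"
    "\<And>r x. r \<in> carrier R \<Longrightarrow> x \<in> carrier M \<Longrightarrow> f (r \<odot>\<^bsub>M\<^esub> x) = r \<odot>\<^bsub>N\<^esub> f x"
    and M: "left_module R M"
  shows "(\<lambda>x\<in>carrier M. f x) \<in> mod_hom R M N"
proof -
  interpret left_module R M by fact
  show ?thesis using assms(1-3) by (auto simp: mod_hom_def)
qed

lemma mod_hom_eqI:
  assumes "f \<in> mod_hom R M N" "g \<in> mod_hom R M N'" "\<And>x. x \<in> carrier M \<Longrightarrow> f x = g x"
  shows "f = g"
  using assms(3) mod_homD(4)[OF assms(1)] mod_homD(4)[OF assms(2)] by (metis ext)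

lemma mod_hom_zero:
  assumes "f \<in> mod_hom R M N" "left_module R M" "left_module R N"
  shows "f \<zero>\<^bsub>M\<^esub> = \<zero>\<^bsub>N\<^esub>"
proof -
  interpret M: left_module R M by fact
  interpret N: left_module R N by fact
  show ?thesis by (intro additive_zero M.M.abelian_group_axioms N.M.abelian_group_axioms mod_homD[OF assms(1)] M.M.zero_closed)
qed

lemma mod_hom_sum:
  assumes "f \<in> mod_hom R M N" "left_module R M" "left_module R N" "\<And>i. i \<in> A \<Longrightarrow> u i \<in> carrier M"
  shows "f (\<Oplus>\<^bsub>M\<^esub>i\<in>A. u i) = (\<Oplus>\<^bsub>N\<^esub>i\<in>A. f (u i))"
  using assms mod_homD[OF assms(1)]
  by (intro additive_finsum) (auto simp: left_module_def)

lemma mod_hom_inv_into: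
  assumes f: "f \<in> mod_hom R M N" "inj_on f (carrier M)" "f ` carrier M = carrier N"
    and M: "left_module R M" and N: "left_module R N"
  shows "(\<lambda>y\<in>carrier N. inv_into (carrier M) f y) \<in> mod_hom R N M"
proof -
  interpret M: left_module R M by fact
  interpret N: left_module R N by fact
  let ?g = "inv_into (carrier M) f"
  have g: "?g y \<in> carrier M" "f (?g y) = y" if "y \<in> carrier N" for y
    using that f(3) by (auto intro: inv_into_into f_inv_into_f)
  have eq: "x = ?g y" if "x \<in> carrier M" "f x = y" for x y
    using that f(2) by (metis inv_into_f_f)
  show ?thesis
    by (rule mod_homI[OF _ _ _ N]) (auto simp: g mod_homD[OF f(1)] intro!: eq[symmetric])
qed

section \<open>Homomorphic images on other carrier types\<close>

text \<open>Both transport along an injection and quotients are instances: a quotient is obtained from a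
  choice of representatives.\<close>

definition image_module :: "('m \<Rightarrow> 'n) \<Rightarrow> ('r, 'm, 'y) module_scheme \<Rightarrow> ('r, 'n) module"
  where "image_module c M = \<lparr>carrier = c ` carrier M, mult = \<lambda>u v. u, one = c \<zero>\<^bsub>M\<^esub>, zero = c \<zero>\<^bsub>M\<^esub>,
    add = \<lambda>u v. c (inv_into (carrier M) c u \<oplus>\<^bsub>M\<^esub> inv_into (carrier M) c v),
    smult = \<lambda>r u. c (r \<odot>\<^bsub>M\<^esub> inv_into (carrier M) c u)\<rparr>"

text \<open>The two assumptions say that the fibres of \<open>c\<close> form a congruence, so the
  operations of \<open>image_module\<close>, which are computed on chosen preimages, do not depend
  on the choice.\<close>

lemma (in left_module) image_module:
  assumes add: "\<And>x y x' y'. \<lbrakk>x \<in> carrier M; y \<in> carrier M; x' \<in> carrier M; y' \<in> carrier M; c x = c x'; c y = c y'\<rbrakk>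
      \<Longrightarrow> c (x \<oplus>\<^bsub>M\<^esub> y) = c (x' \<oplus>\<^bsub>M\<^esub> y')"
    and smult: "\<And>r x x'. \<lbrakk>r \<in> carrier R; x \<in> carrier M; x' \<in> carrier M; c x = c x'\<rbrakk>
      \<Longrightarrow> c (r \<odot>\<^bsub>M\<^esub> x) = c (r \<odot>\<^bsub>M\<^esub> x')"
  shows "left_module R (image_module c M)"
    and "(\<lambda>x\<in>carrier M. c x) \<in> mod_hom R M (image_module c M)"
proof -
  let ?N = "image_module c M"
  have car: "carrier ?N = c ` carrier M" "\<zero>\<^bsub>?N\<^esub> = c \<zero>\<^bsub>M\<^esub>" by (auto simp: image_module_def)
  have i: "inv_into (carrier M) c (c x) \<in> carrier M" "c (inv_into (carrier M) c (c x)) = c x"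
    if "x \<in> carrier M" for x using that by (auto intro: inv_into_into f_inv_into_f)
  have a: "c x \<oplus>\<^bsub>?N\<^esub> c y = c (x \<oplus>\<^bsub>M\<^esub> y)" if "x \<in> carrier M" "y \<in> carrier M" for x y
    using that i by (auto simp: image_module_def intro!: add)
  have s: "r \<odot>\<^bsub>?N\<^esub> c x = c (r \<odot>\<^bsub>M\<^esub> x)" if "r \<in> carrier R" "x \<in> carrier M" for r x
    using that i by (auto simp: image_module_def intro!: smult)
  have ag: "abelian_group ?N"
  proof (rule abelian_groupI)
    fix x assume "x \<in> carrier ?N"
    then obtain x' where "x' \<in> carrier M" "x = c x'" by (auto simp: car)
    then show "\<exists>y\<in>carrier ?N. y \<oplus>\<^bsub>?N\<^esub> x = \<zero>\<^bsub>?N\<^esub>"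
      by (intro bexI[of _ "c (\<ominus>\<^bsub>M\<^esub> x')"]) (auto simp: car a M.l_neg)
  qed (auto simp: car a M.a_ac)
  show "left_module R ?N"
    by (intro left_module.intro left_module_axioms.intro R.ring_axioms ag)
      (auto simp: car a s lsmult_l_distr lsmult_r_distr lsmult_assoc)
  show "(\<lambda>x\<in>carrier M. c x) \<in> mod_hom R M ?N"
    by (rule mod_homI) (auto simp: car a s left_module_axioms)
qed

lemma image_module_inj:
  assumes "left_module R M" "inj_on c (carrier M)"
  shows "left_module R (image_module c M)"
    and "(\<lambda>x\<in>carrier M. c x) \<in> mod_hom R M (image_module c M)"
    and "(\<lambda>y\<in>c ` carrier M. inv_into (carrier M) c y) \<in> mod_hom R (image_module c M) M"
proof -
  interpret left_module R M by fact
  show 1: "left_module R (image_module c M)" "(\<lambda>x\<in>carrier M. c x) \<in> mod_hom R M (image_module c M)"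
    by (rule image_module; use assms(2) in \<open>auto dest!: inj_onD[OF assms(2)]\<close>)+
  have e: "inv_into (carrier M) (\<lambda>x\<in>carrier M. c x) y = inv_into (carrier M) c y" for y
    by (simp add: inv_into_def cong: conj_cong)
  show "(\<lambda>y\<in>c ` carrier M. inv_into (carrier M) c y) \<in> mod_hom R (image_module c M) M"
    using mod_hom_inv_into[OF 1(2) _ _ assms(1) 1(1)] assms(2)
    by (simp add: e image_module_def cong: inj_on_cong image_cong)
qed

section \<open>Finitely generated projective modules via dual bases\<close>

text \<open>The criterion of the dual basis lemma. Unlike \<open>projective_module\<close> it
  quantifies over no test modules, so elementwise formulas carry it from one carrier type to
  another.\<close>

definition dual_basis ::
    "('r, 'x) ring_scheme \<Rightarrow> ('r, 'p, 'y) module_scheme \<Rightarrow> 'd set \<Rightarrow> ('d \<Rightarrow> 'p) \<Rightarrow> ('d \<Rightarrow> 'p \<Rightarrow> 'r) \<Rightarrow> bool"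
  where "dual_basis R P D x f \<longleftrightarrow> finite D \<and> x \<in> D \<rightarrow> carrier P \<and> f \<in> D \<rightarrow> mod_hom R P (reg R) \<and>
    (\<forall>p\<in>carrier P. (\<Oplus>\<^bsub>P\<^esub>d\<in>D. f d p \<odot>\<^bsub>P\<^esub> x d) = p)"

lemma reg_simps [simp]: "carrier (reg R) = carrier R" "\<zero>\<^bsub>reg R\<^esub> = \<zero>\<^bsub>R\<^esub>" "x \<oplus>\<^bsub>reg R\<^esub> y = x \<oplus>\<^bsub>R\<^esub> y"
  "x \<odot>\<^bsub>reg R\<^esub> y = x \<otimes>\<^bsub>R\<^esub> y"
  by (simp_all add: reg_def)

lemma dual_basisD:
  assumes "dual_basis R P D x f"
  shows "finite D" "d \<in> D \<Longrightarrow> x d \<in> carrier P" "d \<in> D \<Longrightarrow> f d \<in> mod_hom R P (reg R)"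
    "d \<in> D \<Longrightarrow> p \<in> carrier P \<Longrightarrow> f d p \<in> carrier R"
    "p \<in> carrier P \<Longrightarrow> (\<Oplus>\<^bsub>P\<^esub>d\<in>D. f d p \<odot>\<^bsub>P\<^esub> x d) = p"
  using assms mod_homD(1)[of _ R P "reg R"] by (fastforce simp: dual_basis_def)+

text \<open>The surjection onto \<open>P\<close> from the free module on a finite generating set
  splits. The coordinates of a splitting \<open>g\<close> are the functionals, and the generators
  index themselves.\<close>

lemma dual_basis_if_fin_gen_projective:
  fixes P :: "('r, 'p) module"
  assumes fg: "fin_gen_module R P" and P: "projective_module R P"
  shows "\<exists>D f. dual_basis R P D (\<lambda>x. x) f"
proof -
  interpret P: left_module R P using P by (simp add: projective_module_def)
  obtain D where D: "finite D" "D \<subseteq> carrier P"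
    "\<And>x. x \<in> carrier P \<Longrightarrow> \<exists>r\<in>D \<rightarrow> carrier R. x = (\<Oplus>\<^bsub>P\<^esub>s\<in>D. r s \<odot>\<^bsub>P\<^esub> s)"
    using fg unfolding fin_gen_module_def by blast
  let ?F = "free_module R D"
  have F: "left_module R ?F" by (rule free_module[OF P.R.ring_axioms])
  have cF: "carrier ?F = fin_supp_funs R D" by (simp add: free_module_def)
  define e where "e = (\<lambda>h\<in>carrier ?F. lin_ext R P (\<lambda>x. x) h)"
  have e: "e \<in> mod_hom R ?F P" unfolding e_def using D(2) by (intro P.lin_ext_hom) auto
  have ev: "e h = (\<Oplus>\<^bsub>P\<^esub>d\<in>D. h d \<odot>\<^bsub>P\<^esub> d)" if "h \<in> carrier ?F" for h
    using that D fin_supp_funsD(3)[of h R D] by (auto simp: e_def cF intro!: P.lin_ext_superset)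
  have "e ` carrier ?F = carrier P"
  proof
    show "e ` carrier ?F \<subseteq> carrier P" using mod_homD(1)[OF e] by auto
    show "carrier P \<subseteq> e ` carrier ?F"
    proof
      fix x assume "x \<in> carrier P"
      then obtain r where r: "r \<in> D \<rightarrow> carrier R" "x = (\<Oplus>\<^bsub>P\<^esub>s\<in>D. r s \<odot>\<^bsub>P\<^esub> s)" using D(3) by blast
      let ?h = "\<lambda>d. if d \<in> D then r d else \<zero>\<^bsub>R\<^esub>"
      have "finite (fsupp R ?h)" by (rule finite_subset[OF _ D(1)]) (auto simp: fsupp_def)
      then have h: "?h \<in> carrier ?F" using r(1) by (auto simp: cF fin_supp_funs_def fsupp_def)
      have "e ?h = x" unfolding ev[OF h] r(2) using r(1) D(2) by (intro P.M.finsum_cong') auto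
      then show "x \<in> e ` carrier ?F" using h by blast
    qed
  qed
  moreover have idP: "mod_id P \<in> mod_hom R P P" unfolding mod_id_def by (rule mod_homI) (auto intro: P.left_module_axioms)
  ultimately obtain g where g: "g \<in> mod_hom R P ?F" "compose (carrier P) e g = mod_id P"
    using projective_module_lifting[OF P F P.left_module_axioms e _ idP] by blast
  have eg: "e (g p) = p" if "p \<in> carrier P" for p
    using fun_cong[OF g(2), of p] that by (simp add: compose_def mod_id_def)
  have gc: "g p \<in> fin_supp_funs R D" if "p \<in> carrier P" for p using mod_homD(1)[OF g(1) that] by (simp add: cF)
  have "(\<lambda>p\<in>carrier P. g p d) \<in> mod_hom R P (reg R)" for d
    using mod_homD(2,3)[OF g(1)] fin_supp_funsD(1)[OF gc]
    by (intro mod_homI P.left_module_axioms) (auto simp: free_module_def)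
  moreover have "(\<Oplus>\<^bsub>P\<^esub>d\<in>D. g p d \<odot>\<^bsub>P\<^esub> d) = p" if "p \<in> carrier P" for p
    using ev[of "g p"] eg[OF that] gc[OF that] by (simp add: cF)
  ultimately have "dual_basis R P D (\<lambda>x. x) (\<lambda>d. \<lambda>p\<in>carrier P. g p d)"
    using D by (auto simp: dual_basis_def)
  then show ?thesis by blast
qed

lemma dual_basis_fin_gen:
  assumes "left_module R P" "dual_basis R P D x f"
  shows "fin_gen_module R P"
proof -
  interpret P: left_module R P by fact
  note D = dual_basisD[OF assms(2)]
  \<comment> \<open>Several indices may give the same element \<open>x d\<close>, while
    \<open>fin_gen_module\<close> sums over a set of generators. The coefficients are therefore
    first added up along the fibres of \<open>x\<close>.\<close>
  define fib where "fib s = {d \<in> D. x d = s}" for s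
  have "\<exists>r\<in>x ` D \<rightarrow> carrier R. p = (\<Oplus>\<^bsub>P\<^esub>s\<in>x ` D. r s \<odot>\<^bsub>P\<^esub> s)" if p: "p \<in> carrier P" for p
  proof (intro bexI)
    let ?r = "\<lambda>s. \<Oplus>\<^bsub>R\<^esub>d\<in>fib s. f d p"
    show "?r \<in> x ` D \<rightarrow> carrier R" using D(4) p by (auto simp: fib_def intro!: P.R.finsum_closed)
    have "p = (\<Oplus>\<^bsub>P\<^esub>d\<in>D. f d p \<odot>\<^bsub>P\<^esub> x d)" using D(5)[OF p] by simp
    also have "D = (\<Union>s\<in>x ` D. fib s)" by (auto simp: fib_def)
    also have "(\<Oplus>\<^bsub>P\<^esub>d\<in>(\<Union>s\<in>x ` D. fib s). f d p \<odot>\<^bsub>P\<^esub> x d) = (\<Oplus>\<^bsub>P\<^esub>s\<in>x ` D. \<Oplus>\<^bsub>P\<^esub>d\<in>fib s. f d p \<odot>\<^bsub>P\<^esub> x d)"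
      using D p by (intro P.M.add.finprod_UN_disjoint) (auto simp: fib_def pairwise_def disjnt_def)
    also have "\<dots> = (\<Oplus>\<^bsub>P\<^esub>s\<in>x ` D. ?r s \<odot>\<^bsub>P\<^esub> s)"
    proof (rule P.M.finsum_cong')
      fix s assume s: "s \<in> x ` D"
      have "(\<Oplus>\<^bsub>P\<^esub>d\<in>fib s. f d p \<odot>\<^bsub>P\<^esub> x d) = (\<Oplus>\<^bsub>P\<^esub>d\<in>fib s. f d p \<odot>\<^bsub>P\<^esub> s)"
        using D p by (intro P.M.finsum_cong') (auto simp: fib_def)
      also have "\<dots> = ?r s \<odot>\<^bsub>P\<^esub> s" using D p s by (intro P.finsum_lsmult[symmetric]) (auto simp: fib_def)
      finally show "(\<Oplus>\<^bsub>P\<^esub>d\<in>fib s. f d p \<odot>\<^bsub>P\<^esub> x d) = ?r s \<odot>\<^bsub>P\<^esub> s" .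
    qed (use D p in \<open>auto simp: fib_def intro!: P.lsmult_closed P.R.finsum_closed\<close>)
    finally show "p = (\<Oplus>\<^bsub>P\<^esub>s\<in>x ` D. ?r s \<odot>\<^bsub>P\<^esub> s)" .
  qed
  then show ?thesis unfolding fin_gen_module_def using D(1,2) by (intro exI[of _ "x ` D"]) auto
qed

text \<open>Preimages have to be chosen only for the finitely many \<open>g (x d)\<close>; the
  functionals spread this choice linearly over \<open>P\<close>.\<close>

lemma dual_basis_projective:
  fixes P :: "('r, 'p) module"
  assumes P: "left_module R P" and "dual_basis R P D x f"
  shows "projective_module R P"
  unfolding projective_module_def
proof (intro conjI P allI ballI impI)
  fix M :: "('r, 'p \<Rightarrow> 'r) module" and N :: "('r, 'p) module" and q g
  assume q: "q \<in> mod_hom R M N" and g: "g \<in> mod_hom R P N" and M: "left_module R M" and N: "left_module R N"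
    and qs: "q ` carrier M = carrier N"
  interpret P: left_module R P by fact
  interpret M: left_module R M by fact
  interpret N: left_module R N by fact
  note D = dual_basisD[OF assms(2)]
  note f = mod_homD[OF D(3)]
  have "\<forall>d\<in>D. \<exists>m\<in>carrier M. q m = g (x d)" using qs mod_homD(1)[OF g D(2)] by (metis imageE)
  then obtain m where m: "\<And>d. d \<in> D \<Longrightarrow> m d \<in> carrier M" "\<And>d. d \<in> D \<Longrightarrow> q (m d) = g (x d)" by metis
  define h where "h = (\<lambda>p\<in>carrier P. \<Oplus>\<^bsub>M\<^esub>d\<in>D. f d p \<odot>\<^bsub>M\<^esub> m d)"
  have h: "h \<in> mod_hom R P M" unfolding h_def
  proof (rule mod_homI)
    fix p p' assume p: "p \<in> carrier P" "p' \<in> carrier P"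
    have "(\<Oplus>\<^bsub>M\<^esub>d\<in>D. f d (p \<oplus>\<^bsub>P\<^esub> p') \<odot>\<^bsub>M\<^esub> m d) = (\<Oplus>\<^bsub>M\<^esub>d\<in>D. f d p \<odot>\<^bsub>M\<^esub> m d \<oplus>\<^bsub>M\<^esub> f d p' \<odot>\<^bsub>M\<^esub> m d)"
      using p m D(4) by (intro M.M.finsum_cong') (auto simp: f M.lsmult_l_distr)
    then show "(\<Oplus>\<^bsub>M\<^esub>d\<in>D. f d (p \<oplus>\<^bsub>P\<^esub> p') \<odot>\<^bsub>M\<^esub> m d) = (\<Oplus>\<^bsub>M\<^esub>d\<in>D. f d p \<odot>\<^bsub>M\<^esub> m d) \<oplus>\<^bsub>M\<^esub> (\<Oplus>\<^bsub>M\<^esub>d\<in>D. f d p' \<odot>\<^bsub>M\<^esub> m d)"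
      using p m D(4) by (simp add: M.M.finsum_addf Pi_def)
  next
    fix r p assume p: "r \<in> carrier R" "p \<in> carrier P"
    have "(\<Oplus>\<^bsub>M\<^esub>d\<in>D. f d (r \<odot>\<^bsub>P\<^esub> p) \<odot>\<^bsub>M\<^esub> m d) = (\<Oplus>\<^bsub>M\<^esub>d\<in>D. r \<odot>\<^bsub>M\<^esub> (f d p \<odot>\<^bsub>M\<^esub> m d))"
      using p m D(4) by (intro M.M.finsum_cong') (auto simp: f M.lsmult_assoc)
    then show "(\<Oplus>\<^bsub>M\<^esub>d\<in>D. f d (r \<odot>\<^bsub>P\<^esub> p) \<odot>\<^bsub>M\<^esub> m d) = r \<odot>\<^bsub>M\<^esub> (\<Oplus>\<^bsub>M\<^esub>d\<in>D. f d p \<odot>\<^bsub>M\<^esub> m d)"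
      using p m D(4) by (simp add: M.lsmult_finsum)
  qed (use P m D(4) in \<open>auto intro!: M.M.finsum_closed\<close>)
  moreover have "compose (carrier P) q h = g"
  proof (rule mod_hom_eqI[OF mod_hom_comp[OF h q P] g])
    fix p assume p: "p \<in> carrier P"
    have "q (h p) = (\<Oplus>\<^bsub>N\<^esub>d\<in>D. q (f d p \<odot>\<^bsub>M\<^esub> m d))"
      using p m D(4) by (auto simp: h_def intro!: mod_hom_sum[OF q M N])
    also have "\<dots> = (\<Oplus>\<^bsub>N\<^esub>d\<in>D. g (f d p \<odot>\<^bsub>P\<^esub> x d))"
      using p m D(2,4) mod_homD(1)[OF g] by (intro N.M.finsum_cong') (auto simp: mod_homD(3)[OF q] mod_homD(3)[OF g])
    also have "\<dots> = g p" using p D(2,4) D(5)[OF p]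
      by (subst mod_hom_sum[OF g P N, symmetric]) auto
    finally show "compose (carrier P) q h p = g p" using p by (simp add: compose_def)
  qed
  ultimately show "\<exists>h\<in>mod_hom R P M. compose (carrier P) q h = g" by blast
qed

text \<open>Only the one-sided relation between \<open>h\<close> and \<open>k\<close> enters, so
  \<open>Q\<close> may be any direct summand of \<open>P\<close>.\<close>

lemma dual_basis_iso:
  assumes P: "left_module R P" and Q: "left_module R Q" and h: "h \<in> mod_hom R P Q"
    and k: "k \<in> mod_hom R Q P" and hk: "\<And>y. y \<in> carrier Q \<Longrightarrow> h (k y) = y"
    and D: "dual_basis R P D x f"
  shows "dual_basis R Q D (\<lambda>d. h (x d)) (\<lambda>d. compose (carrier Q) (f d) k)"
proof -
  interpret P: left_module R P by fact
  interpret Q: left_module R Q by fact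
  note D' = dual_basisD[OF D]
  have "(\<Oplus>\<^bsub>Q\<^esub>d\<in>D. compose (carrier Q) (f d) k y \<odot>\<^bsub>Q\<^esub> h (x d)) = y" if y: "y \<in> carrier Q" for y
  proof -
    have ky: "k y \<in> carrier P" using mod_homD(1)[OF k y] .
    have "(\<Oplus>\<^bsub>Q\<^esub>d\<in>D. compose (carrier Q) (f d) k y \<odot>\<^bsub>Q\<^esub> h (x d)) = (\<Oplus>\<^bsub>Q\<^esub>d\<in>D. h (f d (k y) \<odot>\<^bsub>P\<^esub> x d))"
      using y ky D'(2,4) mod_homD(1)[OF h] by (intro Q.M.finsum_cong') (auto simp: compose_def mod_homD(3)[OF h])
    also have "\<dots> = h (\<Oplus>\<^bsub>P\<^esub>d\<in>D. f d (k y) \<odot>\<^bsub>P\<^esub> x d)"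
      using ky D'(2,4) by (intro mod_hom_sum[OF h P Q, symmetric]) auto
    finally show ?thesis using D'(5)[OF ky] hk[OF y] by simp
  qed
  then show ?thesis using D' mod_homD(1)[OF h] mod_hom_comp[OF k D'(3) Q] by (auto simp: dual_basis_def)
qed

text \<open>An element is determined by its finitely many coordinates \<open>f d p\<close>. This
  yields the carrier type that the definition of a finite resolution prescribes.\<close>

lemma dual_basis_inj:
  fixes P :: "('r, 'p, 'y) module_scheme"
  assumes "left_module R P" "dual_basis R P D x f"
  shows "\<exists>j :: 'p \<Rightarrow> nat \<Rightarrow> 'r. inj_on j (carrier P)"
proof -
  interpret P: left_module R P by fact
  note D = dual_basisD[OF assms(2)]
  obtain n :: "_ \<Rightarrow> nat" where n: "inj_on n D" using D(1) finite_imp_inj_to_nat_seg by blast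
  have "inj_on (\<lambda>p k. f (inv_into D n k) p) (carrier P)"
  proof (rule inj_onI)
    fix p p' assume p: "p \<in> carrier P" "p' \<in> carrier P"
      and eq: "(\<lambda>k. f (inv_into D n k) p) = (\<lambda>k. f (inv_into D n k) p')"
    have "f d p = f d p'" if "d \<in> D" for d using fun_cong[OF eq, of "n d"] that n by simp
    then have "(\<Oplus>\<^bsub>P\<^esub>d\<in>D. f d p \<odot>\<^bsub>P\<^esub> x d) = (\<Oplus>\<^bsub>P\<^esub>d\<in>D. f d p' \<odot>\<^bsub>P\<^esub> x d)"
      using D(2,4) p by (intro P.M.finsum_cong') auto
    then show "p = p'" using D(5) p by simp
  qed
  then show ?thesis by blast
qed

text \<open>A resolution on an arbitrary carrier type \<open>'p\<close> suffices: each
  \<open>P i\<close> embeds into the prescribed type by \<open>dual_basis_inj\<close>, and the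
  differentials are conjugated with these embeddings.\<close>

lemma has_finite_fgproj_resolutionI:
  fixes P :: "nat \<Rightarrow> ('r, 'p) module" and x :: "nat \<Rightarrow> 'd \<Rightarrow> 'p"
  assumes P: "\<And>i. left_module R (P i)" and D: "\<And>i. dual_basis R (P i) (D i) (x i) (f i)"
    and d: "\<And>i. d i \<in> mod_hom R (P (Suc i)) (P i)"
    and e: "e \<in> mod_hom R (P 0) M" "e ` carrier (P 0) = carrier M"
    and ex0: "d 0 ` carrier (P (Suc 0)) = {x \<in> carrier (P 0). e x = \<zero>\<^bsub>M\<^esub>}"
    and ex: "\<And>i. d (Suc i) ` carrier (P (Suc (Suc i))) = {x \<in> carrier (P (Suc i)). d i x = \<zero>\<^bsub>P i\<^esub>}"
    and fin: "\<And>i. i > n \<Longrightarrow> carrier (P i) = {\<zero>\<^bsub>P i\<^esub>}"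
  shows "has_finite_fgproj_resolution R M"
proof -
  have "\<exists>j :: 'p \<Rightarrow> nat \<Rightarrow> 'r. inj_on j (carrier (P i))" for i by (rule dual_basis_inj[OF P D])
  then obtain j :: "nat \<Rightarrow> 'p \<Rightarrow> nat \<Rightarrow> 'r" where j: "\<And>i. inj_on (j i) (carrier (P i))" by metis
  define P' where "P' i = image_module (j i) (P i)" for i
  define h where "h i = (\<lambda>x\<in>carrier (P i). j i x)" for i
  define k where "k i = (\<lambda>y\<in>carrier (P' i). inv_into (carrier (P i)) (j i) y)" for i
  have c: "carrier (P' i) = j i ` carrier (P i)" "\<zero>\<^bsub>P' i\<^esub> = j i \<zero>\<^bsub>P i\<^esub>" for i by (auto simp: P'_def image_module_def)
  note im = image_module_inj[OF P j, folded P'_def h_def, folded c(1), folded k_def]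
  have hk: "h i (k i y) = y" if "y \<in> carrier (P' i)" for i y
    using that mod_homD(1)[OF im(3) that] by (auto simp: h_def k_def c intro: f_inv_into_f)
  have kh: "k i (h i y) = y" if "y \<in> carrier (P i)" for i y
    using that j by (auto simp: h_def k_def c)
  have hc: "h i ` carrier (P i) = carrier (P' i)" for i by (auto simp: h_def c)
  have kc: "k i ` carrier (P' i) = carrier (P i)" for i
    using kh hc[of i] mod_homD(1)[OF im(3)] by (force simp: image_iff)
  have h0: "h i y = \<zero>\<^bsub>P' i\<^esub> \<longleftrightarrow> y = \<zero>\<^bsub>P i\<^esub>" if "y \<in> carrier (P i)" for i y
    using that kh mod_hom_zero[OF im(2) P im(1), of i] abelian_group.a_group left_module.axioms(2)[OF P]
    by (metis left_module_def abelian_group.axioms(1) abelian_monoid.zero_closed)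
  define d' where "d' i = compose (carrier (P' (Suc i))) (h i) (compose (carrier (P' (Suc i))) (d i) (k (Suc i)))" for i
  define e' where "e' = compose (carrier (P' 0)) e (k 0)"
  have d': "d' i \<in> mod_hom R (P' (Suc i)) (P' i)" for i
    unfolding d'_def by (intro mod_hom_comp[OF _ im(2)] mod_hom_comp[OF im(3) d] im(1))
  have e'h: "e' \<in> mod_hom R (P' 0) M" unfolding e'_def by (intro mod_hom_comp[OF im(3) e(1)] im(1))
  have dv: "d' i ` carrier (P' (Suc i)) = h i ` d i ` carrier (P (Suc i))" for i
    unfolding kc[symmetric, of "Suc i"] by (auto simp: d'_def compose_def image_image cong: image_cong_simp)
  have dk: "d' i y = h i (d i (k (Suc i) y))" if "y \<in> carrier (P' (Suc i))" for i y using that by (simp add: d'_def compose_def)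
  have ek: "e' y = e (k 0 y)" if "y \<in> carrier (P' 0)" for y using that by (simp add: e'_def compose_def)
  have split: "h i ` {x \<in> carrier (P i). Q x} = {y \<in> carrier (P' i). Q (k i y)}" for i Q
    using kh hk hc[of i] mod_homD(1)[OF im(3), of _ i] by (force simp: image_iff)
  show ?thesis unfolding has_finite_fgproj_resolution_def
  proof (intro exI conjI allI impI)
    fix i
    note D' = dual_basis_iso[OF P im(1,2,3) hk D, of i]
    show "fin_gen_module R (P' i)" by (rule dual_basis_fin_gen[OF im(1) D'])
    show "projective_module R (P' i)" by (rule dual_basis_projective[OF im(1) D'])
    show "d' i \<in> mod_hom R (P' (Suc i)) (P' i)" by (rule d')
    show "e' \<in> mod_hom R (P' 0) M" by (rule e'h)
    show "e' ` carrier (P' 0) = carrier M"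
      unfolding e(2)[symmetric] kc[symmetric, of 0] by (auto simp: ek image_image)
    show "d' 0 ` carrier (P' (Suc 0)) = {x \<in> carrier (P' 0). e' x = \<zero>\<^bsub>M\<^esub>}"
      unfolding dv ex0 split by (auto simp: ek)
    have "h (Suc i) ` d (Suc i) ` carrier (P (Suc (Suc i))) = {y \<in> carrier (P' (Suc i)). d i (k (Suc i) y) = \<zero>\<^bsub>P i\<^esub>}"
      unfolding ex split ..
    also have "\<dots> = {x \<in> carrier (P' (Suc i)). d' i x = \<zero>\<^bsub>P' i\<^esub>}"
      using h0 mod_homD(1)[OF d mod_homD(1)[OF im(3)]] mod_hom_zero[OF im(2) P im(1)] by (auto simp: dk)
    finally show "d' (Suc i) ` carrier (P' (Suc (Suc i))) = {x \<in> carrier (P' (Suc i)). d' i x = \<zero>\<^bsub>P' i\<^esub>}"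
      unfolding dv .
    show "carrier (P' i) = {\<zero>\<^bsub>P' i\<^esub>}" if "i > n" for i using fin[OF that] by (simp add: c)
  qed
qed

section \<open>Morita data and the induced functor\<close>

text \<open>For a Morita context \<open>(P, Q)\<close> and families \<open>p\<^sub>i \<in> P\<close>, \<open>q\<^sub>i \<in> Q\<close> these are the maps
  \<open>phi i l s = (q\<^sub>i, s p\<^sub>l)\<close> and \<open>theta k j r = [p\<^sub>k r, q\<^sub>j]\<close>; the families indexed by \<open>I\<close> and \<open>J\<close> express
  that the two pairings are onto. The axioms are symmetric in the two rings.\<close>

locale morita_data = R: ring R + S: ring S
  for R :: "('r, 'x) ring_scheme" and S :: "('s, 'y) ring_scheme" and I :: "'i set" and J :: "'i set"
    and phi :: "'i \<Rightarrow> 'i \<Rightarrow> 's \<Rightarrow> 'r" and theta :: "'i \<Rightarrow> 'i \<Rightarrow> 'r \<Rightarrow> 's" +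
  assumes finite: "finite I" "finite J"
    and phi_closed [simp]: "s \<in> carrier S \<Longrightarrow> phi i l s \<in> carrier R"
    and phi_add: "\<lbrakk>s \<in> carrier S; s' \<in> carrier S\<rbrakk> \<Longrightarrow> phi i l (s \<oplus>\<^bsub>S\<^esub> s') = phi i l s \<oplus>\<^bsub>R\<^esub> phi i l s'"
    and theta_closed [simp]: "r \<in> carrier R \<Longrightarrow> theta i l r \<in> carrier S"
    and theta_add: "\<lbrakk>r \<in> carrier R; r' \<in> carrier R\<rbrakk> \<Longrightarrow> theta i l (r \<oplus>\<^bsub>R\<^esub> r') = theta i l r \<oplus>\<^bsub>S\<^esub> theta i l r'"
    and phi_mult: "\<lbrakk>s \<in> carrier S; s' \<in> carrier S\<rbrakk> \<Longrightarrow>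
      (\<Oplus>\<^bsub>R\<^esub>k\<in>I. phi i k s \<otimes>\<^bsub>R\<^esub> phi k l s') = phi i l (s \<otimes>\<^bsub>S\<^esub> s')"
    and theta_mult: "\<lbrakk>r \<in> carrier R; r' \<in> carrier R\<rbrakk> \<Longrightarrow>
      (\<Oplus>\<^bsub>S\<^esub>k\<in>J. theta i k r \<otimes>\<^bsub>S\<^esub> theta k l r') = theta i l (r \<otimes>\<^bsub>R\<^esub> r')"
    and phi_theta: "r \<in> carrier R \<Longrightarrow>
      phi i l (theta k j r) = phi i k \<one>\<^bsub>S\<^esub> \<otimes>\<^bsub>R\<^esub> r \<otimes>\<^bsub>R\<^esub> phi j l \<one>\<^bsub>S\<^esub>"
    and theta_phi: "s \<in> carrier S \<Longrightarrow>
      theta k j (phi i l s) = theta k i \<one>\<^bsub>R\<^esub> \<otimes>\<^bsub>S\<^esub> s \<otimes>\<^bsub>S\<^esub> theta l j \<one>\<^bsub>R\<^esub>"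
    and theta_one: "(\<Oplus>\<^bsub>S\<^esub>k\<in>I. theta k k \<one>\<^bsub>R\<^esub>) = \<one>\<^bsub>S\<^esub>"
    and phi_one: "(\<Oplus>\<^bsub>R\<^esub>k\<in>J. phi k k \<one>\<^bsub>S\<^esub>) = \<one>\<^bsub>R\<^esub>"
begin

lemma swap: "morita_data S R J I theta phi"
  by (intro morita_data.intro morita_data_axioms.intro S.ring_axioms R.ring_axioms)
    (simp_all add: finite phi_add theta_add phi_mult theta_mult phi_theta theta_phi theta_one phi_one)

text \<open>In a Morita context this reads
  \<open>[p_k (q_i, s p_l) r, q_j] = [p_k, q_i] s [p_l r, q_j]\<close>. From the axioms:
  \<open>theta_mult\<close> splits off \<open>r\<close> by a sum over \<open>J\<close>,
  \<open>theta_phi\<close> rewrites each term, and \<open>theta_mult\<close> puts the sum together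
  again.\<close>

lemma theta_phi_mult:
  assumes s: "s \<in> carrier S" and r: "r \<in> carrier R"
  shows "theta k j (phi i l s \<otimes>\<^bsub>R\<^esub> r) = theta k i \<one>\<^bsub>R\<^esub> \<otimes>\<^bsub>S\<^esub> s \<otimes>\<^bsub>S\<^esub> theta l j r"
proof -
  have "theta k j (phi i l s \<otimes>\<^bsub>R\<^esub> r) = (\<Oplus>\<^bsub>S\<^esub>m\<in>J. theta k m (phi i l s) \<otimes>\<^bsub>S\<^esub> theta m j r)"
    using s r by (simp add: theta_mult)
  also have "\<dots> = (\<Oplus>\<^bsub>S\<^esub>m\<in>J. (theta k i \<one>\<^bsub>R\<^esub> \<otimes>\<^bsub>S\<^esub> s) \<otimes>\<^bsub>S\<^esub> (theta l m \<one>\<^bsub>R\<^esub> \<otimes>\<^bsub>S\<^esub> theta m j r))"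
    using s r by (intro S.finsum_cong') (auto simp: theta_phi S.m_assoc)
  also have "\<dots> = (theta k i \<one>\<^bsub>R\<^esub> \<otimes>\<^bsub>S\<^esub> s) \<otimes>\<^bsub>S\<^esub> (\<Oplus>\<^bsub>S\<^esub>m\<in>J. theta l m \<one>\<^bsub>R\<^esub> \<otimes>\<^bsub>S\<^esub> theta m j r)"
    using s r by (intro S.finsum_rdistr[symmetric] finite) auto
  finally show ?thesis using r by (simp add: theta_mult)
qed

definition mat_act :: "('r, 'm, 'z) module_scheme \<Rightarrow> 's \<Rightarrow> ('i \<Rightarrow> 'm) \<Rightarrow> 'i \<Rightarrow> 'm"
  where "mat_act M s t = (\<lambda>i\<in>I. \<Oplus>\<^bsub>M\<^esub>k\<in>I. phi i k s \<odot>\<^bsub>M\<^esub> t k)"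

text \<open>For a Morita context this is \<open>P \<otimes> M\<close> over \<open>R\<close>,
  embedded into the families in \<open>M\<close> by sending \<open>p \<otimes> m\<close> to the
  family \<open>(q_i, p) m\<close>. Since the \<open>[p_k, q_k]\<close> with \<open>k\<close> in
  \<open>I\<close> add up to 1, \<open>s\<close> acts on such families through the matrix
  \<open>phi i k s\<close>. The matrix of the unit is idempotent but in general not the identity
  matrix; its image is the tensor product.\<close>

definition ind_module :: "('r, 'm, 'z) module_scheme \<Rightarrow> ('s, 'i \<Rightarrow> 'm) module"
  where "ind_module M = \<lparr>carrier = {t \<in> I \<rightarrow>\<^sub>E carrier M. mat_act M \<one>\<^bsub>S\<^esub> t = t},
    mult = \<lambda>t u. t, one = (\<lambda>i\<in>I. \<zero>\<^bsub>M\<^esub>), zero = (\<lambda>i\<in>I. \<zero>\<^bsub>M\<^esub>),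
    add = \<lambda>t u. \<lambda>i\<in>I. t i \<oplus>\<^bsub>M\<^esub> u i, smult = mat_act M\<rparr>"

lemma ind_module_simps:
  "carrier (ind_module M) = {t \<in> I \<rightarrow>\<^sub>E carrier M. mat_act M \<one>\<^bsub>S\<^esub> t = t}"
  "\<zero>\<^bsub>ind_module M\<^esub> = (\<lambda>i\<in>I. \<zero>\<^bsub>M\<^esub>)" "t \<oplus>\<^bsub>ind_module M\<^esub> u = (\<lambda>i\<in>I. t i \<oplus>\<^bsub>M\<^esub> u i)"
  "s \<odot>\<^bsub>ind_module M\<^esub> t = mat_act M s t"
  by (simp_all add: ind_module_def)

lemma ind_moduleD:
  assumes "t \<in> carrier (ind_module M)"
  shows "i \<in> I \<Longrightarrow> t i \<in> carrier M" "t \<in> I \<rightarrow>\<^sub>E carrier M" "mat_act M \<one>\<^bsub>S\<^esub> t = t"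
    "i \<in> I \<Longrightarrow> (\<Oplus>\<^bsub>M\<^esub>k\<in>I. phi i k \<one>\<^bsub>S\<^esub> \<odot>\<^bsub>M\<^esub> t k) = t i"
proof -
  show 1: "i \<in> I \<Longrightarrow> t i \<in> carrier M" "t \<in> I \<rightarrow>\<^sub>E carrier M" "mat_act M \<one>\<^bsub>S\<^esub> t = t"
    using assms by (auto simp: ind_module_simps)
  show "i \<in> I \<Longrightarrow> (\<Oplus>\<^bsub>M\<^esub>k\<in>I. phi i k \<one>\<^bsub>S\<^esub> \<odot>\<^bsub>M\<^esub> t k) = t i"
    using fun_cong[OF 1(3), of i] by (simp add: mat_act_def)
qed

section \<open>The module structure on the fixed families, and its dual bases\<close>

context
  fixes M :: "('r, 'm, 'z) module_scheme"
  assumes M: "left_module R M"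
begin

interpretation M: left_module R M by (rule M)

lemma mat_act_apply: "i \<in> I \<Longrightarrow> mat_act M s t i = (\<Oplus>\<^bsub>M\<^esub>k\<in>I. phi i k s \<odot>\<^bsub>M\<^esub> t k)"
  by (simp add: mat_act_def)

lemma mat_act_closed: "s \<in> carrier S \<Longrightarrow> t \<in> I \<rightarrow> carrier M \<Longrightarrow> mat_act M s t \<in> I \<rightarrow>\<^sub>E carrier M"
  by (auto simp: mat_act_def intro!: M.M.finsum_closed)

lemma mat_act_mult:
  assumes s: "s \<in> carrier S" "s' \<in> carrier S" and t: "t \<in> I \<rightarrow> carrier M"
  shows "mat_act M s (mat_act M s' t) = mat_act M (s \<otimes>\<^bsub>S\<^esub> s') t"
proof (rule extensionalityI)
  fix i assume i: "i \<in> I"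
  have "mat_act M s (mat_act M s' t) i = (\<Oplus>\<^bsub>M\<^esub>k\<in>I. phi i k s \<odot>\<^bsub>M\<^esub> (\<Oplus>\<^bsub>M\<^esub>l\<in>I. phi k l s' \<odot>\<^bsub>M\<^esub> t l))"
    unfolding mat_act_apply[OF i]
    using s t by (intro M.M.finsum_cong') (auto simp: mat_act_def Pi_iff intro!: M.M.finsum_closed)
  also have "\<dots> = (\<Oplus>\<^bsub>M\<^esub>k\<in>I. \<Oplus>\<^bsub>M\<^esub>l\<in>I. (phi i k s \<otimes>\<^bsub>R\<^esub> phi k l s') \<odot>\<^bsub>M\<^esub> t l)"
  proof (rule M.M.finsum_cong')
    fix k assume "k \<in> I"
    show "phi i k s \<odot>\<^bsub>M\<^esub> (\<Oplus>\<^bsub>M\<^esub>l\<in>I. phi k l s' \<odot>\<^bsub>M\<^esub> t l) = (\<Oplus>\<^bsub>M\<^esub>l\<in>I. (phi i k s \<otimes>\<^bsub>R\<^esub> phi k l s') \<odot>\<^bsub>M\<^esub> t l)"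
      using s t by (subst M.lsmult_finsum) (auto simp: Pi_iff M.lsmult_assoc intro!: M.M.finsum_cong')
  qed (use s t in \<open>auto simp: Pi_iff intro!: M.M.finsum_closed\<close>)
  also have "\<dots> = (\<Oplus>\<^bsub>M\<^esub>l\<in>I. \<Oplus>\<^bsub>M\<^esub>k\<in>I. (phi i k s \<otimes>\<^bsub>R\<^esub> phi k l s') \<odot>\<^bsub>M\<^esub> t l)"
    using s t by (intro M.M.finsum_swap finite) auto
  also have "\<dots> = (\<Oplus>\<^bsub>M\<^esub>l\<in>I. phi i l (s \<otimes>\<^bsub>S\<^esub> s') \<odot>\<^bsub>M\<^esub> t l)"
  proof (rule M.M.finsum_cong')
    fix l assume "l \<in> I"
    then show "(\<Oplus>\<^bsub>M\<^esub>k\<in>I. (phi i k s \<otimes>\<^bsub>R\<^esub> phi k l s') \<odot>\<^bsub>M\<^esub> t l) = phi i l (s \<otimes>\<^bsub>S\<^esub> s') \<odot>\<^bsub>M\<^esub> t l"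
      using s t by (subst M.finsum_lsmult[symmetric]) (auto simp: phi_mult)
  qed (use s t in auto)
  finally show "mat_act M s (mat_act M s' t) i = mat_act M (s \<otimes>\<^bsub>S\<^esub> s') t i" using i by (simp add: mat_act_def)
qed (auto simp: mat_act_def)

lemma mat_act_add:
  assumes "s \<in> carrier S" and "t \<in> I \<rightarrow> carrier M" "u \<in> I \<rightarrow> carrier M"
  shows "mat_act M s (\<lambda>i\<in>I. t i \<oplus>\<^bsub>M\<^esub> u i) = (\<lambda>i\<in>I. mat_act M s t i \<oplus>\<^bsub>M\<^esub> mat_act M s u i)"
proof (rule extensionalityI)
  fix i assume i: "i \<in> I"
  have "(\<Oplus>\<^bsub>M\<^esub>k\<in>I. phi i k s \<odot>\<^bsub>M\<^esub> (\<lambda>i\<in>I. t i \<oplus>\<^bsub>M\<^esub> u i) k)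
      = (\<Oplus>\<^bsub>M\<^esub>k\<in>I. phi i k s \<odot>\<^bsub>M\<^esub> t k \<oplus>\<^bsub>M\<^esub> phi i k s \<odot>\<^bsub>M\<^esub> u k)"
    using assms by (intro M.M.finsum_cong') (auto simp: Pi_iff M.lsmult_r_distr)
  also have "\<dots> = (\<Oplus>\<^bsub>M\<^esub>k\<in>I. phi i k s \<odot>\<^bsub>M\<^esub> t k) \<oplus>\<^bsub>M\<^esub> (\<Oplus>\<^bsub>M\<^esub>k\<in>I. phi i k s \<odot>\<^bsub>M\<^esub> u k)"
    using assms by (intro M.M.finsum_addf) (auto simp: Pi_iff)
  finally show "mat_act M s (\<lambda>i\<in>I. t i \<oplus>\<^bsub>M\<^esub> u i) i = (\<lambda>i\<in>I. mat_act M s t i \<oplus>\<^bsub>M\<^esub> mat_act M s u i) i"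
    using i by (simp add: mat_act_apply)
qed (auto simp: mat_act_def)

lemma mat_act_add_left:
  assumes "s \<in> carrier S" "s' \<in> carrier S" and "t \<in> I \<rightarrow> carrier M"
  shows "mat_act M (s \<oplus>\<^bsub>S\<^esub> s') t = (\<lambda>i\<in>I. mat_act M s t i \<oplus>\<^bsub>M\<^esub> mat_act M s' t i)"
proof (rule extensionalityI)
  fix i assume i: "i \<in> I"
  have "(\<Oplus>\<^bsub>M\<^esub>k\<in>I. phi i k (s \<oplus>\<^bsub>S\<^esub> s') \<odot>\<^bsub>M\<^esub> t k) = (\<Oplus>\<^bsub>M\<^esub>k\<in>I. phi i k s \<odot>\<^bsub>M\<^esub> t k \<oplus>\<^bsub>M\<^esub> phi i k s' \<odot>\<^bsub>M\<^esub> t k)"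
    using assms by (intro M.M.finsum_cong') (auto simp: Pi_iff phi_add M.lsmult_l_distr)
  also have "\<dots> = (\<Oplus>\<^bsub>M\<^esub>k\<in>I. phi i k s \<odot>\<^bsub>M\<^esub> t k) \<oplus>\<^bsub>M\<^esub> (\<Oplus>\<^bsub>M\<^esub>k\<in>I. phi i k s' \<odot>\<^bsub>M\<^esub> t k)"
    using assms by (intro M.M.finsum_addf) (auto simp: Pi_iff)
  finally show "mat_act M (s \<oplus>\<^bsub>S\<^esub> s') t i = (\<lambda>i\<in>I. mat_act M s t i \<oplus>\<^bsub>M\<^esub> mat_act M s' t i) i"
    using i by (simp add: mat_act_apply)
qed (auto simp: mat_act_def)

text \<open>The unit of \<open>S\<close> can be absorbed into \<open>s\<close> by
  \<open>mat_act_mult\<close>. For \<open>s\<close> equal to the unit this gives a projection of all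
  families onto the carrier, which is how elements of \<open>ind_module M\<close> are produced
  later.\<close>

lemma mat_act_mem:
  assumes "s \<in> carrier S" "t \<in> I \<rightarrow> carrier M"
  shows "mat_act M s t \<in> carrier (ind_module M)"
  using mat_act_closed[OF assms] assms by (simp add: ind_module_simps mat_act_mult)

lemma left_module_ind: "left_module S (ind_module M)"
proof (intro left_module.intro left_module_axioms.intro S.ring_axioms)
  let ?T = "ind_module M"
  have z: "mat_act M s (\<lambda>i\<in>I. \<zero>\<^bsub>M\<^esub>) = (\<lambda>i\<in>I. \<zero>\<^bsub>M\<^esub>)" if "s \<in> carrier S" for s
    using that by (auto simp: mat_act_def intro!: restrict_ext M.M.add.finprod_one_eqI)
  have mem: "t \<in> I \<rightarrow>\<^sub>E carrier M" "t \<in> I \<rightarrow> carrier M" if "t \<in> carrier ?T" for t using ind_moduleD[OF that] by auto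
  have add: "(\<lambda>i\<in>I. t i \<oplus>\<^bsub>M\<^esub> u i) \<in> carrier ?T" if tu: "t \<in> carrier ?T" "u \<in> carrier ?T" for t u
  proof -
    have "mat_act M \<one>\<^bsub>S\<^esub> (\<lambda>i\<in>I. t i \<oplus>\<^bsub>M\<^esub> u i) = (\<lambda>i\<in>I. t i \<oplus>\<^bsub>M\<^esub> u i)"
      using tu by (simp add: mat_act_add mem ind_moduleD(3))
    then show ?thesis using ind_moduleD(1)[OF tu(1)] ind_moduleD(1)[OF tu(2)] by (auto simp: ind_module_simps)
  qed
  show "abelian_group ?T"
  proof (rule abelian_groupI)
    fix t assume t: "t \<in> carrier ?T"
    note D = ind_moduleD[OF t]
    let ?n = "\<lambda>i\<in>I. \<ominus>\<^bsub>M\<^esub> t i"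
    have "mat_act M \<one>\<^bsub>S\<^esub> ?n = ?n"
    proof (rule extensionalityI)
      fix i assume i: "i \<in> I"
      have n: "?n \<in> I \<rightarrow> carrier M" using D by auto
      \<comment> \<open>The matrix of the unit kills \<open>?n\<close> plus \<open>t\<close> and
        fixes \<open>t\<close>, so it must send \<open>?n\<close> to the negative of
        \<open>t\<close>, that is, to \<open>?n\<close>.\<close>
      have "mat_act M \<one>\<^bsub>S\<^esub> (\<lambda>i\<in>I. ?n i \<oplus>\<^bsub>M\<^esub> t i) = mat_act M \<one>\<^bsub>S\<^esub> (\<lambda>i\<in>I. \<zero>\<^bsub>M\<^esub>)"
        using D by (intro arg_cong[where f = "mat_act M \<one>\<^bsub>S\<^esub>"]) (auto simp: M.M.l_neg intro!: restrict_ext)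
      then have "mat_act M \<one>\<^bsub>S\<^esub> ?n i \<oplus>\<^bsub>M\<^esub> t i = \<zero>\<^bsub>M\<^esub>"
        using i n D mat_act_add[OF S.one_closed n, of t] fun_cong[OF z[of "\<one>\<^bsub>S\<^esub>"], of i]
        by (auto dest!: fun_cong[where x = i])
      then show "mat_act M \<one>\<^bsub>S\<^esub> ?n i = ?n i"
        using i mat_act_closed[OF S.one_closed n] D(1)[OF i] by (auto intro!: M.M.minus_equality[symmetric])
    qed (auto simp: mat_act_def)
    then have "?n \<in> carrier ?T" using D by (auto simp: ind_module_simps)
    moreover have "?n \<oplus>\<^bsub>?T\<^esub> t = \<zero>\<^bsub>?T\<^esub>" using D by (auto simp: ind_module_simps M.M.l_neg intro!: restrict_ext)
    ultimately show "\<exists>u\<in>carrier ?T. u \<oplus>\<^bsub>?T\<^esub> t = \<zero>\<^bsub>?T\<^esub>" by blast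
    show "\<zero>\<^bsub>?T\<^esub> \<oplus>\<^bsub>?T\<^esub> t = t"
      using D by (auto simp: ind_module_simps PiE_iff intro!: extensionalityI[of _ I])
  next
    show "\<zero>\<^bsub>?T\<^esub> \<in> carrier ?T" by (simp add: ind_module_simps z)
    show "t \<oplus>\<^bsub>?T\<^esub> u \<in> carrier ?T" if "t \<in> carrier ?T" "u \<in> carrier ?T" for t u
      using add[OF that] by (simp add: ind_module_simps)
    show "t \<oplus>\<^bsub>?T\<^esub> u \<oplus>\<^bsub>?T\<^esub> v = t \<oplus>\<^bsub>?T\<^esub> (u \<oplus>\<^bsub>?T\<^esub> v)"
      if "t \<in> carrier ?T" "u \<in> carrier ?T" "v \<in> carrier ?T" for t u v
      using that[THEN ind_moduleD(1)] by (auto simp: ind_module_simps M.M.a_assoc intro!: restrict_ext)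
    show "t \<oplus>\<^bsub>?T\<^esub> u = u \<oplus>\<^bsub>?T\<^esub> t" if "t \<in> carrier ?T" "u \<in> carrier ?T" for t u
      using that[THEN ind_moduleD(1)] by (auto simp: ind_module_simps M.M.a_comm intro!: restrict_ext)
  qed
  show "s \<odot>\<^bsub>?T\<^esub> t \<in> carrier ?T" if "s \<in> carrier S" "t \<in> carrier ?T" for s t
    using mat_act_mem[OF that(1) mem(2)[OF that(2)]] by (simp add: ind_module_simps)
  show "\<one>\<^bsub>S\<^esub> \<odot>\<^bsub>?T\<^esub> t = t" if "t \<in> carrier ?T" for t using that by (simp add: ind_module_simps)
qed (auto simp: ind_module_simps mat_act_add mat_act_add_left mat_act_mult PiE_def)

text \<open>In terms of \<open>P \<otimes> M\<close> the basis elements are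
  \<open>p_j \<otimes> x_d\<close>, and the functionals send \<open>p \<otimes> m\<close> to
  \<open>[p f_d(m), q_j]\<close>; the formula in the statement arises by writing \<open>t\<close> as
  the sum of all \<open>p_k \<otimes> t_k\<close>. Reconstruction works because
  \<open>[p f_d(m), q_j] p_j = p f_d(m) (q_j, p_j)\<close>, where the last factors add up to 1 over
  \<open>J\<close>.\<close>

lemma ind_dual_basis:
  assumes "dual_basis R M D x f"
  shows "dual_basis S (ind_module M) (D \<times> J) (\<lambda>(d, j). \<lambda>i\<in>I. phi i j \<one>\<^bsub>S\<^esub> \<odot>\<^bsub>M\<^esub> x d)
    (\<lambda>(d, j). \<lambda>t\<in>carrier (ind_module M). \<Oplus>\<^bsub>S\<^esub>k\<in>I. theta k j (f d (t k)))"
proof -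
  let ?T = "ind_module M"
  define Y where "Y d j = (\<lambda>i\<in>I. phi i j \<one>\<^bsub>S\<^esub> \<odot>\<^bsub>M\<^esub> x d)" for d j
  define G where "G d j t = (\<Oplus>\<^bsub>S\<^esub>k\<in>I. theta k j (f d (t k)))" for d j t
  note D = dual_basisD[OF assms]
  note f = mod_homD[OF D(3)]
  interpret T: left_module S ?T by (rule left_module_ind)
  note t = ind_moduleD
  have Gc: "G d j t \<in> carrier S" if "d \<in> D" "t \<in> I \<rightarrow> carrier M" for d j t
    using that D(4) by (auto simp: G_def Pi_iff intro!: S.finsum_closed)
  have Yc: "Y d j \<in> carrier ?T" if "d \<in> D" for d j
  proof -
    have "mat_act M \<one>\<^bsub>S\<^esub> (Y d j) = Y d j"
    proof (rule extensionalityI)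
      fix i assume i: "i \<in> I"
      have "(\<Oplus>\<^bsub>M\<^esub>k\<in>I. phi i k \<one>\<^bsub>S\<^esub> \<odot>\<^bsub>M\<^esub> Y d j k) = (\<Oplus>\<^bsub>M\<^esub>k\<in>I. (phi i k \<one>\<^bsub>S\<^esub> \<otimes>\<^bsub>R\<^esub> phi k j \<one>\<^bsub>S\<^esub>) \<odot>\<^bsub>M\<^esub> x d)"
        using D(2)[OF that] by (intro M.M.finsum_cong') (auto simp: Y_def M.lsmult_assoc)
      also have "\<dots> = phi i j \<one>\<^bsub>S\<^esub> \<odot>\<^bsub>M\<^esub> x d"
        using D(2)[OF that] by (simp add: M.finsum_lsmult[symmetric] phi_mult)
      finally show "mat_act M \<one>\<^bsub>S\<^esub> (Y d j) i = Y d j i" using i by (simp add: Y_def mat_act_apply)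
    qed (auto simp: mat_act_def Y_def)
    then show ?thesis using D(2)[OF that] by (auto simp: Y_def ind_module_simps)
  qed
  have Gh: "(\<lambda>t\<in>carrier ?T. G d j t) \<in> mod_hom S ?T (reg S)" if d: "d \<in> D" for d j
  proof (rule mod_homI[OF _ _ _ left_module_ind])
    show "G d j t \<in> carrier (reg S)" if "t \<in> carrier ?T" for t using Gc d t[OF that] by auto
    show "G d j (t \<oplus>\<^bsub>?T\<^esub> u) = G d j t \<oplus>\<^bsub>reg S\<^esub> G d j u" if tu: "t \<in> carrier ?T" "u \<in> carrier ?T" for t u
    proof -
      note c = t(1)[OF tu(1)] t(1)[OF tu(2)]
      have "G d j (t \<oplus>\<^bsub>?T\<^esub> u) = (\<Oplus>\<^bsub>S\<^esub>k\<in>I. theta k j (f d (t k)) \<oplus>\<^bsub>S\<^esub> theta k j (f d (u k)))"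
        unfolding G_def using c D(4)[OF d]
        by (intro S.finsum_cong') (auto simp: ind_module_simps f(2)[OF d] theta_add)
      also have "\<dots> = G d j t \<oplus>\<^bsub>S\<^esub> G d j u"
        unfolding G_def using c D(4)[OF d] by (intro S.finsum_addf) auto
      finally show ?thesis by simp
    qed
    show "G d j (s \<odot>\<^bsub>?T\<^esub> t) = s \<odot>\<^bsub>reg S\<^esub> G d j t" if s: "s \<in> carrier S" and tT: "t \<in> carrier ?T" for s t
    proof -
      note c = t(1)[OF tT]
      \<comment> \<open>By \<open>theta_phi_mult\<close> the dependence on \<open>k\<close> is
        confined to a factor \<open>theta k k\<close> of the unit. The sum over \<open>k\<close>
        therefore splits off and is 1 by \<open>theta_one\<close>.\<close>
      have "G d j (s \<odot>\<^bsub>?T\<^esub> t) = (\<Oplus>\<^bsub>S\<^esub>k\<in>I. \<Oplus>\<^bsub>S\<^esub>l\<in>I. theta k k \<one>\<^bsub>R\<^esub> \<otimes>\<^bsub>S\<^esub> (s \<otimes>\<^bsub>S\<^esub> theta l j (f d (t l))))"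
        unfolding G_def
      proof (rule S.finsum_cong')
        fix k assume k: "k \<in> I"
        have "f d ((s \<odot>\<^bsub>?T\<^esub> t) k) = f d (\<Oplus>\<^bsub>M\<^esub>l\<in>I. phi k l s \<odot>\<^bsub>M\<^esub> t l)"
          using k by (simp add: ind_module_simps mat_act_apply)
        also have "\<dots> = (\<Oplus>\<^bsub>reg R\<^esub>l\<in>I. f d (phi k l s \<odot>\<^bsub>M\<^esub> t l))"
          using s c by (intro mod_hom_sum[OF D(3)[OF d] M left_module_reg[OF R.ring_axioms]]) auto
        also have "\<dots> = (\<Oplus>\<^bsub>R\<^esub>l\<in>I. phi k l s \<otimes>\<^bsub>R\<^esub> f d (t l))"
          unfolding finsum_reg using s c D(4)[OF d] by (intro R.finsum_cong') (auto simp: f(3)[OF d])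
        finally have "theta k j (f d ((s \<odot>\<^bsub>?T\<^esub> t) k)) = theta k j (\<Oplus>\<^bsub>R\<^esub>l\<in>I. phi k l s \<otimes>\<^bsub>R\<^esub> f d (t l))"
          by simp
        also have "\<dots> = (\<Oplus>\<^bsub>S\<^esub>l\<in>I. theta k j (phi k l s \<otimes>\<^bsub>R\<^esub> f d (t l)))"
          using s c D(4)[OF d]
          by (intro additive_finsum[where h = "theta k j"] R.abelian_group_axioms S.abelian_group_axioms)
            (auto simp: theta_add)
        also have "\<dots> = (\<Oplus>\<^bsub>S\<^esub>l\<in>I. theta k k \<one>\<^bsub>R\<^esub> \<otimes>\<^bsub>S\<^esub> (s \<otimes>\<^bsub>S\<^esub> theta l j (f d (t l))))"
          using s c D(4)[OF d] by (intro S.finsum_cong') (auto simp: theta_phi_mult S.m_assoc)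
        finally show "theta k j (f d ((s \<odot>\<^bsub>?T\<^esub> t) k)) = (\<Oplus>\<^bsub>S\<^esub>l\<in>I. theta k k \<one>\<^bsub>R\<^esub> \<otimes>\<^bsub>S\<^esub> (s \<otimes>\<^bsub>S\<^esub> theta l j (f d (t l))))" .
      qed (use s c D(4)[OF d] in \<open>auto intro!: S.finsum_closed\<close>)
      also have "\<dots> = (\<Oplus>\<^bsub>S\<^esub>k\<in>I. theta k k \<one>\<^bsub>R\<^esub> \<otimes>\<^bsub>S\<^esub> (s \<otimes>\<^bsub>S\<^esub> G d j t))"
        unfolding G_def using s c D(4)[OF d] finite(1)
        by (intro S.finsum_cong') (auto simp: S.finsum_rdistr Pi_iff intro!: S.finsum_closed S.finsum_cong')
      also have "\<dots> = (\<Oplus>\<^bsub>S\<^esub>k\<in>I. theta k k \<one>\<^bsub>R\<^esub>) \<otimes>\<^bsub>S\<^esub> (s \<otimes>\<^bsub>S\<^esub> G d j t)"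
        using s c Gc[OF d, of t] finite(1) by (intro S.finsum_ldistr[symmetric]) auto
      finally show ?thesis using s c Gc[OF d, of t] by (simp add: theta_one)
    qed
  qed
  have main: "(\<Oplus>\<^bsub>?T\<^esub>p\<in>D \<times> J. G (fst p) (snd p) t \<odot>\<^bsub>?T\<^esub> Y (fst p) (snd p)) = t" if tT: "t \<in> carrier ?T" for t
  proof (rule extensionalityI)
    note c = t(1)[OF tT]
    have cl: "G d j t \<odot>\<^bsub>?T\<^esub> Y d j \<in> carrier ?T" if "d \<in> D" for d j
      using that c Gc Yc by (intro T.lsmult_closed) auto
    have sc: "(\<Oplus>\<^bsub>?T\<^esub>p\<in>D \<times> J. G (fst p) (snd p) t \<odot>\<^bsub>?T\<^esub> Y (fst p) (snd p)) \<in> carrier ?T"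
      using cl by (intro T.M.finsum_closed) auto
    then show "(\<Oplus>\<^bsub>?T\<^esub>p\<in>D \<times> J. G (fst p) (snd p) t \<odot>\<^bsub>?T\<^esub> Y (fst p) (snd p)) \<in> extensional I" using t(2) by (auto simp: PiE_def)
    show "t \<in> extensional I" using t(2)[OF tT] by (auto simp: PiE_def)
    fix i assume i: "i \<in> I"
    have ev: "(\<Oplus>\<^bsub>?T\<^esub>p\<in>A. u p) i = (\<Oplus>\<^bsub>M\<^esub>p\<in>A. u p i)" if "\<And>p. p \<in> A \<Longrightarrow> u p \<in> carrier ?T" for A and u :: "'d \<times> 'i \<Rightarrow> _"
      using that i t(1)
      by (intro additive_finsum[where h = "\<lambda>t. t i"] T.M.abelian_group_axioms M.M.abelian_group_axioms)
        (auto simp: ind_module_simps(3))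
    have e1: "(G d j t \<odot>\<^bsub>?T\<^esub> Y d j) i = phi i j (G d j t) \<odot>\<^bsub>M\<^esub> x d" if d: "d \<in> D" for d j
    proof -
      have g: "G d j t \<in> carrier S" using Gc d c by auto
      have "(G d j t \<odot>\<^bsub>?T\<^esub> Y d j) i = (\<Oplus>\<^bsub>M\<^esub>k\<in>I. phi i k (G d j t) \<odot>\<^bsub>M\<^esub> Y d j k)"
        using i by (simp add: ind_module_simps mat_act_apply)
      also have "\<dots> = (\<Oplus>\<^bsub>M\<^esub>k\<in>I. (phi i k (G d j t) \<otimes>\<^bsub>R\<^esub> phi k j \<one>\<^bsub>S\<^esub>) \<odot>\<^bsub>M\<^esub> x d)"
        using D(2)[OF d] g by (intro M.M.finsum_cong') (auto simp: Y_def M.lsmult_assoc)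
      also have "\<dots> = phi i j (G d j t) \<odot>\<^bsub>M\<^esub> x d"
        using D(2)[OF d] g by (simp add: M.finsum_lsmult[symmetric] phi_mult)
      finally show ?thesis .
    qed
    have e2: "phi i j (G d j t) = (\<Oplus>\<^bsub>R\<^esub>k\<in>I. (phi i k \<one>\<^bsub>S\<^esub> \<otimes>\<^bsub>R\<^esub> f d (t k)) \<otimes>\<^bsub>R\<^esub> phi j j \<one>\<^bsub>S\<^esub>)" if d: "d \<in> D" for d j
    proof -
      have "phi i j (G d j t) = (\<Oplus>\<^bsub>R\<^esub>k\<in>I. phi i j (theta k j (f d (t k))))"
        unfolding G_def using c D(4)[OF d]
        by (intro additive_finsum S.abelian_group_axioms R.abelian_group_axioms phi_closed phi_add) auto
      then show ?thesis using c D(4)[OF d] by (simp add: phi_theta cong: R.finsum_cong)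
    qed
    \<comment> \<open>In \<open>e2\<close> the index \<open>j\<close> survives only in the right
      factor \<open>phi j j\<close> of the unit, so summing over \<open>J\<close> removes it by
      \<open>phi_one\<close>.\<close>
    have e3: "(\<Oplus>\<^bsub>R\<^esub>j\<in>J. phi i j (G d j t)) = (\<Oplus>\<^bsub>R\<^esub>k\<in>I. phi i k \<one>\<^bsub>S\<^esub> \<otimes>\<^bsub>R\<^esub> f d (t k))" if d: "d \<in> D" for d
    proof -
      define a where "a = (\<Oplus>\<^bsub>R\<^esub>k\<in>I. phi i k \<one>\<^bsub>S\<^esub> \<otimes>\<^bsub>R\<^esub> f d (t k))"
      have a: "a \<in> carrier R" unfolding a_def using c D(4)[OF d] by (intro R.finsum_closed) auto
      have "(\<Oplus>\<^bsub>R\<^esub>j\<in>J. phi i j (G d j t)) = (\<Oplus>\<^bsub>R\<^esub>j\<in>J. a \<otimes>\<^bsub>R\<^esub> phi j j \<one>\<^bsub>S\<^esub>)"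
        unfolding a_def using c D(4)[OF d] finite(1)
        by (intro R.finsum_cong') (auto simp: e2[OF d] R.finsum_ldistr Pi_iff intro!: R.finsum_closed)
      also have "\<dots> = a" using a finite(2) by (simp add: R.finsum_rdistr[symmetric] phi_one)
      finally show ?thesis unfolding a_def .
    qed
    have "(\<Oplus>\<^bsub>?T\<^esub>p\<in>D \<times> J. G (fst p) (snd p) t \<odot>\<^bsub>?T\<^esub> Y (fst p) (snd p)) i = (\<Oplus>\<^bsub>M\<^esub>p\<in>D \<times> J. (G (fst p) (snd p) t \<odot>\<^bsub>?T\<^esub> Y (fst p) (snd p)) i)"
      using cl by (intro ev) auto
    also have "\<dots> = (\<Oplus>\<^bsub>M\<^esub>p\<in>D \<times> J. phi i (snd p) (G (fst p) (snd p) t) \<odot>\<^bsub>M\<^esub> x (fst p))"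
      using D(2) Gc c e1 by (intro M.M.finsum_cong') auto
    also have "\<dots> = (\<Oplus>\<^bsub>M\<^esub>d\<in>D. \<Oplus>\<^bsub>M\<^esub>j\<in>J. phi i j (G d j t) \<odot>\<^bsub>M\<^esub> x d)"
      using D(1,2) Gc c by (subst M.M.finsum_Sigma[OF _ finite(2)]) auto
    also have "\<dots> = (\<Oplus>\<^bsub>M\<^esub>d\<in>D. \<Oplus>\<^bsub>M\<^esub>k\<in>I. phi i k \<one>\<^bsub>S\<^esub> \<odot>\<^bsub>M\<^esub> (f d (t k) \<odot>\<^bsub>M\<^esub> x d))"
    proof (rule M.M.finsum_cong')
      fix d assume d: "d \<in> D"
      have "(\<Oplus>\<^bsub>M\<^esub>j\<in>J. phi i j (G d j t) \<odot>\<^bsub>M\<^esub> x d) = (\<Oplus>\<^bsub>R\<^esub>j\<in>J. phi i j (G d j t)) \<odot>\<^bsub>M\<^esub> x d"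
        using D(2)[OF d] Gc[OF d] c by (intro M.finsum_lsmult[symmetric]) auto
      also have "\<dots> = (\<Oplus>\<^bsub>M\<^esub>k\<in>I. (phi i k \<one>\<^bsub>S\<^esub> \<otimes>\<^bsub>R\<^esub> f d (t k)) \<odot>\<^bsub>M\<^esub> x d)"
        unfolding e3[OF d] using D(2,4)[OF d] c by (intro M.finsum_lsmult) auto
      also have "\<dots> = (\<Oplus>\<^bsub>M\<^esub>k\<in>I. phi i k \<one>\<^bsub>S\<^esub> \<odot>\<^bsub>M\<^esub> (f d (t k) \<odot>\<^bsub>M\<^esub> x d))"
        using D(2,4)[OF d] c by (intro M.M.finsum_cong') (auto simp: M.lsmult_assoc)
      finally show "(\<Oplus>\<^bsub>M\<^esub>j\<in>J. phi i j (G d j t) \<odot>\<^bsub>M\<^esub> x d) = (\<Oplus>\<^bsub>M\<^esub>k\<in>I. phi i k \<one>\<^bsub>S\<^esub> \<odot>\<^bsub>M\<^esub> (f d (t k) \<odot>\<^bsub>M\<^esub> x d))" .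
    qed (use D(2,4) c in \<open>auto intro!: M.M.finsum_closed\<close>)
    also have "\<dots> = (\<Oplus>\<^bsub>M\<^esub>k\<in>I. \<Oplus>\<^bsub>M\<^esub>d\<in>D. phi i k \<one>\<^bsub>S\<^esub> \<odot>\<^bsub>M\<^esub> (f d (t k) \<odot>\<^bsub>M\<^esub> x d))"
      using D(2,4) c by (intro M.M.finsum_swap D(1) finite(1)) auto
    also have "\<dots> = (\<Oplus>\<^bsub>M\<^esub>k\<in>I. phi i k \<one>\<^bsub>S\<^esub> \<odot>\<^bsub>M\<^esub> t k)"
    proof (rule M.M.finsum_cong')
      fix k assume k: "k \<in> I"
      show "(\<Oplus>\<^bsub>M\<^esub>d\<in>D. phi i k \<one>\<^bsub>S\<^esub> \<odot>\<^bsub>M\<^esub> (f d (t k) \<odot>\<^bsub>M\<^esub> x d)) = phi i k \<one>\<^bsub>S\<^esub> \<odot>\<^bsub>M\<^esub> t k"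
        using D(2,4) c[OF k] by (subst M.lsmult_finsum[symmetric]) (auto simp: D(5))
    qed (use c in auto)
    also have "\<dots> = t i" using t(4)[OF tT i] .
    finally show "(\<Oplus>\<^bsub>?T\<^esub>p\<in>D \<times> J. G (fst p) (snd p) t \<odot>\<^bsub>?T\<^esub> Y (fst p) (snd p)) i = t i" .
  qed
  have "dual_basis S ?T (D \<times> J) (\<lambda>p. Y (fst p) (snd p)) (\<lambda>p. \<lambda>t\<in>carrier ?T. G (fst p) (snd p) t)"
    unfolding dual_basis_def using D(1) finite(2) Yc Gh main by auto
  then show ?thesis unfolding G_def Y_def by (simp add: case_prod_unfold)
qed

end

section \<open>Functoriality and exactness\<close>

definition ind_hom :: "('r, 'm, 'z) module_scheme \<Rightarrow> ('m \<Rightarrow> 'n) \<Rightarrow> ('i \<Rightarrow> 'm) \<Rightarrow> 'i \<Rightarrow> 'n"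
  where "ind_hom M f = (\<lambda>t\<in>carrier (ind_module M). \<lambda>i\<in>I. f (t i))"

lemma mat_act_hom:
  assumes M: "left_module R M" and N: "left_module R N" and f: "f \<in> mod_hom R M N"
    and s: "s \<in> carrier S" and t: "t \<in> I \<rightarrow> carrier M"
  shows "mat_act N s (\<lambda>i\<in>I. f (t i)) = (\<lambda>i\<in>I. f (mat_act M s t i))"
proof -
  interpret M: left_module R M by fact
  interpret N: left_module R N by fact
  have "(\<Oplus>\<^bsub>N\<^esub>k\<in>I. phi i k s \<odot>\<^bsub>N\<^esub> (\<lambda>i\<in>I. f (t i)) k) = f (\<Oplus>\<^bsub>M\<^esub>k\<in>I. phi i k s \<odot>\<^bsub>M\<^esub> t k)" for i
    using s t mod_homD[OF f]
    by (subst mod_hom_sum[OF f M N]) (auto simp: Pi_iff intro!: N.M.finsum_cong')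
  then show ?thesis by (auto simp: mat_act_def intro!: restrict_ext)
qed

lemma ind_hom:
  assumes M: "left_module R M" and N: "left_module R N" and f: "f \<in> mod_hom R M N"
  shows "ind_hom M f \<in> mod_hom S (ind_module M) (ind_module N)"
  unfolding ind_hom_def
proof (rule mod_homI[OF _ _ _ left_module_ind[OF M]])
  note t = ind_moduleD
  interpret M: left_module R M by fact
  fix x assume x: "x \<in> carrier (ind_module M)"
  have xc: "x \<in> I \<rightarrow> carrier M" using t(1)[OF x] by auto
  show "(\<lambda>i\<in>I. f (x i)) \<in> carrier (ind_module N)"
    using t(1)[OF x] t(3)[OF x] mod_homD(1)[OF f] mat_act_hom[OF M N f S.one_closed xc]
    by (auto simp: ind_module_simps)
  show "(\<lambda>i\<in>I. f ((s \<odot>\<^bsub>ind_module M\<^esub> x) i)) = s \<odot>\<^bsub>ind_module N\<^esub> (\<lambda>i\<in>I. f (x i))" if "s \<in> carrier S" for s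
    using mat_act_hom[OF M N f that xc] by (simp add: ind_module_simps)
  fix y assume y: "y \<in> carrier (ind_module M)"
  show "(\<lambda>i\<in>I. f ((x \<oplus>\<^bsub>ind_module M\<^esub> y) i)) = (\<lambda>i\<in>I. f (x i)) \<oplus>\<^bsub>ind_module N\<^esub> (\<lambda>i\<in>I. f (y i))"
    using t(1)[OF x] t(1)[OF y] mod_homD(2)[OF f] by (auto simp: ind_module_simps(3) intro!: restrict_ext)
qed

text \<open>The source of exactness: the construction is a natural retract of taking families.
  Preimages are chosen entry by entry, giving a family that need not be fixed; applying the matrix
  of the unit makes it fixed, and by \<open>mat_act_hom\<close> its image is still \<open>u\<close>,
  because \<open>u\<close> is fixed already.\<close>

lemma ind_hom_image:
  assumes M: "left_module R M" and N: "left_module R N" and f: "f \<in> mod_hom R M N"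
  shows "ind_hom M f ` carrier (ind_module M) = {u \<in> carrier (ind_module N). \<forall>i\<in>I. u i \<in> f ` carrier M}"
proof (intro equalityI subsetI)
  fix u assume "u \<in> ind_hom M f ` carrier (ind_module M)"
  then show "u \<in> {u \<in> carrier (ind_module N). \<forall>i\<in>I. u i \<in> f ` carrier M}"
    using mod_homD(1)[OF ind_hom[OF M N f]] ind_moduleD(1) by (auto simp: ind_hom_def intro!: imageI)
next
  fix u assume u: "u \<in> {u \<in> carrier (ind_module N). \<forall>i\<in>I. u i \<in> f ` carrier M}"
  then have "\<forall>i\<in>I. \<exists>x\<in>carrier M. f x = u i" by (simp add: image_iff) metis
  then obtain t where t: "\<And>i. i \<in> I \<Longrightarrow> t i \<in> carrier M" "\<And>i. i \<in> I \<Longrightarrow> f (t i) = u i" by metis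
  have tc: "t \<in> I \<rightarrow> carrier M" using t by auto
  let ?t = "mat_act M \<one>\<^bsub>S\<^esub> t"
  have mem: "?t \<in> carrier (ind_module M)" using mat_act_mem[OF M _ tc] by simp
  have "(\<lambda>i\<in>I. f (t i)) = u"
    using t u ind_moduleD(2)[of u N] by (intro extensionalityI[of _ I]) (auto simp: PiE_def)
  then have "ind_hom M f ?t = u"
    using mem mat_act_hom[OF M N f S.one_closed tc] u by (simp add: ind_hom_def ind_module_simps)
  then show "u \<in> ind_hom M f ` carrier (ind_module M)" using mem by blast
qed

lemma ind_hom_surj:
  assumes "left_module R M" "left_module R N" "f \<in> mod_hom R M N" "f ` carrier M = carrier N"
  shows "ind_hom M f ` carrier (ind_module M) = carrier (ind_module N)"
  unfolding ind_hom_image[OF assms(1-3)] assms(4) using ind_moduleD(1) by auto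

lemma ind_hom_exact:
  assumes L: "left_module R L" and M: "left_module R M" and f: "f \<in> mod_hom R L M"
    and ex: "f ` carrier L = {x \<in> carrier M. g x = \<zero>\<^bsub>N\<^esub>}"
  shows "ind_hom L f ` carrier (ind_module L) = {t \<in> carrier (ind_module M). ind_hom M g t = \<zero>\<^bsub>ind_module N\<^esub>}"
  unfolding ind_hom_image[OF L M f] ex
  by (auto simp: ind_hom_def ind_module_simps(2) ind_moduleD(1) restrict_def fun_eq_iff)

text \<open>The image of the resolution is augmented to \<open>ind_module M\<close>; the isomorphism
  \<open>h\<close> redirects the augmentation to \<open>N\<close> without changing its
  kernel.\<close>

lemma has_finite_fgproj_resolution_ind:
  assumes M: "left_module R M" and res: "has_finite_fgproj_resolution R M"
    and N: "left_module S N" and h: "h \<in> mod_hom S (ind_module M) N" "inj_on h (carrier (ind_module M))"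
      "h ` carrier (ind_module M) = carrier N"
  shows "has_finite_fgproj_resolution S N"
proof -
  obtain P :: "nat \<Rightarrow> ('r, nat \<Rightarrow> 'r) module" and d e where
    P': "\<forall>i. fin_gen_module R (P i) \<and> projective_module R (P i)"
    and d': "\<forall>i. d i \<in> mod_hom R (P (Suc i)) (P i)"
    and e: "e \<in> mod_hom R (P 0) M" "e ` carrier (P 0) = carrier M"
    and ex0: "d 0 ` carrier (P (Suc 0)) = {x \<in> carrier (P 0). e x = \<zero>\<^bsub>M\<^esub>}"
    and ex': "\<forall>i. d (Suc i) ` carrier (P (Suc (Suc i))) = {x \<in> carrier (P (Suc i)). d i x = \<zero>\<^bsub>P i\<^esub>}"
    and fin': "\<exists>n. \<forall>i>n. carrier (P i) = {\<zero>\<^bsub>P i\<^esub>}"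
    using res unfolding has_finite_fgproj_resolution_def by (elim exE conjE) (rule that; (assumption | rule exI, assumption))
  note P = P'[rule_format, THEN conjunct1] P'[rule_format, THEN conjunct2]
    and d = d'[rule_format] and ex = ex'[rule_format]
  obtain n where fin: "\<And>i. i > n \<Longrightarrow> carrier (P i) = {\<zero>\<^bsub>P i\<^esub>}" using fin' by blast
  have lP: "left_module R (P i)" for i using P(2) by (simp add: projective_module_def)
  obtain D f where D: "\<And>i. dual_basis R (P i) (D i) (\<lambda>x. x) (f i)"
  proof -
    have "\<forall>i. \<exists>p. dual_basis R (P i) (fst p) (\<lambda>x. x) (snd p)"
      using dual_basis_if_fin_gen_projective[OF P] by simp
    then obtain q where "\<And>i. dual_basis R (P i) (fst (q i)) (\<lambda>x. x) (snd (q i))" by metis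
    then show thesis by (rule that)
  qed
  let ?T = "\<lambda>i. ind_module (P i)"
  have eh: "ind_hom (P 0) e \<in> mod_hom S (?T 0) (ind_module M)" by (rule ind_hom[OF lP M e(1)])
  have h0: "h t = \<zero>\<^bsub>N\<^esub> \<longleftrightarrow> t = \<zero>\<^bsub>ind_module M\<^esub>" if "t \<in> carrier (ind_module M)" for t
  proof -
    interpret T: left_module S "ind_module M" by (rule left_module_ind[OF M])
    show ?thesis using mod_hom_zero[OF h(1) left_module_ind[OF M] N] inj_onD[OF h(2) _ that T.M.zero_closed] by auto
  qed
  show ?thesis
  proof (rule has_finite_fgproj_resolutionI[where P = ?T and d = "\<lambda>i. ind_hom (P (Suc i)) (d i)"
        and e = "compose (carrier (?T 0)) h (ind_hom (P 0) e)" and n = n])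
    fix i
    show "left_module S (?T i)" by (rule left_module_ind[OF lP])
    show "dual_basis S (?T i) (D i \<times> J) (\<lambda>(d, j). \<lambda>k\<in>I. phi k j \<one>\<^bsub>S\<^esub> \<odot>\<^bsub>P i\<^esub> d)
      (\<lambda>(d, j). \<lambda>t\<in>carrier (?T i). \<Oplus>\<^bsub>S\<^esub>k\<in>I. theta k j (f i d (t k)))"
      by (rule ind_dual_basis[OF lP D])
    show "ind_hom (P (Suc i)) (d i) \<in> mod_hom S (?T (Suc i)) (?T i)" by (rule ind_hom[OF lP lP d])
    show "compose (carrier (?T 0)) h (ind_hom (P 0) e) \<in> mod_hom S (?T 0) N"
      by (rule mod_hom_comp[OF eh h(1) left_module_ind[OF lP]])
    have "compose (carrier (?T 0)) h (ind_hom (P 0) e) ` carrier (?T 0) = h ` ind_hom (P 0) e ` carrier (?T 0)"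
      by (auto simp: compose_def)
    then show "compose (carrier (?T 0)) h (ind_hom (P 0) e) ` carrier (?T 0) = carrier N"
      by (simp add: ind_hom_surj[OF lP M e] h(3))
    show "ind_hom (P (Suc 0)) (d 0) ` carrier (?T (Suc 0)) =
        {x \<in> carrier (?T 0). compose (carrier (?T 0)) h (ind_hom (P 0) e) x = \<zero>\<^bsub>N\<^esub>}"
      unfolding ind_hom_exact[OF lP lP d ex0] using h0 mod_homD(1)[OF eh] by (auto simp: compose_def)
    show "ind_hom (P (Suc (Suc i))) (d (Suc i)) ` carrier (?T (Suc (Suc i))) =
        {x \<in> carrier (?T (Suc i)). ind_hom (P (Suc i)) (d i) x = \<zero>\<^bsub>?T i\<^esub>}"
      by (rule ind_hom_exact[OF lP lP d ex])
    show "carrier (?T i) = {\<zero>\<^bsub>?T i\<^esub>}" if "i > n"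
    proof -
      interpret T: left_module S "?T i" by (rule left_module_ind[OF lP])
      have "t = \<zero>\<^bsub>?T i\<^esub>" if "t \<in> carrier (?T i)" for t
        using ind_moduleD[OF that] fin[OF \<open>i > n\<close>]
        by (intro extensionalityI[of _ I]) (auto simp: ind_module_simps(2) PiE_def)
      then show ?thesis using T.M.zero_closed by blast
    qed
  qed
qed

end

section \<open>Pure tensors in the enveloping algebra\<close>

context enveloping_setup
begin

definition pure :: "'a \<Rightarrow> 'a \<Rightarrow> ('a \<times> 'a \<Rightarrow> 'k) set"
  where "pure a b = I +>\<^bsub>Q.F\<^esub> single K \<one>\<^bsub>K\<^esub> (a, b)"

sublocale Ae: ring Ae by (rule ring_enveloping_algebra)

lemma single_FS: "c \<in> carrier K \<Longrightarrow> a \<in> carrier A \<Longrightarrow> b \<in> carrier A \<Longrightarrow> single K c (a, b) \<in> Q.FS"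
  by (rule Q.fs(4)) auto

lemma coset_closed: "f \<in> Q.FS \<Longrightarrow> I +>\<^bsub>Q.F\<^esub> f \<in> carrier Ae"
  by (auto simp: Ae_carrier)

lemma pure_closed [simp]: "a \<in> carrier A \<Longrightarrow> b \<in> carrier A \<Longrightarrow> pure a b \<in> carrier Ae"
  unfolding pure_def by (intro coset_closed single_FS) auto

lemma coset_eqI: "f \<in> Q.FS \<Longrightarrow> g \<in> Q.FS \<Longrightarrow> f \<ominus>\<^bsub>Q.F\<^esub> g \<in> T \<Longrightarrow> I +>\<^bsub>Q.F\<^esub> f = I +>\<^bsub>Q.F\<^esub> g"
  using Q.F.quotient_eq_iff_same_a_r_cos[OF ideal_I, of f g] Q.F.genideal_self[of T] T_carrier by auto

lemma relations_mem:
  assumes "a \<in> carrier A" "a' \<in> carrier A" "b \<in> carrier A" "b' \<in> carrier A" "c \<in> carrier K"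
  shows "single K \<one>\<^bsub>K\<^esub> (a \<oplus>\<^bsub>A\<^esub> a', b) \<ominus>\<^bsub>Q.F\<^esub> (single K \<one>\<^bsub>K\<^esub> (a, b) \<oplus>\<^bsub>Q.F\<^esub> single K \<one>\<^bsub>K\<^esub> (a', b)) \<in> T"
    and "single K \<one>\<^bsub>K\<^esub> (a, b \<oplus>\<^bsub>opposite A\<^esub> b') \<ominus>\<^bsub>Q.F\<^esub> (single K \<one>\<^bsub>K\<^esub> (a, b) \<oplus>\<^bsub>Q.F\<^esub> single K \<one>\<^bsub>K\<^esub> (a, b')) \<in> T"
    and "single K \<one>\<^bsub>K\<^esub> (c \<odot>\<^bsub>A\<^esub> a, b) \<ominus>\<^bsub>Q.F\<^esub> single K c (a, b) \<in> T"
    and "single K \<one>\<^bsub>K\<^esub> (a, c \<odot>\<^bsub>opposite A\<^esub> b) \<ominus>\<^bsub>Q.F\<^esub> single K c (a, b) \<in> T"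
  unfolding tensor_relations_def Let_def
  by ((rule UnI1, rule UnI1, rule UnI1, rule CollectI, intro exI conjI, rule refl; simp only: assms opposite_simps),
      (rule UnI1, rule UnI1, rule UnI2, rule CollectI, intro exI conjI, rule refl; simp only: assms opposite_simps),
      (rule UnI1, rule UnI2, rule CollectI, intro exI conjI, rule refl; simp only: assms opposite_simps),
      (rule UnI2, rule CollectI, intro exI conjI, rule refl; simp only: assms opposite_simps))

text \<open>Scalars are absorbed into either factor, so the class of every weighted symbol is itself
  a pure tensor.\<close>

lemma coset_single:
  assumes "c \<in> carrier K" "a \<in> carrier A" "b \<in> carrier A"
  shows "pure (c \<odot>\<^bsub>A\<^esub> a) b = I +>\<^bsub>Q.F\<^esub> single K c (a, b)" "pure a (c \<odot>\<^bsub>A\<^esub> b) = I +>\<^bsub>Q.F\<^esub> single K c (a, b)"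
proof -
  have "single K \<one>\<^bsub>K\<^esub> (c \<odot>\<^bsub>A\<^esub> a, b) \<ominus>\<^bsub>Q.F\<^esub> single K c (a, b) \<in> T"
    using assms by (intro relations_mem(3)[of _ a _ b]) auto
  then show "pure (c \<odot>\<^bsub>A\<^esub> a) b = I +>\<^bsub>Q.F\<^esub> single K c (a, b)"
    unfolding pure_def using assms by (intro coset_eqI single_FS) auto
  have "single K \<one>\<^bsub>K\<^esub> (a, c \<odot>\<^bsub>A\<^esub> b) \<ominus>\<^bsub>Q.F\<^esub> single K c (a, b) \<in> T"
    using relations_mem(4)[of a a b b c] assms by simp
  then show "pure a (c \<odot>\<^bsub>A\<^esub> b) = I +>\<^bsub>Q.F\<^esub> single K c (a, b)"
    unfolding pure_def using assms by (intro coset_eqI single_FS) auto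
qed

lemma pure_smult: "c \<in> carrier K \<Longrightarrow> a \<in> carrier A \<Longrightarrow> b \<in> carrier A \<Longrightarrow> pure (c \<odot>\<^bsub>A\<^esub> a) b = pure a (c \<odot>\<^bsub>A\<^esub> b)"
  by (simp add: coset_single)

lemma coset_add_eqI:
  assumes "f \<in> Q.FS" "g \<in> Q.FS" "h \<in> Q.FS" "f \<ominus>\<^bsub>Q.F\<^esub> (g \<oplus>\<^bsub>Q.F\<^esub> h) \<in> T"
  shows "I +>\<^bsub>Q.F\<^esub> f = (I +>\<^bsub>Q.F\<^esub> g) \<oplus>\<^bsub>Ae\<^esub> (I +>\<^bsub>Q.F\<^esub> h)"
proof -
  have "g \<oplus>\<^bsub>Q.F\<^esub> h \<in> Q.FS" using Q.F.a_closed[of g h] assms(2,3) unfolding Q.carrier_F(1) by blast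
  then show ?thesis unfolding Ae_ops(2)[OF assms(2,3)] using assms(1,4) by (intro coset_eqI)
qed

lemma pure_add_left:
  assumes "a \<in> carrier A" "a' \<in> carrier A" "b \<in> carrier A"
  shows "pure (a \<oplus>\<^bsub>A\<^esub> a') b = pure a b \<oplus>\<^bsub>Ae\<^esub> pure a' b"
  unfolding pure_def using assms relations_mem(1)[of a a' b b "\<zero>\<^bsub>K\<^esub>"]
  by (intro coset_add_eqI single_FS) simp_all

lemma pure_add_right:
  assumes "a \<in> carrier A" "b \<in> carrier A" "b' \<in> carrier A"
  shows "pure a (b \<oplus>\<^bsub>A\<^esub> b') = pure a b \<oplus>\<^bsub>Ae\<^esub> pure a b'"
  unfolding pure_def using assms relations_mem(2)[of a a b b' "\<zero>\<^bsub>K\<^esub>"]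
  by (intro coset_add_eqI single_FS) simp_all

lemma pure_mult:
  assumes "a \<in> carrier A" "b \<in> carrier A" "a' \<in> carrier A" "b' \<in> carrier A"
  shows "pure a b \<otimes>\<^bsub>Ae\<^esub> pure a' b' = pure (a \<otimes>\<^bsub>A\<^esub> a') (b' \<otimes>\<^bsub>A\<^esub> b)"
  using assms Q.single_mult_single[of "\<one>\<^bsub>K\<^esub>" "\<one>\<^bsub>K\<^esub>" "(a, b)" "(a', b')"]
  unfolding pure_def Ae_ops(1)[OF single_FS[OF R.one_closed assms(1,2)] single_FS[OF R.one_closed assms(3,4)]] by simp

lemma pure_one: "pure \<one>\<^bsub>A\<^esub> \<one>\<^bsub>A\<^esub> = \<one>\<^bsub>Ae\<^esub>"
  by (simp add: pure_def Ae_ops(3))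

lemma pure_smult_bimodule:
  assumes "a \<in> carrier A" "b \<in> carrier A" "x \<in> carrier A"
  shows "pure a b \<odot>\<^bsub>regular_bimodule K A\<^esub> x = a \<otimes>\<^bsub>A\<^esub> x \<otimes>\<^bsub>A\<^esub> b"
  using assms unfolding pure_def smult_coset[OF single_FS[OF R.one_closed assms(1,2)] assms(3)]
  by (simp add: act_single)

text \<open>Elements are finite sums of weighted symbols, and \<open>coset_single\<close> removes
  the weights; hence an induction with neither a scalar case nor a zero case.\<close>

lemma Ae_induct [consumes 1, case_names pure add]:
  assumes X: "X \<in> carrier Ae"
    and pure: "\<And>a b. a \<in> carrier A \<Longrightarrow> b \<in> carrier A \<Longrightarrow> P (pure a b)"
    and add: "\<And>X Y. \<lbrakk>X \<in> carrier Ae; Y \<in> carrier Ae; P X; P Y\<rbrakk> \<Longrightarrow> P (X \<oplus>\<^bsub>Ae\<^esub> Y)"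
  shows "P X"
proof -
  obtain f where f: "f \<in> Q.FS" "X = I +>\<^bsub>Q.F\<^esub> f" using X by (auto simp: Ae_carrier)
  have "P (I +>\<^bsub>Q.F\<^esub> f)" using f(1)
  proof (induction rule: Q.indF)
    case zero
    \<comment> \<open>The empty sum is the pure tensor whose first factor is zero times the
      unit.\<close>
    have "single K \<zero>\<^bsub>K\<^esub> (\<one>\<^bsub>A\<^esub>, \<one>\<^bsub>A\<^esub>) = (\<lambda>p. \<zero>\<^bsub>K\<^esub>)" by (auto simp: single_def)
    then show ?case using pure[of "\<zero>\<^bsub>K\<^esub> \<odot>\<^bsub>A\<^esub> \<one>\<^bsub>A\<^esub>" "\<one>\<^bsub>A\<^esub>"] coset_single(1)[of "\<zero>\<^bsub>K\<^esub>" "\<one>\<^bsub>A\<^esub>" "\<one>\<^bsub>A\<^esub>"] by auto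
  next
    case (add c p f)
    obtain a b where p: "p = (a, b)" by force
    have ab: "a \<in> carrier A" "b \<in> carrier A" using add p by auto
    have "P ((I +>\<^bsub>Q.F\<^esub> single K c p) \<oplus>\<^bsub>Ae\<^esub> (I +>\<^bsub>Q.F\<^esub> f))"
      using add ab pure[of "c \<odot>\<^bsub>A\<^esub> a" b] coset_single(1)[OF add(1) ab] unfolding p
      by (intro assms(3) coset_closed single_FS) auto
    then show ?case using Ae_ops(2)[OF single_FS[OF add(1) ab] add(3)] unfolding p by simp
  qed
  then show ?thesis by (simp add: f)
qed

section \<open>The universal property of the enveloping algebra\<close>

text \<open>\<open>K\<close>-bilinear maps, taken as functions of pairs so that
  \<open>lin_ext\<close> applies to them. The second factor may be \<open>A\<close> in place of its
  opposite because both have the same \<open>K\<close>-module structure.\<close>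

definition balanced :: "('k, 'n, 'q) module_scheme \<Rightarrow> ('a \<times> 'a \<Rightarrow> 'n) \<Rightarrow> bool"
  where "balanced N \<beta> \<longleftrightarrow> (\<forall>a\<in>carrier A. \<forall>b\<in>carrier A. \<beta> (a, b) \<in> carrier N \<and>
    (\<forall>a'\<in>carrier A. \<beta> (a \<oplus>\<^bsub>A\<^esub> a', b) = \<beta> (a, b) \<oplus>\<^bsub>N\<^esub> \<beta> (a', b)) \<and>
    (\<forall>b'\<in>carrier A. \<beta> (a, b \<oplus>\<^bsub>A\<^esub> b') = \<beta> (a, b) \<oplus>\<^bsub>N\<^esub> \<beta> (a, b')) \<and>
    (\<forall>c\<in>carrier K. \<beta> (c \<odot>\<^bsub>A\<^esub> a, b) = c \<odot>\<^bsub>N\<^esub> \<beta> (a, b) \<and> \<beta> (a, c \<odot>\<^bsub>A\<^esub> b) = c \<odot>\<^bsub>N\<^esub> \<beta> (a, b)))"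

lemma balancedD:
  assumes "balanced N \<beta>" "a \<in> carrier A" "b \<in> carrier A"
  shows "\<beta> (a, b) \<in> carrier N"
    "a' \<in> carrier A \<Longrightarrow> \<beta> (a \<oplus>\<^bsub>A\<^esub> a', b) = \<beta> (a, b) \<oplus>\<^bsub>N\<^esub> \<beta> (a', b)"
    "b' \<in> carrier A \<Longrightarrow> \<beta> (a, b \<oplus>\<^bsub>A\<^esub> b') = \<beta> (a, b) \<oplus>\<^bsub>N\<^esub> \<beta> (a, b')"
    "c \<in> carrier K \<Longrightarrow> \<beta> (c \<odot>\<^bsub>A\<^esub> a, b) = c \<odot>\<^bsub>N\<^esub> \<beta> (a, b)"
    "c \<in> carrier K \<Longrightarrow> \<beta> (a, c \<odot>\<^bsub>A\<^esub> b) = c \<odot>\<^bsub>N\<^esub> \<beta> (a, b)"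
  using assms by (auto simp: balanced_def)

context
  fixes N :: "('k, 'n, 'q) module_scheme"
  assumes N: "left_module K N"
begin

interpretation N: left_module K N by (rule N)

lemma balanced_Pi: "balanced N \<beta> \<Longrightarrow> \<beta> \<in> carrier G \<rightarrow> carrier N"
  using balancedD(1) by auto

text \<open>Translations of the monoid \<open>G\<close> multiply each component by a fixed element,
  on one side or the other, and this is \<open>K\<close>-linear in each component. Commutativity of
  \<open>K\<close> lets \<open>c\<close> pass the other scalars.\<close>

lemma balanced_translate:
  assumes \<beta>: "balanced N \<beta>" and c: "c \<in> carrier K" and p: "p \<in> carrier G"
  shows "balanced N (\<lambda>q. c \<odot>\<^bsub>N\<^esub> \<beta> (p \<otimes>\<^bsub>G\<^esub> q))" "balanced N (\<lambda>q. c \<odot>\<^bsub>N\<^esub> \<beta> (q \<otimes>\<^bsub>G\<^esub> p))"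
proof -
  obtain a b where p': "p = (a, b)" "a \<in> carrier A" "b \<in> carrier A" using p by auto
  have comm: "c \<odot>\<^bsub>N\<^esub> (d \<odot>\<^bsub>N\<^esub> x) = d \<odot>\<^bsub>N\<^esub> (c \<odot>\<^bsub>N\<^esub> x)" if "d \<in> carrier K" "x \<in> carrier N" for d x
    using that c by (simp add: N.lsmult_assoc[symmetric] R.m_comm)
  note b = balancedD[OF \<beta>]
  show "balanced N (\<lambda>q. c \<odot>\<^bsub>N\<^esub> \<beta> (p \<otimes>\<^bsub>G\<^esub> q))"
    unfolding balanced_def p' using p'(2,3) c
    by (auto simp: b M.l_distr M.r_distr N.lsmult_r_distr smult_mult_left smult_mult_right comm)
  show "balanced N (\<lambda>q. c \<odot>\<^bsub>N\<^esub> \<beta> (q \<otimes>\<^bsub>G\<^esub> p))"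
    unfolding balanced_def p' using p'(2,3) c
    by (auto simp: b M.l_distr M.r_distr N.lsmult_r_distr smult_mult_left smult_mult_right comm)
qed

text \<open>Multiplying the argument by a weighted symbol is moved to a translation of the bilinear
  map. Translates are again balanced, which is what gives the ideal property in
  \<open>lin_ext_ideal\<close>.\<close>

lemma lin_ext_single_mult:
  assumes \<beta>: "balanced N \<beta>" and c: "c \<in> carrier K" and p: "p \<in> carrier G" and f: "f \<in> Q.FS"
  shows "lin_ext K N \<beta> (single K c p \<otimes>\<^bsub>Q.F\<^esub> f) = lin_ext K N (\<lambda>q. c \<odot>\<^bsub>N\<^esub> \<beta> (p \<otimes>\<^bsub>G\<^esub> q)) f"
    and "lin_ext K N \<beta> (f \<otimes>\<^bsub>Q.F\<^esub> single K c p) = lin_ext K N (\<lambda>q. c \<odot>\<^bsub>N\<^esub> \<beta> (q \<otimes>\<^bsub>G\<^esub> p)) f"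
proof -
  note Pi = balanced_Pi[OF \<beta>] and tr = balanced_translate[OF \<beta> c p, THEN balanced_Pi]
  have bG: "\<beta> q \<in> carrier N" if "q \<in> carrier G" for q using Pi that by blast
  show "lin_ext K N \<beta> (single K c p \<otimes>\<^bsub>Q.F\<^esub> f) = lin_ext K N (\<lambda>q. c \<odot>\<^bsub>N\<^esub> \<beta> (p \<otimes>\<^bsub>G\<^esub> q)) f"
    using f
  proof (induction rule: Q.indF)
    case (add d q g)
    have pq: "p \<otimes>\<^bsub>G\<^esub> q \<in> carrier G" using p add(2) by (rule Q.G.m_closed)
    have s: "single K c p \<in> Q.FS" "single K d q \<in> Q.FS" "single K (c \<otimes>\<^bsub>K\<^esub> d) (p \<otimes>\<^bsub>G\<^esub> q) \<in> Q.FS"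
      using c p add(1,2) pq by (intro Q.fs(4); simp)+
    have "single K c p \<otimes>\<^bsub>Q.F\<^esub> (\<lambda>x. single K d q x \<oplus>\<^bsub>K\<^esub> g x) =
        (\<lambda>x. single K (c \<otimes>\<^bsub>K\<^esub> d) (p \<otimes>\<^bsub>G\<^esub> q) x \<oplus>\<^bsub>K\<^esub> (single K c p \<otimes>\<^bsub>Q.F\<^esub> g) x)"
      using Q.dist(2)[OF s(2) add(3) s(1)] Q.single_mult_single[OF c add(1) p add(2)] by simp
    then show ?case
      using N.lin_ext_add[OF s(3) Q.mult_closed[OF s(1) add(3)] Pi] N.lin_ext_add[OF s(2) add(3) tr(1)]
        N.lin_ext_single[OF _ pq Pi, of "c \<otimes>\<^bsub>K\<^esub> d"] N.lin_ext_single[OF add(1,2) tr(1)] c add(1,4) bG[OF pq]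
      by (simp add: N.lsmult_assoc[symmetric] R.m_comm[of c d] del: G_simps)
  qed (simp add: Q.mult_zero_r)
  show "lin_ext K N \<beta> (f \<otimes>\<^bsub>Q.F\<^esub> single K c p) = lin_ext K N (\<lambda>q. c \<odot>\<^bsub>N\<^esub> \<beta> (q \<otimes>\<^bsub>G\<^esub> p)) f"
    using f
  proof (induction rule: Q.indF)
    case (add d q g)
    have pq: "q \<otimes>\<^bsub>G\<^esub> p \<in> carrier G" using add(2) p by (rule Q.G.m_closed)
    have s: "single K c p \<in> Q.FS" "single K d q \<in> Q.FS" "single K (d \<otimes>\<^bsub>K\<^esub> c) (q \<otimes>\<^bsub>G\<^esub> p) \<in> Q.FS"
      using c p add(1,2) pq by (intro Q.fs(4); simp)+
    have "(\<lambda>x. single K d q x \<oplus>\<^bsub>K\<^esub> g x) \<otimes>\<^bsub>Q.F\<^esub> single K c p =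
        (\<lambda>x. single K (d \<otimes>\<^bsub>K\<^esub> c) (q \<otimes>\<^bsub>G\<^esub> p) x \<oplus>\<^bsub>K\<^esub> (g \<otimes>\<^bsub>Q.F\<^esub> single K c p) x)"
      using Q.dist(1)[OF s(2) add(3) s(1)] Q.single_mult_single[OF add(1) c add(2) p] by simp
    then show ?case
      using N.lin_ext_add[OF s(3) Q.mult_closed[OF add(3) s(1)] Pi] N.lin_ext_add[OF s(2) add(3) tr(2)]
        N.lin_ext_single[OF _ pq Pi, of "d \<otimes>\<^bsub>K\<^esub> c"] N.lin_ext_single[OF add(1,2) tr(2)] c add(1,4) bG[OF pq]
      by (simp add: N.lsmult_assoc[symmetric] del: G_simps)
  qed (simp add: Q.mult_zero_l)
qed

lemma lin_ext_uminus:
  assumes "balanced N \<beta>" "f \<in> Q.FS"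
  shows "lin_ext K N \<beta> (\<ominus>\<^bsub>Q.F\<^esub> f) = \<ominus>\<^bsub>N\<^esub> lin_ext K N \<beta> f"
proof -
  note Pi = balanced_Pi[OF assms(1)]
  have n: "\<ominus>\<^bsub>Q.F\<^esub> f \<in> Q.FS" using Q.F.a_inv_closed[of f] assms by simp
  have "lin_ext K N \<beta> (\<ominus>\<^bsub>Q.F\<^esub> f \<oplus>\<^bsub>Q.F\<^esub> f) = \<zero>\<^bsub>N\<^esub>"
    using Q.F.l_neg[of f] assms by (simp del: Q.carrier_F(4))
  then have "lin_ext K N \<beta> (\<ominus>\<^bsub>Q.F\<^esub> f) \<oplus>\<^bsub>N\<^esub> lin_ext K N \<beta> f = \<zero>\<^bsub>N\<^esub>"
    using N.lin_ext_add[OF n assms(2) Pi] by simp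
  then show ?thesis using N.M.minus_equality N.lin_ext_closed[OF n Pi] N.lin_ext_closed[OF assms(2) Pi] by metis
qed

lemma lin_ext_minus:
  assumes "balanced N \<beta>" "f \<in> Q.FS" "g \<in> Q.FS"
  shows "lin_ext K N \<beta> (f \<ominus>\<^bsub>Q.F\<^esub> g) = lin_ext K N \<beta> f \<ominus>\<^bsub>N\<^esub> lin_ext K N \<beta> g"
  using N.lin_ext_add[OF assms(2) _ balanced_Pi[OF assms(1)], of "\<ominus>\<^bsub>Q.F\<^esub> g"] Q.F.a_inv_closed[of g] assms
  by (simp add: a_minus_def lin_ext_uminus)

text \<open>Quantifying over all balanced maps at once makes the set of elements killed by their linear
  extensions an ideal.\<close>

lemma lin_ext_ideal:
  assumes \<beta>: "balanced N \<beta>" and f: "f \<in> I"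
  shows "lin_ext K N \<beta> f = \<zero>\<^bsub>N\<^esub>"
proof -
  define J where "J = {f \<in> Q.FS. \<forall>\<beta>. balanced N \<beta> \<longrightarrow> lin_ext K N \<beta> f = \<zero>\<^bsub>N\<^esub>}"
  have "ideal J Q.F"
  proof (rule idealI)
    show "ring Q.F" by (rule Q.F.ring_axioms)
    show "subgroup J (add_monoid Q.F)"
    proof (rule group.subgroupI[OF Q.F.a_group])
      show "J \<subseteq> carrier (add_monoid Q.F)" by (auto simp: J_def)
      have "(\<lambda>p. \<zero>\<^bsub>K\<^esub>) \<in> J" by (simp add: J_def Q.fs)
      then show "J \<noteq> {}" by blast
      show "inv\<^bsub>add_monoid Q.F\<^esub> f \<in> J" if "f \<in> J" for f
        using that unfolding a_inv_def[symmetric] by (simp add: closures lin_ext_uminus J_def)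
      show "f \<otimes>\<^bsub>add_monoid Q.F\<^esub> g \<in> J" if "f \<in> J" "g \<in> J" for f g
        using that N.lin_ext_add[OF _ _ balanced_Pi] by (auto simp: J_def Q.fs)
    qed
    show "g \<otimes>\<^bsub>Q.F\<^esub> f \<in> J" if f: "f \<in> J" and g: "g \<in> carrier Q.F" for f g
    proof -
      have fF: "f \<in> Q.FS" using f by (simp add: J_def)
      have "lin_ext K N \<beta> (g \<otimes>\<^bsub>Q.F\<^esub> f) = \<zero>\<^bsub>N\<^esub>" if \<beta>: "balanced N \<beta>" for \<beta>
        using g[unfolded Q.carrier_F]
      proof (induction rule: Q.indF)
        case (add c p g)
        note s = Q.fs(4)[OF add(1,2)]
        show ?case
          using N.lin_ext_add[OF Q.mult_closed[OF s fF] Q.mult_closed[OF add(3) fF] balanced_Pi[OF \<beta>]]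
            lin_ext_single_mult(1)[OF \<beta> add(1,2) fF] balanced_translate(1)[OF \<beta> add(1,2)] f add(4)
          by (simp add: Q.dist(1)[OF s add(3) fF] J_def)
      qed (simp add: Q.mult_zero_l)
      then show ?thesis using fF g by (simp add: J_def closures)
    qed
    show "f \<otimes>\<^bsub>Q.F\<^esub> g \<in> J" if f: "f \<in> J" and g: "g \<in> carrier Q.F" for f g
    proof -
      have fF: "f \<in> Q.FS" using f by (simp add: J_def)
      have "lin_ext K N \<beta> (f \<otimes>\<^bsub>Q.F\<^esub> g) = \<zero>\<^bsub>N\<^esub>" if \<beta>: "balanced N \<beta>" for \<beta>
        using g[unfolded Q.carrier_F]
      proof (induction rule: Q.indF)
        case (add c p g)
        note s = Q.fs(4)[OF add(1,2)]
        show ?case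
          using N.lin_ext_add[OF Q.mult_closed[OF fF s] Q.mult_closed[OF fF add(3)] balanced_Pi[OF \<beta>]]
            lin_ext_single_mult(2)[OF \<beta> add(1,2) fF] balanced_translate(2)[OF \<beta> add(1,2)] f add(4)
          by (simp add: Q.dist(2)[OF s add(3) fF] J_def)
      qed (simp add: Q.mult_zero_r)
      then show ?thesis using fF g by (simp add: J_def closures)
    qed
  qed
  moreover have "T \<subseteq> J"
  proof -
    have "lin_ext K N \<gamma> h = \<zero>\<^bsub>N\<^esub>" if "balanced N \<gamma>" "h \<in> T" for \<gamma> h
    proof -
      note Pi = balanced_Pi[OF that(1)] and b = balancedD[OF that(1)]
      have s: "lin_ext K N \<gamma> (single K c (a, b)) = c \<odot>\<^bsub>N\<^esub> \<gamma> (a, b)"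
        if "c \<in> carrier K" "a \<in> carrier A" "b \<in> carrier A" for c a b
        using that by (intro N.lin_ext_single[OF _ _ Pi]) auto
      have ad: "lin_ext K N \<gamma> (\<lambda>x. f x \<oplus>\<^bsub>K\<^esub> g x) = lin_ext K N \<gamma> f \<oplus>\<^bsub>N\<^esub> lin_ext K N \<gamma> g"
        if "f \<in> Q.FS" "g \<in> Q.FS" for f g using N.lin_ext_add[OF that Pi] .
      show ?thesis
        using that(2) unfolding tensor_relations_def Let_def
        by (auto simp: lin_ext_minus[OF that(1), simplified] ad[simplified] s b Q.fs N.M.minus_eq N.M.r_neg)
    qed
    then show ?thesis using T_carrier by (auto simp: J_def)
  qed
  ultimately have "I \<subseteq> J" by (rule Q.F.genideal_minimal)
  then show ?thesis using assms by (auto simp: J_def)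
qed

lemma lin_ext_coset_cong:
  assumes \<beta>: "balanced N \<beta>" and f: "f \<in> Q.FS" "g \<in> Q.FS" and eq: "I +>\<^bsub>Q.F\<^esub> f = I +>\<^bsub>Q.F\<^esub> g"
  shows "lin_ext K N \<beta> f = lin_ext K N \<beta> g"
proof -
  note Pi = balanced_Pi[OF \<beta>]
  have "f \<ominus>\<^bsub>Q.F\<^esub> g \<in> I" using Q.F.quotient_eq_iff_same_a_r_cos[OF ideal_I, of f g] f eq by simp
  then have "lin_ext K N \<beta> f \<ominus>\<^bsub>N\<^esub> lin_ext K N \<beta> g = \<zero>\<^bsub>N\<^esub>"
    using lin_ext_ideal[OF \<beta>] lin_ext_minus[OF \<beta> f] by simp
  then show ?thesis using N.lin_ext_closed[OF f(1) Pi] N.lin_ext_closed[OF f(2) Pi]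
    by (metis N.M.minus_eq N.M.minus_equality N.M.minus_minus N.M.a_inv_closed)
qed

end

text \<open>\<open>Ae\<close> is a bare ring record. To serve as a target of \<open>lin_ext\<close>
  it receives its \<open>K\<close>-action as multiplication by the pure tensor of \<open>c\<close>
  times the unit with the unit.\<close>

definition scalar_module :: "('k, ('a \<times> 'a \<Rightarrow> 'k) set) module"
  where "scalar_module = \<lparr>carrier = carrier Ae, mult = mult Ae, one = \<one>\<^bsub>Ae\<^esub>, zero = \<zero>\<^bsub>Ae\<^esub>, add = add Ae,
    smult = \<lambda>c X. pure (c \<odot>\<^bsub>A\<^esub> \<one>\<^bsub>A\<^esub>) \<one>\<^bsub>A\<^esub> \<otimes>\<^bsub>Ae\<^esub> X\<rparr>"

lemma scalar_module_simps [simp]: "carrier scalar_module = carrier Ae" "\<zero>\<^bsub>scalar_module\<^esub> = \<zero>\<^bsub>Ae\<^esub>"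
  "X \<oplus>\<^bsub>scalar_module\<^esub> Y = X \<oplus>\<^bsub>Ae\<^esub> Y"
  by (simp_all add: scalar_module_def)

lemma scalar_module_smult: "c \<odot>\<^bsub>scalar_module\<^esub> X = pure (c \<odot>\<^bsub>A\<^esub> \<one>\<^bsub>A\<^esub>) \<one>\<^bsub>A\<^esub> \<otimes>\<^bsub>Ae\<^esub> X"
  by (simp add: scalar_module_def)

lemma scalar_module: "left_module K scalar_module"
proof (intro left_module.intro left_module_axioms.intro R.ring_axioms)
  show "abelian_group scalar_module"
    by (rule abelian_groupI, simp_all add: Ae.a_assoc) (auto simp: Ae.a_comm intro: Ae.l_neg)
  have m: "pure ((c \<otimes>\<^bsub>K\<^esub> d) \<odot>\<^bsub>A\<^esub> \<one>\<^bsub>A\<^esub>) \<one>\<^bsub>A\<^esub> = pure (c \<odot>\<^bsub>A\<^esub> \<one>\<^bsub>A\<^esub>) \<one>\<^bsub>A\<^esub> \<otimes>\<^bsub>Ae\<^esub> pure (d \<odot>\<^bsub>A\<^esub> \<one>\<^bsub>A\<^esub>) \<one>\<^bsub>A\<^esub>"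
    if "c \<in> carrier K" "d \<in> carrier K" for c d
    using that by (simp add: pure_mult smult_mult_left smult_assoc1)
  show "(c \<otimes>\<^bsub>K\<^esub> d) \<odot>\<^bsub>scalar_module\<^esub> X = c \<odot>\<^bsub>scalar_module\<^esub> (d \<odot>\<^bsub>scalar_module\<^esub> X)"
    if "c \<in> carrier K" "d \<in> carrier K" "X \<in> carrier scalar_module" for c d X
    using that by (simp add: scalar_module_smult m Ae.m_assoc)
qed (auto simp: scalar_module_smult smult_l_distr pure_add_left Ae.l_distr Ae.r_distr pure_one)

lemma scalar_module_pure:
  assumes "c \<in> carrier K" "a \<in> carrier A" "b \<in> carrier A"
  shows "c \<odot>\<^bsub>scalar_module\<^esub> pure a b = pure (c \<odot>\<^bsub>A\<^esub> a) b"
  using assms by (simp add: scalar_module_smult pure_mult smult_mult_left)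

lemma pure_finsum:
  assumes "finite X" "finite Y" and u: "u \<in> X \<rightarrow> carrier A" and v: "v \<in> Y \<rightarrow> carrier A"
  shows "(\<Oplus>\<^bsub>Ae\<^esub>p\<in>X \<times> Y. pure (u (fst p)) (v (snd p))) = pure (\<Oplus>\<^bsub>A\<^esub>x\<in>X. u x) (\<Oplus>\<^bsub>A\<^esub>y\<in>Y. v y)"
proof -
  have "(\<Oplus>\<^bsub>Ae\<^esub>p\<in>X \<times> Y. pure (u (fst p)) (v (snd p))) = (\<Oplus>\<^bsub>Ae\<^esub>x\<in>X. \<Oplus>\<^bsub>Ae\<^esub>y\<in>Y. pure (u x) (v y))"
    using assms by (subst Ae.finsum_Sigma) (auto simp: Pi_iff)
  also have "\<dots> = (\<Oplus>\<^bsub>Ae\<^esub>x\<in>X. pure (u x) (\<Oplus>\<^bsub>A\<^esub>y\<in>Y. v y))"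
  proof (rule Ae.finsum_cong')
    fix x assume x: "x \<in> X"
    show "(\<Oplus>\<^bsub>Ae\<^esub>y\<in>Y. pure (u x) (v y)) = pure (u x) (\<Oplus>\<^bsub>A\<^esub>y\<in>Y. v y)"
      using u v funcset_mem[OF u x]
      by (intro additive_finsum[symmetric, where h = "pure (u x)"] M.abelian_group_axioms Ae.abelian_group_axioms)
        (simp_all add: pure_add_right Pi_iff)
  qed (use u v in \<open>auto intro!: M.finsum_closed pure_closed\<close>)
  also have "\<dots> = pure (\<Oplus>\<^bsub>A\<^esub>x\<in>X. u x) (\<Oplus>\<^bsub>A\<^esub>y\<in>Y. v y)"
    using u M.finsum_closed[OF v]
    by (intro additive_finsum[symmetric, where h = "\<lambda>a. pure a _"] M.abelian_group_axioms Ae.abelian_group_axioms)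
      (simp_all add: pure_add_left Pi_iff)
  finally show ?thesis .
qed

end

section \<open>Tensor products of linear maps between enveloping algebras\<close>

definition linear_map ::
    "('k, 'x) ring_scheme \<Rightarrow> ('k, 'a, 'y) module_scheme \<Rightarrow> ('k, 'b, 'z) module_scheme \<Rightarrow> ('a \<Rightarrow> 'b) \<Rightarrow> bool"
  where "linear_map K A B f \<longleftrightarrow> (\<forall>x\<in>carrier A. f x \<in> carrier B) \<and>
    (\<forall>x\<in>carrier A. \<forall>y\<in>carrier A. f (x \<oplus>\<^bsub>A\<^esub> y) = f x \<oplus>\<^bsub>B\<^esub> f y) \<and>
    (\<forall>c\<in>carrier K. \<forall>x\<in>carrier A. f (c \<odot>\<^bsub>A\<^esub> x) = c \<odot>\<^bsub>B\<^esub> f x)"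

lemma linear_mapD:
  assumes "linear_map K A B f"
  shows "x \<in> carrier A \<Longrightarrow> f x \<in> carrier B"
    "x \<in> carrier A \<Longrightarrow> y \<in> carrier A \<Longrightarrow> f (x \<oplus>\<^bsub>A\<^esub> y) = f x \<oplus>\<^bsub>B\<^esub> f y"
    "c \<in> carrier K \<Longrightarrow> x \<in> carrier A \<Longrightarrow> f (c \<odot>\<^bsub>A\<^esub> x) = c \<odot>\<^bsub>B\<^esub> f x"
  using assms by (auto simp: linear_map_def)

locale enveloping_pair = A: enveloping_setup K A + B: enveloping_setup K B
  for K :: "('k, 'x) ring_scheme" (structure) and A :: "('k, 'a, 'y) module_scheme"
    and B :: "('k, 'b, 'z) module_scheme"
begin

text \<open>The map \<open>f \<otimes> g\<close>, computed on some representative of the coset;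
  \<open>tens_coset\<close> shows that every representative gives the same value.\<close>

definition tens :: "('a \<Rightarrow> 'b) \<Rightarrow> ('a \<Rightarrow> 'b) \<Rightarrow> ('a \<times> 'a \<Rightarrow> 'k) set \<Rightarrow> ('b \<times> 'b \<Rightarrow> 'k) set"
  where "tens f g X = lin_ext K B.scalar_module (\<lambda>p. B.pure (f (fst p)) (g (snd p)))
    (SOME h. h \<in> A.Q.FS \<and> X = A.I +>\<^bsub>A.Q.F\<^esub> h)"

context
  fixes f g assumes f: "linear_map K A B f" and g: "linear_map K A B g"
begin

interpretation N: left_module K B.scalar_module by (rule B.scalar_module)

lemma tens_balanced: "A.balanced B.scalar_module (\<lambda>p. B.pure (f (fst p)) (g (snd p)))"
  unfolding A.balanced_def
  by (simp add: linear_mapD[OF f] linear_mapD[OF g] B.pure_add_left B.pure_add_right B.scalar_module_pure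
    B.pure_smult[symmetric])

lemma tens_coset:
  assumes "h \<in> A.Q.FS"
  shows "tens f g (A.I +>\<^bsub>A.Q.F\<^esub> h) = lin_ext K B.scalar_module (\<lambda>p. B.pure (f (fst p)) (g (snd p))) h"
proof -
  have "\<exists>h'. h' \<in> A.Q.FS \<and> A.I +>\<^bsub>A.Q.F\<^esub> h = A.I +>\<^bsub>A.Q.F\<^esub> h'" using assms by blast
  from someI_ex[OF this] show ?thesis
    unfolding tens_def by (intro A.lin_ext_coset_cong[OF B.scalar_module tens_balanced _ assms]) simp_all
qed

lemma tens_closed:
  assumes "X \<in> carrier A.Ae" shows "tens f g X \<in> carrier B.Ae"
proof -
  obtain h where h: "h \<in> A.Q.FS" "X = A.I +>\<^bsub>A.Q.F\<^esub> h" using assms by (auto simp: A.Ae_carrier)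
  show ?thesis unfolding h(2) tens_coset[OF h(1)]
    using N.lin_ext_closed[OF h(1) A.balanced_Pi[OF B.scalar_module tens_balanced]] by simp
qed

lemma tens_add:
  assumes "X \<in> carrier A.Ae" "Y \<in> carrier A.Ae"
  shows "tens f g (X \<oplus>\<^bsub>A.Ae\<^esub> Y) = tens f g X \<oplus>\<^bsub>B.Ae\<^esub> tens f g Y"
proof -
  obtain h where h: "h \<in> A.Q.FS" "X = A.I +>\<^bsub>A.Q.F\<^esub> h" using assms by (auto simp: A.Ae_carrier)
  obtain h' where h': "h' \<in> A.Q.FS" "Y = A.I +>\<^bsub>A.Q.F\<^esub> h'" using assms by (auto simp: A.Ae_carrier)
  have s: "h \<oplus>\<^bsub>A.Q.F\<^esub> h' \<in> A.Q.FS" using A.Q.F.a_closed[of h h'] h h' unfolding A.Q.carrier_F(1) by blast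
  show ?thesis unfolding h(2) h'(2) A.Ae_ops(2)[OF h(1) h'(1)] tens_coset[OF h(1)] tens_coset[OF h'(1)] tens_coset[OF s]
    using N.lin_ext_add[OF h(1) h'(1) A.balanced_Pi[OF B.scalar_module tens_balanced]] by simp
qed

lemma tens_pure:
  assumes "a \<in> carrier A" "b \<in> carrier A"
  shows "tens f g (A.pure a b) = B.pure (f a) (g b)"
proof -
  note s = A.single_FS[OF A.R.one_closed assms]
  show ?thesis unfolding A.pure_def tens_coset[OF s]
    using N.lin_ext_single[OF A.R.one_closed _ A.balanced_Pi[OF B.scalar_module tens_balanced], of "(a, b)"] assms
    by (simp add: linear_mapD(1)[OF f] linear_mapD(1)[OF g] N.lsmult_one[simplified])
qed

end

end

section \<open>Morita data for enveloping algebras\<close>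

lemma regular_bimodule_simps [simp]: "carrier (regular_bimodule K A) = carrier A"
  "\<zero>\<^bsub>regular_bimodule K A\<^esub> = \<zero>\<^bsub>A\<^esub>" "x \<oplus>\<^bsub>regular_bimodule K A\<^esub> y = x \<oplus>\<^bsub>A\<^esub> y"
  by (simp_all add: regular_bimodule_def)

lemma finsum_regular_bimodule: "finsum (regular_bimodule K A) f X = finsum A f X"
  by (simp add: finsum_def finprod_def regular_bimodule_def)

locale morita_algebras = MD: morita_data A B I J phi theta + A: enveloping_setup K A + B: enveloping_setup K B
  for K :: "('k, 'x) ring_scheme" (structure) and A :: "('k, 'a, 'y) module_scheme"
    and B :: "('k, 'b, 'z) module_scheme" and I :: "'i set" and J :: "'i set" and phi and theta +
  assumes phi_linear: "linear_map K B A (phi i l)"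
    and theta_linear: "linear_map K A B (theta i l)"
begin

sublocale AB: enveloping_pair K A B
  by (intro enveloping_pair.intro A.enveloping_setup_axioms B.enveloping_setup_axioms)

sublocale BA: enveloping_pair K B A
  by (intro enveloping_pair.intro A.enveloping_setup_axioms B.enveloping_setup_axioms)

lemma swap: "morita_algebras K B A J I theta phi"
  by (intro morita_algebras.intro morita_algebras_axioms.intro MD.swap A.enveloping_setup_axioms
    B.enveloping_setup_axioms phi_linear theta_linear)

text \<open>The indices of the second factor are transposed: it takes values in the opposite
  algebra, where the factors of a matrix product appear in reverse order. With the transposition
  \<open>Phi\<close> is multiplicative as a matrix.\<close>

definition Phi :: "'i \<times> 'i \<Rightarrow> 'i \<times> 'i \<Rightarrow> ('b \<times> 'b \<Rightarrow> 'k) set \<Rightarrow> ('a \<times> 'a \<Rightarrow> 'k) set"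
  where "Phi p q = BA.tens (phi (fst p) (fst q)) (phi (snd q) (snd p))"

definition Theta :: "'i \<times> 'i \<Rightarrow> 'i \<times> 'i \<Rightarrow> ('a \<times> 'a \<Rightarrow> 'k) set \<Rightarrow> ('b \<times> 'b \<Rightarrow> 'k) set"
  where "Theta p q = AB.tens (theta (fst p) (fst q)) (theta (snd q) (snd p))"

text \<open>Through this identity the laws proved for \<open>Phi\<close> also give those for
  \<open>Theta\<close>, by passing to the swapped data.\<close>

lemma Theta_eq: "Theta = morita_algebras.Phi K B A theta"
  unfolding morita_algebras.Phi_def[OF swap] Theta_def by (rule ext)+ simp

lemma Phi_closed [simp]: "X \<in> carrier B.Ae \<Longrightarrow> Phi p q X \<in> carrier A.Ae"
  unfolding Phi_def by (intro BA.tens_closed phi_linear)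

lemma Phi_add: "X \<in> carrier B.Ae \<Longrightarrow> Y \<in> carrier B.Ae \<Longrightarrow> Phi p q (X \<oplus>\<^bsub>B.Ae\<^esub> Y) = Phi p q X \<oplus>\<^bsub>A.Ae\<^esub> Phi p q Y"
  unfolding Phi_def by (intro BA.tens_add phi_linear)

lemma Phi_pure: "b \<in> carrier B \<Longrightarrow> b' \<in> carrier B \<Longrightarrow>
    Phi p q (B.pure b b') = A.pure (phi (fst p) (fst q) b) (phi (snd q) (snd p) b')"
  unfolding Phi_def by (intro BA.tens_pure phi_linear)

lemma Phi_one: "Phi p q \<one>\<^bsub>B.Ae\<^esub> = A.pure (phi (fst p) (fst q) \<one>\<^bsub>B\<^esub>) (phi (snd q) (snd p) \<one>\<^bsub>B\<^esub>)"
  unfolding B.pure_one[symmetric] by (intro Phi_pure) auto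

lemma Theta_pure: "a \<in> carrier A \<Longrightarrow> a' \<in> carrier A \<Longrightarrow>
    Theta p q (A.pure a a') = B.pure (theta (fst p) (fst q) a) (theta (snd q) (snd p) a')"
  unfolding Theta_def by (intro AB.tens_pure theta_linear)

lemma Theta_closed [simp]: "X \<in> carrier A.Ae \<Longrightarrow> Theta p q X \<in> carrier B.Ae"
  unfolding Theta_def by (intro AB.tens_closed theta_linear)

lemma Theta_add: "X \<in> carrier A.Ae \<Longrightarrow> Y \<in> carrier A.Ae \<Longrightarrow>
    Theta p q (X \<oplus>\<^bsub>A.Ae\<^esub> Y) = Theta p q X \<oplus>\<^bsub>B.Ae\<^esub> Theta p q Y"
  unfolding Theta_def by (intro AB.tens_add theta_linear)

lemma Phi_mult:
  assumes X: "X \<in> carrier B.Ae" and Y: "Y \<in> carrier B.Ae"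
  shows "(\<Oplus>\<^bsub>A.Ae\<^esub>k\<in>I \<times> I. Phi p k X \<otimes>\<^bsub>A.Ae\<^esub> Phi k q Y) = Phi p q (X \<otimes>\<^bsub>B.Ae\<^esub> Y)"
  using X
proof (induction rule: B.Ae_induct)
  case (pure b b')
  show ?case using Y
  proof (induction rule: B.Ae_induct)
    case (pure d d')
    note bd = \<open>b \<in> carrier B\<close> \<open>b' \<in> carrier B\<close> \<open>d \<in> carrier B\<close> \<open>d' \<in> carrier B\<close>
    let ?u = "\<lambda>k. phi (fst p) k b \<otimes>\<^bsub>A\<^esub> phi k (fst q) d"
    let ?v = "\<lambda>k. phi (snd q) k d' \<otimes>\<^bsub>A\<^esub> phi k (snd p) b'"
    have "(\<Oplus>\<^bsub>A.Ae\<^esub>k\<in>I \<times> I. Phi p k (B.pure b b') \<otimes>\<^bsub>A.Ae\<^esub> Phi k q (B.pure d d')) =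
        (\<Oplus>\<^bsub>A.Ae\<^esub>k\<in>I \<times> I. A.pure (?u (fst k)) (?v (snd k)))"
      using bd by (intro A.Ae.finsum_cong') (auto simp: Phi_pure A.pure_mult)
    also have "\<dots> = A.pure (\<Oplus>\<^bsub>A\<^esub>k\<in>I. ?u k) (\<Oplus>\<^bsub>A\<^esub>k\<in>I. ?v k)"
      using bd MD.finite(1) by (intro A.pure_finsum) auto
    also have "\<dots> = Phi p q (B.pure b b' \<otimes>\<^bsub>B.Ae\<^esub> B.pure d d')"
      using bd by (simp add: MD.phi_mult B.pure_mult Phi_pure)
    finally show ?case .
  next
    case (add Y Y')
    have p: "B.pure b b' \<in> carrier B.Ae" using pure by simp
    have "(\<Oplus>\<^bsub>A.Ae\<^esub>k\<in>I \<times> I. Phi p k (B.pure b b') \<otimes>\<^bsub>A.Ae\<^esub> Phi k q (Y \<oplus>\<^bsub>B.Ae\<^esub> Y')) =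
        (\<Oplus>\<^bsub>A.Ae\<^esub>k\<in>I \<times> I. Phi p k (B.pure b b') \<otimes>\<^bsub>A.Ae\<^esub> Phi k q Y \<oplus>\<^bsub>A.Ae\<^esub> Phi p k (B.pure b b') \<otimes>\<^bsub>A.Ae\<^esub> Phi k q Y')"
      using add p by (intro A.Ae.finsum_cong') (simp_all add: Phi_add A.Ae.r_distr)
    also have "\<dots> = Phi p q (B.pure b b' \<otimes>\<^bsub>B.Ae\<^esub> (Y \<oplus>\<^bsub>B.Ae\<^esub> Y'))"
      using add p by (simp add: A.Ae.finsum_addf Pi_def B.Ae.r_distr Phi_add)
    finally show ?case .
  qed
next
  case (add X X')
  have "(\<Oplus>\<^bsub>A.Ae\<^esub>k\<in>I \<times> I. Phi p k (X \<oplus>\<^bsub>B.Ae\<^esub> X') \<otimes>\<^bsub>A.Ae\<^esub> Phi k q Y) =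
      (\<Oplus>\<^bsub>A.Ae\<^esub>k\<in>I \<times> I. Phi p k X \<otimes>\<^bsub>A.Ae\<^esub> Phi k q Y \<oplus>\<^bsub>A.Ae\<^esub> Phi p k X' \<otimes>\<^bsub>A.Ae\<^esub> Phi k q Y)"
    using add Y by (intro A.Ae.finsum_cong') (simp_all add: Phi_add A.Ae.l_distr)
  also have "\<dots> = Phi p q ((X \<oplus>\<^bsub>B.Ae\<^esub> X') \<otimes>\<^bsub>B.Ae\<^esub> Y)"
    using add Y by (simp add: A.Ae.finsum_addf Pi_def B.Ae.l_distr Phi_add)
  finally show ?case .
qed

lemma Phi_Theta:
  assumes X: "X \<in> carrier A.Ae"
  shows "Phi p q (Theta k j X) = Phi p k \<one>\<^bsub>B.Ae\<^esub> \<otimes>\<^bsub>A.Ae\<^esub> X \<otimes>\<^bsub>A.Ae\<^esub> Phi j q \<one>\<^bsub>B.Ae\<^esub>"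
  using X
proof (induction rule: A.Ae_induct)
  case (pure a b)
  then show ?case by (simp add: Theta_pure Phi_pure Phi_one A.pure_mult MD.phi_theta MD.R.m_assoc)
next
  case (add X Y)
  then show ?case by (simp add: Theta_add Phi_add A.Ae.l_distr A.Ae.r_distr)
qed

lemma sum_Phi_one: "(\<Oplus>\<^bsub>A.Ae\<^esub>k\<in>J \<times> J. Phi k k \<one>\<^bsub>B.Ae\<^esub>) = \<one>\<^bsub>A.Ae\<^esub>"
  unfolding Phi_one using A.pure_finsum[of J J "\<lambda>k. phi k k \<one>\<^bsub>B\<^esub>" "\<lambda>k. phi k k \<one>\<^bsub>B\<^esub>"] MD.finite(2)
  by (simp add: MD.phi_one A.pure_one)

end

sublocale morita_algebras \<subseteq> E: morita_data "enveloping_algebra K A" "enveloping_algebra K B" "I \<times> I" "J \<times> J" Phi Theta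
proof -
  \<comment> \<open>The swapped data supply the half of the axioms that concerns
    \<open>Theta\<close>.\<close>
  interpret S: morita_algebras K B A J I theta phi by (rule swap)
  have T: "S.Phi = Theta" "S.Theta = Phi"
    by (simp_all add: Theta_eq S.Theta_eq)
  show "morita_data A.Ae B.Ae (I \<times> I) (J \<times> J) Phi Theta"
    by (intro morita_data.intro morita_data_axioms.intro A.Ae.ring_axioms B.Ae.ring_axioms)
      (use MD.finite in \<open>simp_all add: Phi_add Theta_add Phi_mult Phi_Theta sum_Phi_one
        S.Phi_mult[unfolded T] S.Phi_Theta[unfolded T] S.sum_Phi_one[unfolded T]\<close>)
qed

section \<open>The regular bimodule of \<open>A\<close> is sent to that of \<open>B\<close>\<close>

context morita_algebras
begin

text \<open>For the enveloping algebras the functor sends \<open>A\<close> to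
  \<open>P \<otimes> A \<otimes> Q\<close>, tensored over \<open>A\<close>, which the pairing
  identifies with \<open>B\<close>. In the embedding into families, \<open>b\<close> corresponds to
  the entries \<open>(q_i, b p_l)\<close>.\<close>

definition tvec :: "'b \<Rightarrow> 'i \<times> 'i \<Rightarrow> 'a"
  where "tvec b = (\<lambda>p\<in>I \<times> I. phi (fst p) (snd p) b)"

abbreviation "RA \<equiv> regular_bimodule K A"
abbreviation "RB \<equiv> regular_bimodule K B"

lemmas left_module_RA = A.left_module_regular_bimodule
lemmas left_module_RB = B.left_module_regular_bimodule

lemma tvec_Pi: "b \<in> carrier B \<Longrightarrow> tvec b \<in> I \<times> I \<rightarrow> carrier RA"
  by (auto simp: tvec_def)

text \<open>On a pure tensor the left side is a product of three matrices \<open>phi\<close>,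
  belonging to \<open>c\<close>, \<open>b\<close> and \<open>c'\<close>; two uses of
  \<open>phi_mult\<close> collapse it to the matrix of their product.\<close>

lemma mat_act_tvec:
  assumes X: "X \<in> carrier B.Ae" and b: "b \<in> carrier B"
  shows "E.mat_act RA X (tvec b) = tvec (X \<odot>\<^bsub>RB\<^esub> b)"
  using X
proof (induction rule: B.Ae_induct)
  case (pure c c')
  have "(\<Oplus>\<^bsub>A\<^esub>k\<in>I \<times> I. Phi p k (B.pure c c') \<odot>\<^bsub>RA\<^esub> tvec b k) = phi (fst p) (snd p) (c \<otimes>\<^bsub>B\<^esub> b \<otimes>\<^bsub>B\<^esub> c')" for p
  proof -
    have "(\<Oplus>\<^bsub>A\<^esub>k\<in>I \<times> I. Phi p k (B.pure c c') \<odot>\<^bsub>RA\<^esub> tvec b k) =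
        (\<Oplus>\<^bsub>A\<^esub>k\<in>I \<times> I. phi (fst p) (fst k) c \<otimes>\<^bsub>A\<^esub> (phi (fst k) (snd k) b \<otimes>\<^bsub>A\<^esub> phi (snd k) (snd p) c'))"
      using pure b
      by (intro MD.R.finsum_cong') (auto simp: Phi_pure tvec_def A.pure_smult_bimodule MD.R.m_assoc)
    also have "\<dots> = (\<Oplus>\<^bsub>A\<^esub>k\<in>I. \<Oplus>\<^bsub>A\<^esub>l\<in>I. phi (fst p) k c \<otimes>\<^bsub>A\<^esub> (phi k l b \<otimes>\<^bsub>A\<^esub> phi l (snd p) c'))"
      using pure b MD.finite(1) by (subst MD.R.finsum_Sigma) auto
    also have "\<dots> = (\<Oplus>\<^bsub>A\<^esub>k\<in>I. phi (fst p) k c \<otimes>\<^bsub>A\<^esub> phi k (snd p) (b \<otimes>\<^bsub>B\<^esub> c'))"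
      using pure b MD.finite(1)
      by (intro MD.R.finsum_cong') (auto simp: MD.R.finsum_rdistr[symmetric] MD.phi_mult)
    also have "\<dots> = phi (fst p) (snd p) (c \<otimes>\<^bsub>B\<^esub> b \<otimes>\<^bsub>B\<^esub> c')"
      using pure b by (simp add: MD.phi_mult MD.S.m_assoc)
    finally show ?thesis .
  qed
  then show ?case using pure b
    by (simp add: E.mat_act_def tvec_def[of "c \<otimes>\<^bsub>B\<^esub> b \<otimes>\<^bsub>B\<^esub> c'"] B.pure_smult_bimodule finsum_regular_bimodule)
next
  case (add X Y)
  interpret RB: left_module B.Ae RB by (rule left_module_RB)
  have c: "X \<odot>\<^bsub>RB\<^esub> b \<in> carrier B" "Y \<odot>\<^bsub>RB\<^esub> b \<in> carrier B"
    using add b RB.lsmult_closed by auto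
  have "E.mat_act RA (X \<oplus>\<^bsub>B.Ae\<^esub> Y) (tvec b) = (\<lambda>p\<in>I \<times> I. E.mat_act RA X (tvec b) p \<oplus>\<^bsub>RA\<^esub> E.mat_act RA Y (tvec b) p)"
    by (rule E.mat_act_add_left[OF left_module_RA add(1,2) tvec_Pi[OF b]])
  also have "\<dots> = tvec ((X \<oplus>\<^bsub>B.Ae\<^esub> Y) \<odot>\<^bsub>RB\<^esub> b)"
    using RB.lsmult_l_distr[OF add(1,2)] b c unfolding add(3,4)
    by (auto simp: tvec_def MD.phi_add intro!: restrict_ext)
  finally show ?case .
qed

lemma tvec_hom: "(\<lambda>b\<in>carrier RB. tvec b) \<in> mod_hom B.Ae RB (E.ind_module RA)"
proof (rule mod_homI[OF _ _ _ left_module_RB])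
  interpret RB: left_module B.Ae RB by (rule left_module_RB)
  fix b assume b: "b \<in> carrier RB"
  have "E.mat_act RA \<one>\<^bsub>B.Ae\<^esub> (tvec b) = tvec b"
    using mat_act_tvec[OF B.Ae.one_closed, of b] RB.lsmult_one[OF b] b by simp
  then show "tvec b \<in> carrier (E.ind_module RA)"
    using b by (auto simp: E.ind_module_simps tvec_def)
  show "tvec (X \<odot>\<^bsub>RB\<^esub> b) = X \<odot>\<^bsub>E.ind_module RA\<^esub> tvec b" if "X \<in> carrier B.Ae" for X
    using mat_act_tvec[OF that, of b] b by (simp add: E.ind_module_simps)
  show "tvec (b \<oplus>\<^bsub>RB\<^esub> b') = tvec b \<oplus>\<^bsub>E.ind_module RA\<^esub> tvec b'" if "b' \<in> carrier RB" for b'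
    using b that by (auto simp: E.ind_module_simps tvec_def MD.phi_add intro!: restrict_ext)
qed

text \<open>By \<open>theta_phi\<close> each term is \<open>b\<close> between two diagonal values of
  \<open>theta\<close> at the unit with independent indices, and \<open>theta_one\<close> sums each
  of these to 1.\<close>

lemma tvec_left_inverse:
  assumes b: "b \<in> carrier B"
  shows "(\<Oplus>\<^bsub>B\<^esub>k\<in>I \<times> I. theta (fst k) (snd k) (tvec b k)) = b"
proof -
  have "(\<Oplus>\<^bsub>B\<^esub>k\<in>I \<times> I. theta (fst k) (snd k) (tvec b k)) =
      (\<Oplus>\<^bsub>B\<^esub>k\<in>I \<times> I. theta (fst k) (fst k) \<one>\<^bsub>A\<^esub> \<otimes>\<^bsub>B\<^esub> b \<otimes>\<^bsub>B\<^esub> theta (snd k) (snd k) \<one>\<^bsub>A\<^esub>)"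
    using b by (intro MD.S.finsum_cong') (auto simp: tvec_def MD.theta_phi)
  also have "\<dots> = (\<Oplus>\<^bsub>B\<^esub>k\<in>I. \<Oplus>\<^bsub>B\<^esub>l\<in>I. theta k k \<one>\<^bsub>A\<^esub> \<otimes>\<^bsub>B\<^esub> b \<otimes>\<^bsub>B\<^esub> theta l l \<one>\<^bsub>A\<^esub>)"
    using b MD.finite(1) by (subst MD.S.finsum_Sigma) auto
  also have "\<dots> = (\<Oplus>\<^bsub>B\<^esub>k\<in>I. theta k k \<one>\<^bsub>A\<^esub> \<otimes>\<^bsub>B\<^esub> b)"
    using b MD.finite(1)
    by (intro MD.S.finsum_cong') (auto simp: MD.S.finsum_rdistr[symmetric] MD.theta_one)
  also have "\<dots> = b" using b MD.finite(1) by (subst MD.S.finsum_ldistr[symmetric]) (auto simp: MD.theta_one)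
  finally show ?thesis .
qed

text \<open>Read from left to right, \<open>phi_theta\<close> turns the composite of
  \<open>phi\<close> and \<open>theta\<close> into the action of \<open>Phi\<close> at the unit,
  under which \<open>t\<close> is fixed.\<close>

lemma tvec_right_inverse:
  assumes t: "t \<in> carrier (E.ind_module RA)"
  shows "tvec (\<Oplus>\<^bsub>B\<^esub>k\<in>I \<times> I. theta (fst k) (snd k) (t k)) = t"
proof (rule extensionalityI)
  note t' = E.ind_moduleD[OF t]
  fix p assume p: "p \<in> I \<times> I"
  have "t p = (\<Oplus>\<^bsub>A\<^esub>k\<in>I \<times> I. Phi p k \<one>\<^bsub>B.Ae\<^esub> \<odot>\<^bsub>RA\<^esub> t k)"
    using t'(4)[OF p] by (simp add: finsum_regular_bimodule)
  also have "\<dots> = (\<Oplus>\<^bsub>A\<^esub>k\<in>I \<times> I. phi (fst p) (snd p) (theta (fst k) (snd k) (t k)))"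
    using t'(1) by (intro MD.R.finsum_cong') (auto simp: Phi_one A.pure_smult_bimodule MD.phi_theta)
  also have "\<dots> = phi (fst p) (snd p) (\<Oplus>\<^bsub>B\<^esub>k\<in>I \<times> I. theta (fst k) (snd k) (t k))"
    using t'(1)
    by (intro additive_finsum[symmetric, where h = "phi (fst p) (snd p)"] MD.R.abelian_group_axioms
      MD.S.abelian_group_axioms) (auto simp: MD.phi_add)
  finally show "tvec (\<Oplus>\<^bsub>B\<^esub>k\<in>I \<times> I. theta (fst k) (snd k) (t k)) p = t p"
    using p by (simp add: tvec_def)
qed (use E.ind_moduleD(2)[OF t] in \<open>auto simp: tvec_def PiE_def\<close>)

lemma homologically_smooth_transfer:
  assumes "homologically_smooth K A"
  shows "homologically_smooth K B"
proof -
  let ?h = "\<lambda>b\<in>carrier RB. tvec b"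
  have inj: "inj_on ?h (carrier RB)"
    by (rule inj_on_inverseI[where g = "\<lambda>t. \<Oplus>\<^bsub>B\<^esub>k\<in>I \<times> I. theta (fst k) (snd k) (t k)"])
      (simp add: tvec_left_inverse)
  have "t \<in> ?h ` carrier RB" if t: "t \<in> carrier (E.ind_module RA)" for t
  proof (rule image_eqI)
    show b: "(\<Oplus>\<^bsub>B\<^esub>k\<in>I \<times> I. theta (fst k) (snd k) (t k)) \<in> carrier RB"
      using E.ind_moduleD(1)[OF t] by (auto intro!: MD.S.finsum_closed)
    show "t = ?h (\<Oplus>\<^bsub>B\<^esub>k\<in>I \<times> I. theta (fst k) (snd k) (t k))"
      using b by (simp add: tvec_right_inverse[OF t])
  qed
  then have surj: "?h ` carrier RB = carrier (E.ind_module RA)"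
    using mod_homD(1)[OF tvec_hom] by blast
  \<comment> \<open>\<open>has_finite_fgproj_resolution_ind\<close> wants an isomorphism out of the
    induced module, so \<open>tvec\<close> has to be inverted.\<close>
  let ?g = "\<lambda>t\<in>carrier (E.ind_module RA). inv_into (carrier RB) ?h t"
  have "?g \<in> mod_hom B.Ae (E.ind_module RA) RB"
    by (rule mod_hom_inv_into[OF tvec_hom inj surj left_module_RB E.left_module_ind[OF left_module_RA]])
  moreover have "inj_on ?g (carrier (E.ind_module RA))"
    using inj_on_inv_into[of "carrier (E.ind_module RA)" ?h "carrier RB"] surj
    by (simp add: inj_on_def)
  moreover have "?g ` carrier (E.ind_module RA) = carrier RB"
  proof -
    have "?g ` carrier (E.ind_module RA) = inv_into (carrier RB) ?h ` ?h ` carrier RB"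
      unfolding surj by auto
    also have "\<dots> = carrier RB" by (rule inv_into_image_cancel[OF inj subset_refl])
    finally show ?thesis .
  qed
  ultimately show ?thesis
    using E.has_finite_fgproj_resolution_ind[OF left_module_RA _ left_module_RB] assms
    unfolding homologically_smooth_def by blast
qed

end

section \<open>Morita data from a progenerator\<close>

text \<open>The laws for \<open>\<alpha>\<close> make it an isomorphism from \<open>A\<close> onto
  the opposite of the endomorphism ring of \<open>P\<close>, so \<open>P\<close> is a
  \<open>B\<close>-\<open>A\<close>-bimodule with \<open>\<alpha> a\<close> as right multiplication;
  \<open>alpha_smult\<close> says that both actions restrict to the same action of \<open>K\<close>.
  \<open>q\<close> and \<open>x\<close> are well typed at every index, not only in \<open>I\<close>
  and \<open>J\<close>, because the laws of \<open>morita_data\<close> range over all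
  indices.\<close>

locale progenerator = A: k_algebra K A + B: k_algebra K B + P: left_module B P
  for K :: "('k, 'x) ring_scheme" (structure) and A :: "('k, 'a, 'y) module_scheme"
    and B :: "('k, 'b, 'z) module_scheme" and P :: "('b, 'u) module" +
  fixes \<alpha> :: "'a \<Rightarrow> 'u \<Rightarrow> 'u" and I J :: "'i set" and q :: "'i \<Rightarrow> 'u \<Rightarrow> 'b" and x :: "'i \<Rightarrow> 'u"
  assumes alpha_hom: "a \<in> carrier A \<Longrightarrow> \<alpha> a \<in> mod_hom B P P"
    and alpha_one: "y \<in> carrier P \<Longrightarrow> \<alpha> \<one>\<^bsub>A\<^esub> y = y"
    and alpha_mult: "\<lbrakk>a \<in> carrier A; a' \<in> carrier A; y \<in> carrier P\<rbrakk> \<Longrightarrow> \<alpha> (a \<otimes>\<^bsub>A\<^esub> a') y = \<alpha> a' (\<alpha> a y)"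
    and alpha_add: "\<lbrakk>a \<in> carrier A; a' \<in> carrier A; y \<in> carrier P\<rbrakk> \<Longrightarrow> \<alpha> (a \<oplus>\<^bsub>A\<^esub> a') y = \<alpha> a y \<oplus>\<^bsub>P\<^esub> \<alpha> a' y"
    and alpha_smult: "\<lbrakk>c \<in> carrier K; a \<in> carrier A; y \<in> carrier P\<rbrakk> \<Longrightarrow>
      \<alpha> (c \<odot>\<^bsub>A\<^esub> a) y = (c \<odot>\<^bsub>B\<^esub> \<one>\<^bsub>B\<^esub>) \<odot>\<^bsub>P\<^esub> \<alpha> a y"
    and alpha_inj: "\<lbrakk>a \<in> carrier A; a' \<in> carrier A; \<alpha> a = \<alpha> a'\<rbrakk> \<Longrightarrow> a = a'"
    and alpha_surj: "h \<in> mod_hom B P P \<Longrightarrow> \<exists>a\<in>carrier A. \<alpha> a = h"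
    and finite: "finite I" "finite J"
    and q: "q i \<in> mod_hom B P (reg B)" and x: "x i \<in> carrier P"
    and generator: "(\<Oplus>\<^bsub>B\<^esub>k\<in>I. q k (x k)) = \<one>\<^bsub>B\<^esub>"
    and projective: "y \<in> carrier P \<Longrightarrow> (\<Oplus>\<^bsub>P\<^esub>k\<in>J. q k y \<odot>\<^bsub>P\<^esub> x k) = y"
begin

definition theta :: "'i \<Rightarrow> 'i \<Rightarrow> 'a \<Rightarrow> 'b"
  where "theta k j a = q j (\<alpha> a (x k))"

text \<open>The pairing \<open>(q_i, b x_l)\<close> with values in \<open>A\<close>: the described
  map is a \<open>B\<close>-endomorphism of \<open>P\<close>, hence right multiplication by exactly
  one element of \<open>A\<close>.\<close>

definition phi :: "'i \<Rightarrow> 'i \<Rightarrow> 'b \<Rightarrow> 'a"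
  where "phi i l b = (SOME a. a \<in> carrier A \<and> (\<forall>y\<in>carrier P. \<alpha> a y = (q i y \<otimes>\<^bsub>B\<^esub> b) \<odot>\<^bsub>P\<^esub> x l))"

lemma q_closed [simp]: "y \<in> carrier P \<Longrightarrow> q i y \<in> carrier B"
  using mod_homD(1)[OF q] by simp

lemma x_closed [simp]: "x i \<in> carrier P" by (rule x)

lemma q_add: "y \<in> carrier P \<Longrightarrow> y' \<in> carrier P \<Longrightarrow> q i (y \<oplus>\<^bsub>P\<^esub> y') = q i y \<oplus>\<^bsub>B\<^esub> q i y'"
  using mod_homD(2)[OF q] by simp

lemma q_smult: "b \<in> carrier B \<Longrightarrow> y \<in> carrier P \<Longrightarrow> q i (b \<odot>\<^bsub>P\<^esub> y) = b \<otimes>\<^bsub>B\<^esub> q i y"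
  using mod_homD(3)[OF q] by simp

lemma alpha_closed [simp]: "a \<in> carrier A \<Longrightarrow> y \<in> carrier P \<Longrightarrow> \<alpha> a y \<in> carrier P"
  using mod_homD(1)[OF alpha_hom] .

lemma alpha_lin: "a \<in> carrier A \<Longrightarrow> b \<in> carrier B \<Longrightarrow> y \<in> carrier P \<Longrightarrow> \<alpha> a (b \<odot>\<^bsub>P\<^esub> y) = b \<odot>\<^bsub>P\<^esub> \<alpha> a y"
  using mod_homD(3)[OF alpha_hom] .

lemma alpha_eqI:
  assumes "a \<in> carrier A" "a' \<in> carrier A" "\<And>y. y \<in> carrier P \<Longrightarrow> \<alpha> a y = \<alpha> a' y"
  shows "a = a'"
  by (rule alpha_inj[OF assms(1,2) mod_hom_eqI[OF alpha_hom alpha_hom]]) (use assms in auto)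

lemma phi:
  assumes b: "b \<in> carrier B"
  shows "phi i l b \<in> carrier A" "y \<in> carrier P \<Longrightarrow> \<alpha> (phi i l b) y = (q i y \<otimes>\<^bsub>B\<^esub> b) \<odot>\<^bsub>P\<^esub> x l"
proof -
  have "(\<lambda>y\<in>carrier P. (q i y \<otimes>\<^bsub>B\<^esub> b) \<odot>\<^bsub>P\<^esub> x l) \<in> mod_hom B P P"
    using b by (intro mod_homI P.left_module_axioms)
      (auto simp: q_add q_smult P.lsmult_l_distr P.lsmult_assoc B.M.l_distr B.M.m_assoc)
  from alpha_surj[OF this] have "\<exists>a. a \<in> carrier A \<and> (\<forall>y\<in>carrier P. \<alpha> a y = (q i y \<otimes>\<^bsub>B\<^esub> b) \<odot>\<^bsub>P\<^esub> x l)"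
    by fastforce
  from someI_ex[OF this]
  show "phi i l b \<in> carrier A" "y \<in> carrier P \<Longrightarrow> \<alpha> (phi i l b) y = (q i y \<otimes>\<^bsub>B\<^esub> b) \<odot>\<^bsub>P\<^esub> x l"
    unfolding phi_def by blast+
qed

lemma alpha_finsum:
  assumes "\<And>k. k \<in> X \<Longrightarrow> a k \<in> carrier A" "y \<in> carrier P"
  shows "\<alpha> (\<Oplus>\<^bsub>A\<^esub>k\<in>X. a k) y = (\<Oplus>\<^bsub>P\<^esub>k\<in>X. \<alpha> (a k) y)"
  using assms
  by (intro additive_finsum[where h = "\<lambda>a. \<alpha> a y"] A.M.abelian_group_axioms P.M.abelian_group_axioms)
    (auto simp: alpha_add)

lemma theta_closed [simp]: "a \<in> carrier A \<Longrightarrow> theta i l a \<in> carrier B"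
  by (simp add: theta_def)

lemma phi_linear: "linear_map K B A (phi i l)"
  unfolding linear_map_def
proof (intro conjI ballI)
  fix b assume b: "b \<in> carrier B"
  show "phi i l b \<in> carrier A" by (rule phi[OF b])
  show "phi i l (b \<oplus>\<^bsub>B\<^esub> b') = phi i l b \<oplus>\<^bsub>A\<^esub> phi i l b'" if "b' \<in> carrier B" for b'
    using b that by (intro alpha_eqI) (auto simp: phi alpha_add B.M.r_distr P.lsmult_l_distr)
  show "phi i l (c \<odot>\<^bsub>B\<^esub> b) = c \<odot>\<^bsub>A\<^esub> phi i l b" if "c \<in> carrier K" for c
    using b that by (intro alpha_eqI)
      (auto simp: phi alpha_smult P.lsmult_assoc[symmetric] B.smult_mult_left B.smult_mult_right)
qed

lemma theta_linear: "linear_map K A B (theta i l)"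
  unfolding linear_map_def
  by (auto simp: theta_def alpha_add q_add alpha_smult q_smult B.smult_mult_left)

text \<open>Elements of \<open>A\<close> are compared as endomorphisms of \<open>P\<close>. The
  composite contains the factor \<open>q k (x k)\<close>, and \<open>generator\<close> adds these up
  to 1.\<close>

lemma phi_mult:
  assumes "b \<in> carrier B" "b' \<in> carrier B"
  shows "(\<Oplus>\<^bsub>A\<^esub>k\<in>I. phi i k b \<otimes>\<^bsub>A\<^esub> phi k l b') = phi i l (b \<otimes>\<^bsub>B\<^esub> b')"
proof (rule alpha_eqI)
  fix y assume y: "y \<in> carrier P"
  have "\<alpha> (\<Oplus>\<^bsub>A\<^esub>k\<in>I. phi i k b \<otimes>\<^bsub>A\<^esub> phi k l b') y =
      (\<Oplus>\<^bsub>P\<^esub>k\<in>I. (q i y \<otimes>\<^bsub>B\<^esub> b \<otimes>\<^bsub>B\<^esub> q k (x k) \<otimes>\<^bsub>B\<^esub> b') \<odot>\<^bsub>P\<^esub> x l)"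
    using assms y
    by (subst alpha_finsum) (auto simp: phi alpha_mult q_smult intro!: P.M.finsum_cong')
  also have "\<dots> = (\<Oplus>\<^bsub>B\<^esub>k\<in>I. q i y \<otimes>\<^bsub>B\<^esub> b \<otimes>\<^bsub>B\<^esub> q k (x k) \<otimes>\<^bsub>B\<^esub> b') \<odot>\<^bsub>P\<^esub> x l"
    using assms y by (intro P.finsum_lsmult[symmetric]) auto
  also have "(\<Oplus>\<^bsub>B\<^esub>k\<in>I. q i y \<otimes>\<^bsub>B\<^esub> b \<otimes>\<^bsub>B\<^esub> q k (x k) \<otimes>\<^bsub>B\<^esub> b') = q i y \<otimes>\<^bsub>B\<^esub> (b \<otimes>\<^bsub>B\<^esub> b')"
    using assms y finite(1) by (simp add: B.M.finsum_ldistr[symmetric] B.M.finsum_rdistr[symmetric] generator B.M.m_assoc)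
  finally show "\<alpha> (\<Oplus>\<^bsub>A\<^esub>k\<in>I. phi i k b \<otimes>\<^bsub>A\<^esub> phi k l b') y = \<alpha> (phi i l (b \<otimes>\<^bsub>B\<^esub> b')) y"
    using assms y by (simp add: phi)
qed (use assms in \<open>auto simp: phi intro!: A.M.finsum_closed\<close>)

text \<open>Moving the scalar \<open>theta i k a\<close> inside \<open>q l\<close> and
  \<open>\<alpha> a'\<close> leaves the expansion of \<open>\<alpha> a (x i)\<close> given by
  \<open>projective\<close>.\<close>

lemma theta_mult:
  assumes "a \<in> carrier A" "a' \<in> carrier A"
  shows "(\<Oplus>\<^bsub>B\<^esub>k\<in>J. theta i k a \<otimes>\<^bsub>B\<^esub> theta k l a') = theta i l (a \<otimes>\<^bsub>A\<^esub> a')"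
proof -
  let ?y = "\<alpha> a (x i)"
  have "(\<Oplus>\<^bsub>B\<^esub>k\<in>J. theta i k a \<otimes>\<^bsub>B\<^esub> theta k l a') = (\<Oplus>\<^bsub>B\<^esub>k\<in>J. q l (\<alpha> a' (q k ?y \<odot>\<^bsub>P\<^esub> x k)))"
    using assms by (intro B.M.finsum_cong') (auto simp: theta_def alpha_lin q_smult)
  also have "\<dots> = q l (\<alpha> a' (\<Oplus>\<^bsub>P\<^esub>k\<in>J. q k ?y \<odot>\<^bsub>P\<^esub> x k))"
    using assms mod_homD(2)[OF alpha_hom[OF assms(2)]]
    by (intro additive_finsum[symmetric, where h = "\<lambda>y. q l (\<alpha> a' y)"] B.M.abelian_group_axioms P.M.abelian_group_axioms)
      (auto simp: q_add)
  finally show ?thesis using assms by (simp add: projective theta_def alpha_mult)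
qed

lemma morita_algebras: "morita_algebras K A B I J phi theta"
proof (intro morita_algebras.intro morita_algebras_axioms.intro morita_data.intro morita_data_axioms.intro
    enveloping_setup.intro A.k_algebra_axioms B.k_algebra_axioms phi_linear theta_linear
    A.M.ring_axioms B.M.ring_axioms finite)
  show "phi i l (theta k j a) = phi i k \<one>\<^bsub>B\<^esub> \<otimes>\<^bsub>A\<^esub> a \<otimes>\<^bsub>A\<^esub> phi j l \<one>\<^bsub>B\<^esub>" if a: "a \<in> carrier A" for a i l k j
    using a by (intro alpha_eqI) (auto simp: phi alpha_mult theta_def alpha_lin q_smult P.lsmult_assoc)
  show "theta k j (phi i l b) = theta k i \<one>\<^bsub>A\<^esub> \<otimes>\<^bsub>B\<^esub> b \<otimes>\<^bsub>B\<^esub> theta l j \<one>\<^bsub>A\<^esub>" if b: "b \<in> carrier B" for b i l k j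
    using b by (simp add: theta_def phi alpha_one q_smult)
  show "(\<Oplus>\<^bsub>B\<^esub>k\<in>I. theta k k \<one>\<^bsub>A\<^esub>) = \<one>\<^bsub>B\<^esub>"
    by (simp add: theta_def alpha_one generator)
  show "(\<Oplus>\<^bsub>A\<^esub>k\<in>J. phi k k \<one>\<^bsub>B\<^esub>) = \<one>\<^bsub>A\<^esub>"
    by (rule alpha_eqI) (auto simp: phi alpha_finsum alpha_one projective intro!: A.M.finsum_closed)
qed (auto simp: linear_mapD[OF phi_linear] linear_mapD[OF theta_linear] phi_mult theta_mult)

end

section \<open>Trace ideals\<close>

text \<open>Adding one value of a functional at a time gives closure properties by induction,
  without reindexing; \<open>trace_sum\<close> recovers finite families from it.\<close>

inductive_set trace :: "('r, 'x) ring_scheme \<Rightarrow> ('r, 'm, 'y) module_scheme \<Rightarrow> 'r set"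
  for R and M where
    zero: "\<zero>\<^bsub>R\<^esub> \<in> trace R M"
  | add: "\<lbrakk>z \<in> trace R M; q \<in> mod_hom R M (reg R); x \<in> carrier M\<rbrakk> \<Longrightarrow> z \<oplus>\<^bsub>R\<^esub> q x \<in> trace R M"

context left_module
begin

lemma trace_closed: "z \<in> trace R M \<Longrightarrow> z \<in> carrier R"
  by (induction rule: trace.induct) (use mod_homD(1)[of _ R M "reg R"] in auto)

lemma trace_add: "z \<in> trace R M \<Longrightarrow> z' \<in> trace R M \<Longrightarrow> z' \<oplus> z \<in> trace R M"
proof (induction rule: trace.induct)
  case zero then show ?case using trace_closed by simp
next
  case (add z q x)
  have "(z' \<oplus> z) \<oplus> q x \<in> trace R M" by (rule trace.add) (use add in auto)
  then show ?case using add trace_closed mod_homD(1)[OF add(2,3)] by (simp add: R.a_assoc)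
qed

lemma trace_mem: "q \<in> mod_hom R M (reg R) \<Longrightarrow> x \<in> carrier M \<Longrightarrow> q x \<in> trace R M"
  using trace.add[OF trace.zero, of q R M x] mod_homD(1)[of q R M "reg R" x] by simp

lemma trace_mult: "z \<in> trace R M \<Longrightarrow> r \<in> carrier R \<Longrightarrow> r \<otimes> z \<in> trace R M"
proof (induction rule: trace.induct)
  case (add z q x)
  have "r \<otimes> z \<oplus> q (r \<odot>\<^bsub>M\<^esub> x) \<in> trace R M" by (rule trace.add) (use add in auto)
  then show ?case using add trace_closed mod_homD(1)[OF add(2,3)] by (simp add: R.r_distr mod_homD(3)[OF add(2)])
qed (simp add: trace.zero)

lemma trace_sum:
  assumes "z \<in> trace R M"
  shows "\<exists>(n :: nat) q x. (\<forall>i. q i \<in> mod_hom R M (reg R)) \<and> (\<forall>i. x i \<in> carrier M) \<and>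
    z = (\<Oplus>i\<in>{..<n}. q i (x i))"
  using assms
proof (induction rule: trace.induct)
  case zero
  \<comment> \<open>The families in the statement are total, so even the empty sum must supply some
    functional; the zero map serves.\<close>
  define w where "w = (\<lambda>x\<in>carrier M. \<zero>)"
  have "w \<in> mod_hom R M (reg R)"
    unfolding w_def by (intro mod_homI left_module_axioms) auto
  then show ?case
    by (intro exI[of _ 0] exI[of _ "\<lambda>i. w"] exI[of _ "\<lambda>i. \<zero>\<^bsub>M\<^esub>"]) auto
next
  case (add z q x)
  then obtain n :: nat and q' x' where n: "\<And>i. q' i \<in> mod_hom R M (reg R)" "\<And>i. x' i \<in> carrier M"
    "z = (\<Oplus>i\<in>{..<n}. q' i (x' i))" by blast
  have c: "p y \<in> carrier R" if "p \<in> mod_hom R M (reg R)" "y \<in> carrier M" for p y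
    using mod_homD(1)[OF that] by simp
  let ?q = "q'(n := q)" and ?x = "x'(n := x)"
  have "(\<Oplus>i\<in>{..<Suc n}. ?q i (?x i)) = ?q n (?x n) \<oplus> (\<Oplus>i\<in>{..<n}. ?q i (?x i))"
    using n add c unfolding lessThan_Suc by (intro R.finsum_insert) auto
  also have "(\<Oplus>i\<in>{..<n}. ?q i (?x i)) = z"
    unfolding n(3) using n c by (intro R.finsum_cong') auto
  finally have "z \<oplus> q x = (\<Oplus>i\<in>{..<Suc n}. ?q i (?x i))"
    using add trace_closed c by (simp add: R.a_comm)
  then show ?case using n(1,2) add(2,3)
    by (intro exI[of _ "Suc n"] exI[of _ ?q] exI[of _ ?x]) auto
qed

text \<open>\<open>N\<close> is the quotient of the regular module by the trace ideal, realized on \<^typ>\<open>'u\<close> by a choice of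
  representatives.\<close>

lemma trace_quotient:
  fixes i :: "'r \<Rightarrow> 'u"
  assumes i: "inj_on i (carrier R)" and one: "\<one> \<notin> trace R M"
  shows "\<exists>(N :: ('r, 'u) module) \<pi>. left_module R N \<and> \<pi> \<in> mod_hom R (reg R) N \<and>
    (\<forall>z\<in>trace R M. \<pi> z = \<zero>\<^bsub>N\<^esub>) \<and> \<pi> \<one> \<noteq> \<zero>\<^bsub>N\<^esub>"
proof -
  interpret L: left_module R "reg R" by (rule left_module_reg[OF R.ring_axioms])
  let ?t = "trace R M"
  define rep where "rep b = (SOME b'. b' \<in> carrier R \<and> b' \<ominus> b \<in> ?t)" for b
  have neg: "\<ominus> z \<in> ?t" if "z \<in> ?t" for z
    using trace_mult[OF that, of "\<ominus> \<one>"] trace_closed[OF that] by (simp add: R.l_minus)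
  have rep: "rep b \<in> carrier R" "rep b \<ominus> b \<in> ?t" if "b \<in> carrier R" for b
  proof -
    have "\<exists>b'. b' \<in> carrier R \<and> b' \<ominus> b \<in> ?t"
      using that trace.zero[of R M] by (intro exI[of _ b]) (simp add: R.minus_eq R.r_neg)
    from someI_ex[OF this] show "rep b \<in> carrier R" "rep b \<ominus> b \<in> ?t" unfolding rep_def by auto
  qed
  have cancel: "x \<ominus> z = (x \<ominus> y) \<oplus> (y \<ominus> z)" if "x \<in> carrier R" "y \<in> carrier R" "z \<in> carrier R" for x y z
    using that by (simp add: R.minus_eq R.a_assoc R.r_neg1)
  have inv: "y \<ominus> x \<in> ?t" if "x \<ominus> y \<in> ?t" "x \<in> carrier R" "y \<in> carrier R" for x y
  proof -
    have "\<ominus> (x \<ominus> y) = y \<ominus> x" using that(2,3) by (simp add: R.minus_eq R.minus_add R.a_comm)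
    then show ?thesis using neg[OF that(1)] by simp
  qed
  have rep_eq: "rep b = rep b' \<longleftrightarrow> b \<ominus> b' \<in> ?t" if b: "b \<in> carrier R" "b' \<in> carrier R" for b b'
  proof
    assume "rep b = rep b'"
    then show "b \<ominus> b' \<in> ?t"
      using cancel[of b "rep b" b'] inv[OF rep(2)[OF b(1)]] rep b by (auto intro: trace_add)
  next
    assume d: "b \<ominus> b' \<in> ?t"
    have "c \<ominus> b \<in> ?t \<longleftrightarrow> c \<ominus> b' \<in> ?t" if "c \<in> carrier R" for c
      using cancel[OF that b(1,2)] cancel[OF that b(2,1)] trace_add[OF d, of "c \<ominus> b"]
        trace_add[OF inv[OF d b], of "c \<ominus> b'"] by auto
    then have "(\<lambda>c. c \<in> carrier R \<and> c \<ominus> b \<in> ?t) = (\<lambda>c. c \<in> carrier R \<and> c \<ominus> b' \<in> ?t)" by blast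
    then show "rep b = rep b'" unfolding rep_def by simp
  qed
  define c where "c b = i (rep b)" for b
  have c_eq: "c b = c b' \<longleftrightarrow> b \<ominus> b' \<in> ?t" if "b \<in> carrier R" "b' \<in> carrier R" for b b'
    using that rep_eq[OF that] rep(1) inj_on_eq_iff[OF i] by (simp add: c_def)
  have add: "c (x \<oplus>\<^bsub>reg R\<^esub> y) = c (x' \<oplus>\<^bsub>reg R\<^esub> y')"
    if a: "x \<in> carrier (reg R)" "y \<in> carrier (reg R)" "x' \<in> carrier (reg R)" "y' \<in> carrier (reg R)"
      "c x = c x'" "c y = c y'" for x y x' y'
  proof -
    have "(x \<oplus> y) \<ominus> (x' \<oplus> y') = (x \<ominus> x') \<oplus> (y \<ominus> y')"
      using a by (simp add: R.minus_eq R.minus_add R.a_ac)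
    then show ?thesis using a trace_add[of "y \<ominus> y'" "x \<ominus> x'"] by (simp add: c_eq)
  qed
  have smult: "c (r \<odot>\<^bsub>reg R\<^esub> x) = c (r \<odot>\<^bsub>reg R\<^esub> x')"
    if a: "r \<in> carrier R" "x \<in> carrier (reg R)" "x' \<in> carrier (reg R)" "c x = c x'" for r x x'
  proof -
    have "(r \<otimes> x) \<ominus> (r \<otimes> x') = r \<otimes> (x \<ominus> x')"
      using a by (simp add: R.minus_eq R.r_distr R.r_minus)
    then show ?thesis using a trace_mult[of "x \<ominus> x'" r] by (simp add: c_eq)
  qed
  have z: "c z = \<zero>\<^bsub>image_module c (reg R)\<^esub> \<longleftrightarrow> z \<in> ?t" if "z \<in> carrier R" for z
    using that by (simp add: c_eq R.minus_eq image_module_def)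
  show ?thesis
  proof (intro exI conjI ballI)
    show "left_module R (image_module c (reg R))" by (rule L.image_module(1)[OF add smult])
    show "(\<lambda>x\<in>carrier (reg R). c x) \<in> mod_hom R (reg R) (image_module c (reg R))"
      by (rule L.image_module(2)[OF add smult])
    show "(\<lambda>x\<in>carrier (reg R). c x) y = \<zero>\<^bsub>image_module c (reg R)\<^esub>" if "y \<in> ?t" for y
      using z[of y] trace_closed[OF that] that by simp
    show "(\<lambda>x\<in>carrier (reg R). c x) \<one> \<noteq> \<zero>\<^bsub>image_module c (reg R)\<^esub>"
      using z[of \<one>] one by simp
  qed
qed

end

section \<open>Equivalences of module categories\<close>

lemma mod_isoD:
  assumes "f \<in> mod_iso R M N"
  shows "f \<in> mod_hom R M N" "inj_on f (carrier M)" "f ` carrier M = carrier N"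
proof -
  obtain g where f: "f \<in> mod_hom R M N" and g: "g \<in> mod_hom R N M"
    and c: "compose (carrier M) g f = mod_id M" "compose (carrier N) f g = mod_id N"
    using assms by (auto simp: mod_iso_def)
  have 1: "g (f x) = x" if "x \<in> carrier M" for x using fun_cong[OF c(1), of x] that by (simp add: compose_def mod_id_def)
  have 2: "f (g x) = x" if "x \<in> carrier N" for x using fun_cong[OF c(2), of x] that by (simp add: compose_def mod_id_def)
  show "f \<in> mod_hom R M N" by (rule f)
  show "inj_on f (carrier M)" using 1 by (rule inj_on_inverseI)
  show "f ` carrier M = carrier N"
    using 2 mod_homD(1)[OF f] mod_homD(1)[OF g] by (metis image_subsetI subsetI subset_antisym image_eqI)
qed

lemma mod_iso_inverse:
  assumes f: "f \<in> mod_iso R M N" and M: "left_module R M" and N: "left_module R N"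
  obtains g where "g \<in> mod_hom R N M" "\<And>x. x \<in> carrier M \<Longrightarrow> g (f x) = x" "\<And>y. y \<in> carrier N \<Longrightarrow> f (g y) = y"
proof
  note f' = mod_isoD[OF f]
  let ?g = "\<lambda>y\<in>carrier N. inv_into (carrier M) f y"
  show "?g \<in> mod_hom R N M" by (rule mod_hom_inv_into[OF f' M N])
  show "?g (f x) = x" if "x \<in> carrier M" for x using that f'(2) mod_homD(1)[OF f'(1)] by simp
  show "f (?g y) = y" if "y \<in> carrier N" for y using that f'(3) by (simp add: f_inv_into_f)
qed

lemma mod_hom_zero_map: "left_module T M \<Longrightarrow> left_module T N \<Longrightarrow> (\<lambda>x\<in>carrier M. \<zero>\<^bsub>N\<^esub>) \<in> mod_hom T M N"
proof -
  assume "left_module T M" "left_module T N"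
  then interpret N: left_module T N by simp
  show ?thesis by (rule mod_homI[OF _ _ _ \<open>left_module T M\<close>]) auto
qed

lemma hom_add_mod_hom:
  assumes M: "left_module T M" and N: "left_module T N" and f: "f \<in> mod_hom T M N" and g: "g \<in> mod_hom T M N"
  shows "hom_add M N f g \<in> mod_hom T M N"
proof -
  interpret N: left_module T N by fact
  show ?thesis unfolding hom_add_def using mod_homD[OF f] mod_homD[OF g]
    by (intro mod_homI[OF _ _ _ M]) (auto simp: N.lsmult_r_distr N.M.a_ac)
qed

locale full_embedding = R: ring R + S: ring S
  for R :: "('r, 'x) ring_scheme" and S :: "('s, 'y) ring_scheme" and F :: "('r, 's, 'u) mod_functor" +
  assumes functorial: "is_functor R S F"
    and additive: "\<lbrakk>left_module R M; left_module R N; f \<in> mod_hom R M N; g \<in> mod_hom R M N\<rbrakk> \<Longrightarrow>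
      arr_map F M N (hom_add M N f g) = hom_add (obj_map F M) (obj_map F N) (arr_map F M N f) (arr_map F M N g)"
    and faithful: "\<lbrakk>left_module R M; left_module R N; f \<in> mod_hom R M N; g \<in> mod_hom R M N;
      arr_map F M N f = arr_map F M N g\<rbrakk> \<Longrightarrow> f = g"
    and full: "\<lbrakk>left_module R M; left_module R N; h \<in> mod_hom S (obj_map F M) (obj_map F N)\<rbrakk> \<Longrightarrow>
      \<exists>f\<in>mod_hom R M N. arr_map F M N f = h"
begin

lemma obj: "left_module R M \<Longrightarrow> left_module S (obj_map F M)"
  using functorial by (simp add: is_functor_def Mod_obj_def)

lemma arr: "\<lbrakk>left_module R M; left_module R N; f \<in> mod_hom R M N\<rbrakk> \<Longrightarrow>
    arr_map F M N f \<in> mod_hom S (obj_map F M) (obj_map F N)"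
  using functorial by (simp add: is_functor_def Mod_obj_def)

lemma arr_id: "left_module R M \<Longrightarrow> arr_map F M M (mod_id M) = mod_id (obj_map F M)"
  using functorial by (simp add: is_functor_def Mod_obj_def)

lemma arr_comp: "\<lbrakk>left_module R L; left_module R M; left_module R N; f \<in> mod_hom R L M; g \<in> mod_hom R M N;
      y \<in> carrier (obj_map F L)\<rbrakk> \<Longrightarrow>
    arr_map F L N (compose (carrier L) g f) y = arr_map F M N g (arr_map F L M f y)"
  using functorial by (simp add: is_functor_def Mod_obj_def compose_def)

text \<open>The zero map is equal to its own double, so by additivity the same holds for its image
  under \<open>F\<close>, which forces the image to vanish.\<close>

lemma arr_zero:
  assumes M: "left_module R M" and N: "left_module R N"
  shows "arr_map F M N (\<lambda>x\<in>carrier M. \<zero>\<^bsub>N\<^esub>) = (\<lambda>x\<in>carrier (obj_map F M). \<zero>\<^bsub>obj_map F N\<^esub>)"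
proof -
  interpret N: left_module R N by fact
  interpret FN: left_module S "obj_map F N" by (rule obj[OF N])
  let ?z = "\<lambda>x\<in>carrier M. \<zero>\<^bsub>N\<^esub>"
  have h: "arr_map F M N ?z \<in> mod_hom S (obj_map F M) (obj_map F N)" by (intro arr M N mod_hom_zero_map)
  have "hom_add M N ?z ?z = ?z" by (auto simp: hom_add_def intro!: restrict_ext)
  then have "arr_map F M N ?z = hom_add (obj_map F M) (obj_map F N) (arr_map F M N ?z) (arr_map F M N ?z)"
    using additive[OF M N mod_hom_zero_map[OF M N] mod_hom_zero_map[OF M N]] by simp
  note w = this
  have e: "arr_map F M N ?z y = arr_map F M N ?z y \<oplus>\<^bsub>obj_map F N\<^esub> arr_map F M N ?z y" if y: "y \<in> carrier (obj_map F M)" for y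
  proof -
    have "arr_map F M N ?z y = hom_add (obj_map F M) (obj_map F N) (arr_map F M N ?z) (arr_map F M N ?z) y"
      by (rule fun_cong[OF w])
    also have "\<dots> = arr_map F M N ?z y \<oplus>\<^bsub>obj_map F N\<^esub> arr_map F M N ?z y"
      using y by (simp add: hom_add_def)
    finally show ?thesis .
  qed
  show ?thesis
  proof (rule mod_hom_eqI[OF h mod_hom_zero_map[OF obj[OF M] obj[OF N]]])
    fix y assume y: "y \<in> carrier (obj_map F M)"
    show "arr_map F M N ?z y = (\<lambda>x\<in>carrier (obj_map F M). \<zero>\<^bsub>obj_map F N\<^esub>) y"
      using FN.M.add.l_cancel_one'[OF mod_homD(1)[OF h y] mod_homD(1)[OF h y], THEN iffD1, OF e[OF y]] y by simp
  qed
qed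

lemma zero_if_arr_zero:
  assumes M: "left_module R M" and N: "left_module R N" and f: "f \<in> mod_hom R M N"
    and z: "\<And>y. y \<in> carrier (obj_map F M) \<Longrightarrow> arr_map F M N f y = \<zero>\<^bsub>obj_map F N\<^esub>" and x: "x \<in> carrier M"
  shows "f x = \<zero>\<^bsub>N\<^esub>"
proof -
  have "f = (\<lambda>x\<in>carrier M. \<zero>\<^bsub>N\<^esub>)"
  proof (rule faithful[OF M N f mod_hom_zero_map[OF M N]])
    show "arr_map F M N f = arr_map F M N (\<lambda>x\<in>carrier M. \<zero>\<^bsub>N\<^esub>)"
      unfolding arr_zero[OF M N]
      by (rule mod_hom_eqI[OF arr[OF M N f] mod_hom_zero_map[OF obj[OF M] obj[OF N]]]) (use z in auto)
  qed
  then show ?thesis using x by simp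
qed

text \<open>\<open>F\<close> respects the binary \<open>hom_add\<close>, so finite sums need an
  induction on \<open>n\<close>. The second conjunct is what allows additivity to be applied in the
  inductive step.\<close>

lemma arr_sum:
  assumes M: "left_module R M" and N: "left_module R N" and f: "\<And>j. f j \<in> mod_hom R M N"
    and y: "y \<in> carrier (obj_map F M)"
  shows "arr_map F M N (\<lambda>x\<in>carrier M. \<Oplus>\<^bsub>N\<^esub>j\<in>{..<n::nat}. f j x) y = (\<Oplus>\<^bsub>obj_map F N\<^esub>j\<in>{..<n}. arr_map F M N (f j) y)
    \<and> (\<lambda>x\<in>carrier M. \<Oplus>\<^bsub>N\<^esub>j\<in>{..<n}. f j x) \<in> mod_hom R M N"
proof -
  interpret N: left_module R N by fact
  interpret FN: left_module S "obj_map F N" by (rule obj[OF N])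
  define s where "s n = (\<lambda>x\<in>carrier M. \<Oplus>\<^bsub>N\<^esub>j\<in>{..<n}. f j x)" for n :: nat
  have s_0: "s 0 = (\<lambda>x\<in>carrier M. \<zero>\<^bsub>N\<^esub>)" by (simp add: s_def)
  have s_Suc: "s (Suc n) = hom_add M N (f n) (s n)" for n
    unfolding s_def using mod_homD(1)[OF f] by (auto simp: hom_add_def lessThan_Suc intro!: restrict_ext)
  have "arr_map F M N (s n) y = (\<Oplus>\<^bsub>obj_map F N\<^esub>j\<in>{..<n}. arr_map F M N (f j) y) \<and> s n \<in> mod_hom R M N"
  proof (induction n)
    case 0
    show ?case unfolding s_0 arr_zero[OF M N] using y by (intro conjI mod_hom_zero_map M N) simp
  next
    case (Suc n)
    then show ?case
      unfolding s_Suc using hom_add_mod_hom[OF M N f] additive[OF M N f] y mod_homD(1)[OF arr[OF M N f] y]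
      by (simp add: hom_add_def[of "obj_map F M"] lessThan_Suc)
  qed
  then show ?thesis unfolding s_def .
qed

end

text \<open>Naturality of \<open>\<eta>\<close> makes \<open>F\<close> faithful, and naturality of
  \<open>\<epsilon>\<close> makes the quasi-inverse \<open>G\<close> faithful. For fullness,
  \<open>G h\<close> is conjugated by \<open>\<eta>\<close> to a map \<open>f\<close>; then
  \<open>G\<close> takes the same value on \<open>F f\<close> and on \<open>h\<close>, and
  faithfulness of \<open>G\<close> gives \<open>F f = h\<close>. A preimage of \<open>N\<close> up
  to isomorphism is \<open>G N\<close>.\<close>

lemma equivalence_full_embedding:
  fixes F :: "('r, 's, 'u) mod_functor" and N :: "('s, 'u) module"
  assumes R: "ring R" and S: "ring S" and eq: "is_equivalence R S F"
    and additive: "\<And>M N f g. \<lbrakk>left_module R M; left_module R N; f \<in> mod_hom R M N; g \<in> mod_hom R M N\<rbrakk> \<Longrightarrow>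
      arr_map F M N (hom_add M N f g) = hom_add (obj_map F M) (obj_map F N) (arr_map F M N f) (arr_map F M N g)"
  shows "full_embedding R S F"
    and "left_module S N \<Longrightarrow> \<exists>M e. left_module R M \<and> e \<in> mod_iso S (obj_map F M) N"
proof -
  obtain G :: "('s, 'r, 'u) mod_functor" where F: "is_functor R S F" and G: "is_functor S R G"
    and nG: "naturally_isomorphic R R id_functor (comp_functor G F)"
    and nF: "naturally_isomorphic S S (comp_functor F G) id_functor"
    using eq by (auto simp: is_equivalence_def)
  obtain \<eta> where
    \<eta>: "\<forall>M\<in>Mod_obj R. \<eta> M \<in> mod_iso R (obj_map id_functor M) (obj_map (comp_functor G F) M)"
      "\<forall>M\<in>Mod_obj R. \<forall>N\<in>Mod_obj R. \<forall>f\<in>mod_hom R M N.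
        compose (carrier (obj_map id_functor M)) (\<eta> N) (arr_map id_functor M N f) =
        compose (carrier (obj_map id_functor M)) (arr_map (comp_functor G F) M N f) (\<eta> M)"
    using nG unfolding naturally_isomorphic_def by (elim exE conjE) (rule that)
  have eta: "\<eta> M \<in> mod_iso R M (obj_map G (obj_map F M))" if "left_module R M" for M
    using \<eta>(1) that by (simp add: Mod_obj_def id_functor_def comp_functor_def)
  have eta_nat: "compose (carrier M) (\<eta> N) f =
      compose (carrier M) (arr_map G (obj_map F M) (obj_map F N) (arr_map F M N f)) (\<eta> M)"
    if "left_module R M" "left_module R N" "f \<in> mod_hom R M N" for M N f
    using \<eta>(2) that by (simp add: Mod_obj_def id_functor_def comp_functor_def)
  obtain \<epsilon> where
    \<epsilon>: "\<forall>M\<in>Mod_obj S. \<epsilon> M \<in> mod_iso S (obj_map (comp_functor F G) M) (obj_map id_functor M)"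
      "\<forall>M\<in>Mod_obj S. \<forall>N\<in>Mod_obj S. \<forall>f\<in>mod_hom S M N.
        compose (carrier (obj_map (comp_functor F G) M)) (\<epsilon> N) (arr_map (comp_functor F G) M N f) =
        compose (carrier (obj_map (comp_functor F G) M)) (arr_map id_functor M N f) (\<epsilon> M)"
    using nF unfolding naturally_isomorphic_def by (elim exE conjE) (rule that)
  have eps: "\<epsilon> M \<in> mod_iso S (obj_map F (obj_map G M)) M" if "left_module S M" for M
    using \<epsilon>(1) that by (simp add: Mod_obj_def id_functor_def comp_functor_def)
  have eps_nat: "compose (carrier (obj_map F (obj_map G M))) (\<epsilon> N) (arr_map F (obj_map G M) (obj_map G N) (arr_map G M N f)) =
      compose (carrier (obj_map F (obj_map G M))) f (\<epsilon> M)"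
    if "left_module S M" "left_module S N" "f \<in> mod_hom S M N" for M N f
    using \<epsilon>(2) that by (simp add: Mod_obj_def id_functor_def comp_functor_def)
  have Fobj: "left_module S (obj_map F M)" if "left_module R M" for M using F that by (simp add: is_functor_def Mod_obj_def)
  have Gobj: "left_module R (obj_map G M)" if "left_module S M" for M using G that by (simp add: is_functor_def Mod_obj_def)
  have Farr: "arr_map F M N f \<in> mod_hom S (obj_map F M) (obj_map F N)"
    if "left_module R M" "left_module R N" "f \<in> mod_hom R M N" for M N f
    using F that by (simp add: is_functor_def Mod_obj_def)
  have Garr: "arr_map G M N f \<in> mod_hom R (obj_map G M) (obj_map G N)"
    if "left_module S M" "left_module S N" "f \<in> mod_hom S M N" for M N f
    using G that by (simp add: is_functor_def Mod_obj_def)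
  have eta_nat': "\<eta> N (f x) = arr_map G (obj_map F M) (obj_map F N) (arr_map F M N f) (\<eta> M x)"
    if "left_module R M" "left_module R N" "f \<in> mod_hom R M N" "x \<in> carrier M" for M N f x
    using fun_cong[OF eta_nat[OF that(1-3)], of x] that(4) by (simp add: compose_def)
  have eps_nat': "\<epsilon> N (arr_map F (obj_map G M) (obj_map G N) (arr_map G M N f) y) = f (\<epsilon> M y)"
    if "left_module S M" "left_module S N" "f \<in> mod_hom S M N" "y \<in> carrier (obj_map F (obj_map G M))" for M N f y
    using fun_cong[OF eps_nat[OF that(1-3)], of y] that(4) by (simp add: compose_def)
  have faithful: "f = g" if M: "left_module R M" and N: "left_module R N" and f: "f \<in> mod_hom R M N" and g: "g \<in> mod_hom R M N"
    and e: "arr_map F M N f = arr_map F M N g" for M N f g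
  proof (rule mod_hom_eqI[OF f g])
    fix x assume x: "x \<in> carrier M"
    have "\<eta> N (f x) = \<eta> N (g x)" unfolding eta_nat'[OF M N f x] eta_nat'[OF M N g x] e ..
    then show "f x = g x" using mod_isoD(2)[OF eta[OF N]] mod_homD(1)[OF f x] mod_homD(1)[OF g x] by (auto dest: inj_onD)
  qed
  have Gfaithful: "f = g" if M: "left_module S M" and N: "left_module S N" and f: "f \<in> mod_hom S M N" and g: "g \<in> mod_hom S M N"
    and e: "arr_map G M N f = arr_map G M N g" for M N f g
  proof (rule mod_hom_eqI[OF f g])
    fix x assume "x \<in> carrier M"
    then obtain y where y: "y \<in> carrier (obj_map F (obj_map G M))" "x = \<epsilon> M y" using mod_isoD(3)[OF eps[OF M]] by auto
    show "f x = g x" unfolding y(2) eps_nat'[OF M N f y(1), symmetric] eps_nat'[OF M N g y(1), symmetric] e ..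
  qed
  have full: "\<exists>f\<in>mod_hom R M N. arr_map F M N f = h"
    if M: "left_module R M" and N: "left_module R N" and h: "h \<in> mod_hom S (obj_map F M) (obj_map F N)" for M N h
  proof -
    let ?GM = "obj_map G (obj_map F M)" and ?GN = "obj_map G (obj_map F N)"
    let ?Gh = "arr_map G (obj_map F M) (obj_map F N) h"
    obtain g where g: "g \<in> mod_hom R ?GN N" "\<And>y. y \<in> carrier ?GN \<Longrightarrow> \<eta> N (g y) = y"
      using mod_iso_inverse[OF eta[OF N] N Gobj[OF Fobj[OF N]]] by metis
    note Gh = Garr[OF Fobj[OF M] Fobj[OF N] h]
    note em = mod_isoD[OF eta[OF M]]
    define f where "f = compose (carrier M) g (compose (carrier M) ?Gh (\<eta> M))"
    have f: "f \<in> mod_hom R M N" unfolding f_def by (intro mod_hom_comp[OF mod_hom_comp[OF em(1) Gh M] g(1) M])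
    have "arr_map G (obj_map F M) (obj_map F N) (arr_map F M N f) = ?Gh"
    proof (rule mod_hom_eqI[OF Garr[OF Fobj[OF M] Fobj[OF N] Farr[OF M N f]] Gh])
      fix z assume "z \<in> carrier ?GM"
      then obtain x where x: "x \<in> carrier M" "z = \<eta> M x" using em(3) by auto
      show "arr_map G (obj_map F M) (obj_map F N) (arr_map F M N f) z = ?Gh z"
        unfolding x(2) eta_nat'[OF M N f x(1), symmetric]
        using x g(2) mod_homD(1)[OF Gh] mod_homD(1)[OF em(1)] by (simp add: f_def compose_def)
    qed
    then have "arr_map F M N f = h" by (rule Gfaithful[OF Fobj[OF M] Fobj[OF N] Farr[OF M N f] h])
    then show ?thesis using f by blast
  qed
  show "full_embedding R S F"
    by (intro full_embedding.intro full_embedding_axioms.intro R S F) (use additive faithful full in auto)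
  show "\<exists>M e. left_module R M \<and> e \<in> mod_iso S (obj_map F M) N" if "left_module S N"
    using eps[OF that] Gobj[OF that] by blast
qed

text \<open>Let \<open>Q\<close> be a preimage of the regular \<open>B\<close>-module. If the trace ideal of \<open>P\<close> in \<open>B\<close> were proper,
  the nonzero projection of \<open>B\<close> onto the quotient would vanish on all images of \<open>P\<close>, which faithfulness
  excludes; this makes \<open>P\<close> a generator. The same argument for \<open>Q\<close> and \<open>A\<close> makes \<open>P\<close> finitely
  generated projective.\<close>

lemma equivalence_progenerator:
  fixes K :: "('k, 'x) ring_scheme" and A :: "('k, 'a, 'y) module_scheme" and B :: "('k, 'b, 'z) module_scheme"
    and F :: "('a, 'b, 'u) mod_functor" and iA :: "'a \<Rightarrow> 'u" and iB :: "'b \<Rightarrow> 'u"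
  assumes A: "k_algebra K A" and B: "k_algebra K B" and iA: "inj_on iA (carrier A)" and iB: "inj_on iB (carrier B)"
    and eq: "is_equivalence A B F" and lin: "k_linear_functor K A B F"
  shows "\<exists>(P :: ('b, 'u) module) \<alpha> (I :: (nat + nat) set) J q x. progenerator K A B P \<alpha> I J q x"
proof -
  interpret A: k_algebra K A by fact
  interpret B: k_algebra K B by fact
  have add: "arr_map F M N (hom_add M N f g) = hom_add (obj_map F M) (obj_map F N) (arr_map F M N f) (arr_map F M N g)"
    if "left_module A M" "left_module A N" "f \<in> mod_hom A M N" "g \<in> mod_hom A M N" for M N f g
    using lin that by (simp add: k_linear_functor_def Mod_obj_def)
  have scale: "arr_map F M N (hom_scale A M N c f) = hom_scale B (obj_map F M) (obj_map F N) c (arr_map F M N f)"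
    if "left_module A M" "left_module A N" "f \<in> mod_hom A M N" "c \<in> carrier K" for M N f c
    using lin that by (simp add: k_linear_functor_def Mod_obj_def)
  interpret F: full_embedding A B F
    by (rule equivalence_full_embedding(1)[OF A.M.ring_axioms B.M.ring_axioms eq add])
  note ess = equivalence_full_embedding(2)[OF A.M.ring_axioms B.M.ring_axioms eq add]
  have lA: "left_module A (reg A)" by (rule left_module_reg[OF A.M.ring_axioms])
  have lB: "left_module B (reg B)" by (rule left_module_reg[OF B.M.ring_axioms])
  \<comment> \<open>\<open>F\<close> acts only on modules with carrier in \<open>'u\<close>. So
    \<open>U\<close> and \<open>V\<close> are copies of the regular modules there, with mutually
    inverse isomorphisms \<open>\<iota>A\<close>, \<open>\<kappa>A\<close> and
    \<open>\<iota>B\<close>, \<open>\<kappa>B\<close>.\<close>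
  define U where "U = image_module iA (reg A)"
  define V where "V = image_module iB (reg B)"
  define \<iota>A where "\<iota>A = (\<lambda>x\<in>carrier A. iA x)"
  define \<iota>B where "\<iota>B = (\<lambda>x\<in>carrier B. iB x)"
  define \<kappa>A where "\<kappa>A = (\<lambda>y\<in>carrier U. inv_into (carrier A) iA y)"
  define \<kappa>B where "\<kappa>B = (\<lambda>y\<in>carrier V. inv_into (carrier B) iB y)"
  have cU: "carrier U = iA ` carrier A" and cV: "carrier V = iB ` carrier B" by (auto simp: U_def V_def image_module_def)
  have lU: "left_module A U" and iota_A: "\<iota>A \<in> mod_hom A (reg A) U" and kappa_A: "\<kappa>A \<in> mod_hom A U (reg A)"
    using image_module_inj[OF lA, of iA] iA by (simp_all add: U_def[symmetric] \<iota>A_def \<kappa>A_def cU)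
  have lV: "left_module B V" and iota_B: "\<iota>B \<in> mod_hom B (reg B) V" and kappa_B: "\<kappa>B \<in> mod_hom B V (reg B)"
    using image_module_inj[OF lB, of iB] iB by (simp_all add: V_def[symmetric] \<iota>B_def \<kappa>B_def cV)
  have ki_A: "\<kappa>A (\<iota>A a) = a" if "a \<in> carrier A" for a using that iA by (simp add: \<kappa>A_def \<iota>A_def cU)
  have ik_A: "\<iota>A (\<kappa>A u) = u" if "u \<in> carrier U" for u
    using that iA by (auto simp: \<kappa>A_def \<iota>A_def cU)
  have ki_B: "\<kappa>B (\<iota>B b) = b" if "b \<in> carrier B" for b using that iB by (simp add: \<kappa>B_def \<iota>B_def cV)
  have ik_B: "\<iota>B (\<kappa>B v) = v" if "v \<in> carrier V" for v
    using that iB by (auto simp: \<kappa>B_def \<iota>B_def cV)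
  note iota_A' = mod_homD[OF iota_A, unfolded reg_simps] and iota_B' = mod_homD[OF iota_B, unfolded reg_simps]
    and kappa_A' = mod_homD[OF kappa_A, unfolded reg_simps] and kappa_B' = mod_homD[OF kappa_B, unfolded reg_simps]
  interpret U: left_module A U by (rule lU)
  interpret V: left_module B V by (rule lV)
  define P where "P = obj_map F U"
  have lP: "left_module B P" unfolding P_def by (rule F.obj[OF lU])
  interpret P: left_module B P by (rule lP)
  obtain Q e where lQ: "left_module A Q" and e: "e \<in> mod_iso B (obj_map F Q) V" using ess[OF _ _ _ _ lV] by blast
  interpret Q: left_module A Q by (rule lQ)
  note lFQ = F.obj[OF lQ]
  interpret FQ: left_module B "obj_map F Q" by (rule lFQ)
  note eh = mod_isoD[OF e]
  obtain e' where e': "e' \<in> mod_hom B V (obj_map F Q)" "\<And>x. x \<in> carrier (obj_map F Q) \<Longrightarrow> e' (e x) = x"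
    "\<And>y. y \<in> carrier V \<Longrightarrow> e (e' y) = y"
    using mod_iso_inverse[OF e lFQ lV] by metis
  \<comment> \<open>\<open>r z\<close> sends the generator of \<open>U\<close> to \<open>z\<close>.
    Its image under \<open>F\<close>, followed by the isomorphisms from \<open>F Q\<close> to
    \<open>V\<close> and on to \<open>B\<close>, is the functional \<open>q z\<close> on
    \<open>P\<close>.\<close>
  define r where "r z = (\<lambda>u\<in>carrier U. \<kappa>A u \<odot>\<^bsub>Q\<^esub> z)" for z
  have r: "r z \<in> mod_hom A U Q" if "z \<in> carrier Q" for z
    unfolding r_def using that kappa_A' by (intro mod_homI lU) (auto simp: Q.lsmult_l_distr Q.lsmult_assoc)
  define q where "q z = compose (carrier P) \<kappa>B (compose (carrier P) e (arr_map F U Q (r z)))" for z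
  have Fr: "arr_map F U Q (r z) \<in> mod_hom B P (obj_map F Q)" if "z \<in> carrier Q" for z
    unfolding P_def by (rule F.arr[OF lU lQ r[OF that]])
  have q: "q z \<in> mod_hom B P (reg B)" if "z \<in> carrier Q" for z
    unfolding q_def by (rule mod_hom_comp[OF mod_hom_comp[OF Fr[OF that] eh(1) lP] kappa_B lP])
  have q_apply: "q z y = \<kappa>B (e (arr_map F U Q (r z) y))" if "y \<in> carrier P" for z y
    using that by (simp add: q_def compose_def)
  have gen: "\<one>\<^bsub>B\<^esub> \<in> trace B P"
  proof (rule ccontr)
    assume "\<one>\<^bsub>B\<^esub> \<notin> trace B P"
    then obtain N :: "('b, 'u) module" and \<pi> where lN: "left_module B N" and pi: "\<pi> \<in> mod_hom B (reg B) N"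
      and pi0: "\<And>z. z \<in> trace B P \<Longrightarrow> \<pi> z = \<zero>\<^bsub>N\<^esub>" and pi1: "\<pi> \<one>\<^bsub>B\<^esub> \<noteq> \<zero>\<^bsub>N\<^esub>"
      using P.trace_quotient[OF iB] by blast
    interpret N: left_module B N by (rule lN)
    obtain N' d where lN': "left_module A N'" and d: "d \<in> mod_iso B (obj_map F N') N" using ess[OF _ _ _ _ lN] by blast
    obtain d' where d': "d' \<in> mod_hom B N (obj_map F N')" "\<And>y. y \<in> carrier N \<Longrightarrow> d (d' y) = y"
      using mod_iso_inverse[OF d F.obj[OF lN'] lN] by metis
    \<comment> \<open>Fullness realises the projection, read as a map from \<open>F Q\<close> to
      \<open>F N'\<close>, as the image of some \<open>f\<close>. The values of \<open>q z\<close>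
      lie in the trace ideal, so \<open>f\<close> after \<open>r z\<close> has zero image and is
      zero; since \<open>r z\<close> hits \<open>z\<close>, this makes \<open>f\<close>
      vanish.\<close>
    have "compose (carrier (obj_map F Q)) d' (compose (carrier (obj_map F Q)) \<pi> (compose (carrier (obj_map F Q)) \<kappa>B e))
        \<in> mod_hom B (obj_map F Q) (obj_map F N')"
      by (intro mod_hom_comp[OF _ d'(1)] mod_hom_comp[OF _ pi] mod_hom_comp[OF eh(1) kappa_B] lFQ)
    from F.full[OF lQ lN' this] obtain f where f: "f \<in> mod_hom A Q N'"
      and Ff: "arr_map F Q N' f = compose (carrier (obj_map F Q)) d' (compose (carrier (obj_map F Q)) \<pi> (compose (carrier (obj_map F Q)) \<kappa>B e))"
      by blast
    have Ff': "arr_map F Q N' f w = d' (\<pi> (\<kappa>B (e w)))" if "w \<in> carrier (obj_map F Q)" for w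
      using that by (simp add: Ff compose_def)
    have "f z = \<zero>\<^bsub>N'\<^esub>" if z: "z \<in> carrier Q" for z
    proof -
      have "compose (carrier U) f (r z) (\<iota>A \<one>\<^bsub>A\<^esub>) = \<zero>\<^bsub>N'\<^esub>"
      proof (rule F.zero_if_arr_zero[OF lU lN' mod_hom_comp[OF r[OF z] f lU]])
        fix y assume y: "y \<in> carrier (obj_map F U)"
        then have yP: "y \<in> carrier P" by (simp add: P_def)
        have "arr_map F U N' (compose (carrier U) f (r z)) y = arr_map F Q N' f (arr_map F U Q (r z) y)"
          by (rule F.arr_comp[OF lU lQ lN' r[OF z] f y])
        also have "\<dots> = d' (\<pi> (q z y))" using mod_homD(1)[OF Fr[OF z] yP] yP by (simp add: Ff' q_apply)
        also have "\<dots> = \<zero>\<^bsub>obj_map F N'\<^esub>"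
          using pi0[OF P.trace_mem[OF q[OF z] yP]] mod_hom_zero[OF d'(1) lN F.obj[OF lN']] by simp
        finally show "arr_map F U N' (compose (carrier U) f (r z)) y = \<zero>\<^bsub>obj_map F N'\<^esub>" .
      qed (use iota_A' in simp)
      then show ?thesis using z iota_A' ki_A by (simp add: compose_def r_def)
    qed
    then have "f = (\<lambda>z\<in>carrier Q. \<zero>\<^bsub>N'\<^esub>)" by (intro mod_hom_eqI[OF f mod_hom_zero_map[OF lQ lN']]) simp
    then have z: "arr_map F Q N' f w = \<zero>\<^bsub>obj_map F N'\<^esub>" if "w \<in> carrier (obj_map F Q)" for w
      using that F.arr_zero[OF lQ lN'] by simp
    have w: "e' (\<iota>B \<one>\<^bsub>B\<^esub>) \<in> carrier (obj_map F Q)" using mod_homD(1)[OF e'(1)] iota_B' by simp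
    have "d' (\<pi> \<one>\<^bsub>B\<^esub>) = \<zero>\<^bsub>obj_map F N'\<^esub>"
      using z[OF w] Ff'[OF w] e'(3) iota_B' ki_B by simp
    moreover have "\<pi> \<one>\<^bsub>B\<^esub> \<in> carrier N" using mod_homD(1)[OF pi] by simp
    ultimately have "\<pi> \<one>\<^bsub>B\<^esub> = d \<zero>\<^bsub>obj_map F N'\<^esub>" using d'(2) by metis
    then show False using pi1 mod_hom_zero[OF mod_isoD(1)[OF d] F.obj[OF lN'] lN] by simp
  qed
  have gen': "\<one>\<^bsub>A\<^esub> \<in> trace A Q"
  proof (rule ccontr)
    assume "\<one>\<^bsub>A\<^esub> \<notin> trace A Q"
    then obtain N :: "('a, 'u) module" and \<pi> where lN: "left_module A N" and pi: "\<pi> \<in> mod_hom A (reg A) N"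
      and pi0: "\<And>z. z \<in> trace A Q \<Longrightarrow> \<pi> z = \<zero>\<^bsub>N\<^esub>" and pi1: "\<pi> \<one>\<^bsub>A\<^esub> \<noteq> \<zero>\<^bsub>N\<^esub>"
      using Q.trace_quotient[OF iA] by blast
    define p where "p = compose (carrier U) \<pi> \<kappa>A"
    have p: "p \<in> mod_hom A U N" unfolding p_def by (rule mod_hom_comp[OF kappa_A pi lU])
    have "arr_map F U N p y = \<zero>\<^bsub>obj_map F N\<^esub>" if y: "y \<in> carrier (obj_map F U)" for y
    proof -
      \<comment> \<open>\<open>s\<close> sends the generator of \<open>V\<close> to
        \<open>y\<close>, so by fullness \<open>y\<close> is a value of \<open>F h\<close> for some
        \<open>h\<close> from \<open>Q\<close> to \<open>U\<close>. Following \<open>h\<close> by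
        \<open>\<kappa>A\<close> gives a functional on \<open>Q\<close>, whose values lie in the
        trace ideal; hence \<open>p\<close> after \<open>h\<close> is zero and \<open>F p\<close>
        kills \<open>y\<close>.\<close>
      define s where "s = (\<lambda>v\<in>carrier V. \<kappa>B v \<odot>\<^bsub>P\<^esub> y)"
      have yP: "y \<in> carrier P" using y by (simp add: P_def)
      have "s \<in> mod_hom B V P" unfolding s_def
        using yP kappa_B' by (intro mod_homI lV) (auto simp: P.lsmult_l_distr P.lsmult_assoc)
      then have "compose (carrier (obj_map F Q)) s e \<in> mod_hom B (obj_map F Q) (obj_map F U)"
        unfolding P_def by (rule mod_hom_comp[OF eh(1) _ lFQ])
      from F.full[OF lQ lU this] obtain h where h: "h \<in> mod_hom A Q U"
        and Fh: "arr_map F Q U h = compose (carrier (obj_map F Q)) s e" by blast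
      have "compose (carrier Q) p h = (\<lambda>z\<in>carrier Q. \<zero>\<^bsub>N\<^esub>)"
      proof (rule mod_hom_eqI[OF mod_hom_comp[OF h p lQ] mod_hom_zero_map[OF lQ lN]])
        fix z assume z: "z \<in> carrier Q"
        have "compose (carrier Q) \<kappa>A h z \<in> trace A Q"
          by (rule Q.trace_mem[OF mod_hom_comp[OF h kappa_A lQ] z])
        then show "compose (carrier Q) p h z = (\<lambda>z\<in>carrier Q. \<zero>\<^bsub>N\<^esub>) z"
          using z pi0 mod_homD(1)[OF h z] by (simp add: compose_def p_def)
      qed
      note 0 = this
      have w: "e' (\<iota>B \<one>\<^bsub>B\<^esub>) \<in> carrier (obj_map F Q)" using mod_homD(1)[OF e'(1)] iota_B' by simp
      have "arr_map F U N p (arr_map F Q U h (e' (\<iota>B \<one>\<^bsub>B\<^esub>))) = \<zero>\<^bsub>obj_map F N\<^esub>"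
        using F.arr_comp[OF lQ lU lN h p w] w by (simp add: 0 F.arr_zero[OF lQ lN])
      moreover have "arr_map F Q U h (e' (\<iota>B \<one>\<^bsub>B\<^esub>)) = y"
        using w e'(3) iota_B' ki_B yP by (simp add: Fh compose_def s_def)
      ultimately show ?thesis by simp
    qed
    from F.zero_if_arr_zero[OF lU lN p this] have "p (\<iota>A \<one>\<^bsub>A\<^esub>) = \<zero>\<^bsub>N\<^esub>" using iota_A' by simp
    then show False using pi1 iota_A' ki_A by (simp add: p_def compose_def)
  qed
  obtain n :: nat and q1 x1 where q1: "\<And>i. q1 i \<in> mod_hom B P (reg B)" and x1: "\<And>i. x1 i \<in> carrier P"
    and sum1: "\<one>\<^bsub>B\<^esub> = (\<Oplus>\<^bsub>B\<^esub>i\<in>{..<n}. q1 i (x1 i))"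
    using P.trace_sum[OF gen] by blast
  obtain m :: nat and h z where h: "\<And>j. h j \<in> mod_hom A Q (reg A)" and z: "\<And>j. z j \<in> carrier Q"
    and sum2: "\<one>\<^bsub>A\<^esub> = (\<Oplus>\<^bsub>A\<^esub>j\<in>{..<m}. h j (z j))"
    using Q.trace_sum[OF gen'] by blast
  \<comment> \<open>\<open>g j\<close> and \<open>r (z j)\<close> run in opposite directions between
    \<open>Q\<close> and \<open>U\<close>, and \<open>sum2\<close> makes the composites on
    \<open>U\<close> add up to the identity. Their images under \<open>F\<close> factor through
    \<open>F Q\<close>, a copy of \<open>B\<close>, so each is a functional times the element
    \<open>x2 j\<close>: the sum becomes the dual basis expansion in \<open>P\<close>.\<close>
  define g where "g j = compose (carrier Q) \<iota>A (h j)" for j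
  have g: "g j \<in> mod_hom A Q U" for j unfolding g_def by (rule mod_hom_comp[OF h iota_A lQ])
  define p where "p j = compose (carrier V) (arr_map F Q U (g j)) e'" for j
  have p: "p j \<in> mod_hom B V P" for j
    unfolding p_def P_def by (rule mod_hom_comp[OF e'(1) F.arr[OF lQ lU g] lV])
  define x2 where "x2 j = p j (\<iota>B \<one>\<^bsub>B\<^esub>)" for j
  have x2: "x2 j \<in> carrier P" for j unfolding x2_def using mod_homD(1)[OF p] iota_B' by simp
  have qx: "q (z j) y \<odot>\<^bsub>P\<^esub> x2 j = arr_map F U U (compose (carrier U) (g j) (r (z j))) y" if y: "y \<in> carrier P" for j y
  proof -
    let ?w = "arr_map F U Q (r (z j)) y"
    have w: "?w \<in> carrier (obj_map F Q)" using mod_homD(1)[OF Fr[OF z] y] .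
    have ew: "e ?w \<in> carrier V" using mod_homD(1)[OF eh(1) w] .
    have "q (z j) y \<odot>\<^bsub>P\<^esub> x2 j = p j (\<kappa>B (e ?w) \<odot>\<^bsub>V\<^esub> \<iota>B \<one>\<^bsub>B\<^esub>)"
      unfolding x2_def q_apply[OF y] using ew kappa_B' iota_B' by (simp add: mod_homD(3)[OF p])
    also have "\<kappa>B (e ?w) \<odot>\<^bsub>V\<^esub> \<iota>B \<one>\<^bsub>B\<^esub> = e ?w"
      using ew kappa_B' iota_B'(3)[of "\<kappa>B (e ?w)" "\<one>\<^bsub>B\<^esub>"] ik_B by simp
    also have "p j (e ?w) = arr_map F Q U (g j) ?w" using ew w e'(2) by (simp add: p_def compose_def)
    also have "\<dots> = arr_map F U U (compose (carrier U) (g j) (r (z j))) y"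
      using F.arr_comp[OF lU lQ lU r[OF z] g] y by (simp add: P_def)
    finally show ?thesis .
  qed
  have sum_id: "(\<Oplus>\<^bsub>P\<^esub>j\<in>{..<m}. q (z j) y \<odot>\<^bsub>P\<^esub> x2 j) = y" if y: "y \<in> carrier P" for y
  proof -
    have gr: "compose (carrier U) (g j) (r (z j)) \<in> mod_hom A U U" for j by (rule mod_hom_comp[OF r[OF z] g lU])
    have hc: "h j (z j) \<in> carrier A" for j using mod_homD(1)[OF h z] by simp
    have "(\<lambda>u\<in>carrier U. \<Oplus>\<^bsub>U\<^esub>j\<in>{..<m}. compose (carrier U) (g j) (r (z j)) u) = mod_id U"
      unfolding mod_id_def
    proof (rule restrict_ext)
      fix u assume u: "u \<in> carrier U"
      have ku: "\<kappa>A u \<in> carrier A" using kappa_A' u by simp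
      have "(\<Oplus>\<^bsub>U\<^esub>j\<in>{..<m}. compose (carrier U) (g j) (r (z j)) u) = (\<Oplus>\<^bsub>U\<^esub>j\<in>{..<m}. \<iota>A (\<kappa>A u \<otimes>\<^bsub>A\<^esub> h j (z j)))"
        using u ku z hc mod_homD(3)[OF h] iota_A'
        by (intro U.M.finsum_cong') (auto simp: compose_def g_def r_def)
      also have "\<dots> = \<iota>A (\<Oplus>\<^bsub>A\<^esub>j\<in>{..<m}. \<kappa>A u \<otimes>\<^bsub>A\<^esub> h j (z j))"
        using ku hc iota_A'
        by (intro additive_finsum[symmetric, where h = \<iota>A] A.M.abelian_group_axioms U.M.abelian_group_axioms) auto
      also have "(\<Oplus>\<^bsub>A\<^esub>j\<in>{..<m}. \<kappa>A u \<otimes>\<^bsub>A\<^esub> h j (z j)) = \<kappa>A u"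
        using ku hc by (simp add: A.M.finsum_rdistr[symmetric] sum2[symmetric])
      finally show "(\<Oplus>\<^bsub>U\<^esub>j\<in>{..<m}. compose (carrier U) (g j) (r (z j)) u) = u" using ik_A[OF u] by simp
    qed
    note id = this
    have "(\<Oplus>\<^bsub>P\<^esub>j\<in>{..<m}. q (z j) y \<odot>\<^bsub>P\<^esub> x2 j) =
        arr_map F U U (\<lambda>u\<in>carrier U. \<Oplus>\<^bsub>U\<^esub>j\<in>{..<m}. compose (carrier U) (g j) (r (z j)) u) y"
      unfolding qx[OF y] unfolding P_def
      by (rule F.arr_sum[OF lU lU gr y[unfolded P_def], THEN conjunct1, symmetric])
    also have "\<dots> = y" unfolding id F.arr_id[OF lU] using y by (simp add: mod_id_def P_def)
    finally show ?thesis .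
  qed
  \<comment> \<open>Right multiplication by \<open>a\<close>, read on the copy \<open>U\<close> of
    the regular module. Composition reverses products, as \<open>alpha_mult\<close> demands.\<close>
  define \<rho> where "\<rho> a = (\<lambda>u\<in>carrier U. \<iota>A (\<kappa>A u \<otimes>\<^bsub>A\<^esub> a))" for a
  have rho: "\<rho> a \<in> mod_hom A U U" if "a \<in> carrier A" for a
    unfolding \<rho>_def using that kappa_A' iota_A'
    by (intro mod_homI lU) (auto simp: A.M.l_distr A.M.m_assoc)
  define \<alpha> where "\<alpha> a = arr_map F U U (\<rho> a)" for a
  \<comment> \<open>The families for the generator and for the projectivity condition have unrelated
    lengths \<open>n\<close> and \<open>m\<close>; \<open>Inl\<close> and \<open>Inr\<close> put
    them side by side in one index type.\<close>
  have "progenerator K A B P \<alpha> (Inl ` {..<n}) (Inr ` {..<m}) (case_sum q1 (q \<circ> z)) (case_sum x1 x2)"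
  proof (intro progenerator.intro progenerator_axioms.intro A B lP)
    show "\<alpha> a \<in> mod_hom B P P" if "a \<in> carrier A" for a
      unfolding \<alpha>_def P_def by (rule F.arr[OF lU lU rho[OF that]])
    show "\<alpha> \<one>\<^bsub>A\<^esub> y = y" if "y \<in> carrier P" for y
    proof -
      have "\<rho> \<one>\<^bsub>A\<^esub> = mod_id U" unfolding \<rho>_def mod_id_def using kappa_A' ik_A by (intro restrict_ext) simp
      then show ?thesis using F.arr_id[OF lU] that by (simp add: \<alpha>_def mod_id_def P_def)
    qed
    show "\<alpha> (a \<otimes>\<^bsub>A\<^esub> a') y = \<alpha> a' (\<alpha> a y)" if a: "a \<in> carrier A" "a' \<in> carrier A" and y: "y \<in> carrier P" for a a' y
    proof -
      have "\<rho> (a \<otimes>\<^bsub>A\<^esub> a') = compose (carrier U) (\<rho> a') (\<rho> a)"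
        unfolding \<rho>_def compose_def using a kappa_A' iota_A' ki_A by (intro restrict_ext) (simp add: A.M.m_assoc)
      then show ?thesis using F.arr_comp[OF lU lU lU rho rho] a y by (simp add: \<alpha>_def P_def)
    qed
    show "\<alpha> (a \<oplus>\<^bsub>A\<^esub> a') y = \<alpha> a y \<oplus>\<^bsub>P\<^esub> \<alpha> a' y" if a: "a \<in> carrier A" "a' \<in> carrier A" and y: "y \<in> carrier P" for a a' y
    proof -
      have "\<rho> (a \<oplus>\<^bsub>A\<^esub> a') = hom_add U U (\<rho> a) (\<rho> a')"
        unfolding hom_add_def using a kappa_A' iota_A' by (subst \<rho>_def, intro restrict_ext) (simp add: \<rho>_def A.M.r_distr)
      then show ?thesis using add[OF lU lU rho rho] a y by (simp add: \<alpha>_def hom_add_def P_def)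
    qed
    show "\<alpha> (c \<odot>\<^bsub>A\<^esub> a) y = (c \<odot>\<^bsub>B\<^esub> \<one>\<^bsub>B\<^esub>) \<odot>\<^bsub>P\<^esub> \<alpha> a y"
      if c: "c \<in> carrier K" and a: "a \<in> carrier A" and y: "y \<in> carrier P" for c a y
    proof -
      \<comment> \<open>Compatibility of \<open>F\<close> with scalars is used here and nowhere else
        in this proof; it is the origin of the \<open>K\<close>-linearity of \<open>phi\<close> and
        \<open>theta\<close>.\<close>
      have "\<rho> (c \<odot>\<^bsub>A\<^esub> a) = hom_scale A U U c (\<rho> a)"
        unfolding hom_scale_def using a c kappa_A' iota_A'(1) iota_A'(3)[symmetric]
        by (subst \<rho>_def, intro restrict_ext) (simp add: \<rho>_def A.smult_mult_left A.smult_mult_right)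
      then show ?thesis using scale[OF lU lU rho c] a y by (simp add: \<alpha>_def hom_scale_def P_def)
    qed
    show "a = a'" if a: "a \<in> carrier A" "a' \<in> carrier A" and eq: "\<alpha> a = \<alpha> a'" for a a'
    proof -
      have "\<rho> a = \<rho> a'" using F.faithful[OF lU lU rho rho] a eq by (simp add: \<alpha>_def)
      then have "\<rho> a (\<iota>A \<one>\<^bsub>A\<^esub>) = \<rho> a' (\<iota>A \<one>\<^bsub>A\<^esub>)" by simp
      then have "\<iota>A a = \<iota>A a'" using a iota_A' ki_A by (simp add: \<rho>_def)
      then show ?thesis using ki_A a by metis
    qed
    show "\<exists>a\<in>carrier A. \<alpha> a = f" if f: "f \<in> mod_hom B P P" for f
    proof -
      obtain f' where f': "f' \<in> mod_hom A U U" "arr_map F U U f' = f"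
        using F.full[OF lU lU] f unfolding P_def by blast
      \<comment> \<open>An endomorphism of the regular module is right multiplication by its value
        at the unit.\<close>
      let ?a = "\<kappa>A (f' (\<iota>A \<one>\<^bsub>A\<^esub>))"
      have a: "?a \<in> carrier A" "f' (\<iota>A \<one>\<^bsub>A\<^esub>) \<in> carrier U" using kappa_A' mod_homD(1)[OF f'(1)] iota_A' by simp_all
      have "\<rho> ?a = f'"
      proof (rule mod_hom_eqI[OF rho[OF a(1)] f'(1)])
        fix u assume u: "u \<in> carrier U"
        have k: "\<kappa>A u \<in> carrier A" using kappa_A' u by simp
        have "u = \<kappa>A u \<odot>\<^bsub>U\<^esub> \<iota>A \<one>\<^bsub>A\<^esub>" using iota_A'(3)[of "\<kappa>A u" "\<one>\<^bsub>A\<^esub>"] k ik_A[OF u] by simp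
        then have "f' u = \<kappa>A u \<odot>\<^bsub>U\<^esub> f' (\<iota>A \<one>\<^bsub>A\<^esub>)" using mod_homD(3)[OF f'(1) k, of "\<iota>A \<one>\<^bsub>A\<^esub>"] iota_A' by simp
        also have "\<dots> = \<rho> ?a u" using u k a iota_A'(3)[OF k a(1)] ik_A[OF a(2)] by (simp add: \<rho>_def)
        finally show "\<rho> ?a u = f' u" by simp
      qed
      then show ?thesis using a(1) f'(2) by (intro bexI[of _ ?a]) (simp_all add: \<alpha>_def)
    qed
    show "case_sum q1 (q \<circ> z) i \<in> mod_hom B P (reg B)" for i using q1 q z by (simp split: sum.split)
    show "case_sum x1 x2 i \<in> carrier P" for i using x1 x2 by (simp split: sum.split)
    show "(\<Oplus>\<^bsub>B\<^esub>k\<in>Inl ` {..<n}. case_sum q1 (q \<circ> z) k (case_sum x1 x2 k)) = \<one>\<^bsub>B\<^esub>"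
      using mod_homD(1)[OF q1 x1] sum1 by (subst B.M.add.finprod_reindex) auto
    show "(\<Oplus>\<^bsub>P\<^esub>k\<in>Inr ` {..<m}. case_sum q1 (q \<circ> z) k y \<odot>\<^bsub>P\<^esub> case_sum x1 x2 k) = y" if y: "y \<in> carrier P" for y
      using mod_homD(1)[OF q[OF z] y] x2 sum_id[OF y] by (subst P.M.add.finprod_reindex) auto
  qed auto
  then show ?thesis by blast
qed

theorem proposition3p17:
  fixes K :: "('k, 'x) ring_scheme"
    and A :: "('k, 'a, 'y) module_scheme"
    and B :: "('k, 'b, 'z) module_scheme"
  assumes "field K"
    and "k_algebra K A"
    and "k_algebra K B"
    and "universe_for TYPE('u) A"
    and "universe_for TYPE('u) B"
    and "morita_equivalent TYPE('u) K A B"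
  shows "homologically_smooth K A \<longleftrightarrow> homologically_smooth K B"
proof -
  obtain F :: "('a, 'b, 'u) mod_functor" where F: "is_equivalence A B F" "k_linear_functor K A B F"
    using assms(6) by (auto simp: morita_equivalent_def)
  obtain iA :: "'a \<Rightarrow> 'u" and iB :: "'b \<Rightarrow> 'u" where i: "inj_on iA (carrier A)" "inj_on iB (carrier B)"
    using assms(4,5) by (auto simp: universe_for_def)
  obtain P :: "('b, 'u) module" and \<alpha> and I J :: "(nat + nat) set" and q x where "progenerator K A B P \<alpha> I J q x"
    using equivalence_progenerator[OF assms(2,3) i F] by blast
  then interpret progenerator K A B P \<alpha> I J q x .
  interpret M: morita_algebras K A B I J phi theta by (rule morita_algebras)
  \<comment> \<open>The converse uses the same data with the two algebras exchanged, so the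
    equivalence is unpacked only once.\<close>
  interpret N: morita_algebras K B A J I theta phi by (rule M.swap)
  show ?thesis using M.homologically_smooth_transfer N.homologically_smooth_transfer by blast
qed

end
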